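(* Let $G$ be the $xy$-sum of connected graphs $G_1,G_2\in\mathcal G_{xy}^\circ$. If (i) $G_1\in\mathcal C_0^\circ(\widehat g^+)$ and (ii) $G_2\in\mathcal C_1^\circ(\widehat g^+)$, then $G\in\mathcal C_2^\circ(\widehat g^+)$. Conversely, every 2-connected graph $G\in\mathcal C_2^\circ(\widehat g^+)$ such that $\{x,y\}$ is a 2-vertex-cut is the $xy$-sum of connected graphs $G_1,G_2\in\mathcal G_{xy}^\circ$ satisfying (i) and (ii).
   Context: All graphs are finite and simple; after contracting an edge, parallel edges are replaced by single edges. The Euler genus $\widehat g(G)$ is the minimum Euler genus of a surface into which $G$ embeds. $\mathcal G_{xy}$ is the class of simple graphs with two distinguished vertices $x,y$ (terminals); $\mathcal G_{xy}^\circ$ the subclass with $x,y$ non-adjacent. The set $\mathcal M(G)$ of minor-operations consists of deletion of any edge and contraction of any edge other than $xy$ (contracting an edge incident with a terminal yields a terminal); $\mu G$ is the result. $G^+$ is $G$ with edge $xy$ added and $\widehat g^+(G)=\widehat g(G^+)$. For $G_1,G_2\in\mathcal G_{xy}$ with $V(G_1)\cap V(G_2)=\{x,y\}$, their $xy$-sum has vertex set $V(G_1)\cup V(G_2)$, edge set $E(G_1)\cup E(G_2)$ and terminals $x,y$. $G$ is $\widehat g^+$-critical if $\widehat g^+(\mu G)<\widehat g^+(G)$ for every $\mu\in\mathcal M(G)$; $\mathcal C_k^\circ(\widehat g^+)$ is the class of $\widehat g^+$-critical graphs $G\in\mathcal G_{xy}^\circ$ with $\widehat g^+(G)=k+1$.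 *)

theory Defs
  imports Main
begin

section \<open>Graphs\<close>

record 'a graph =
  verts :: "'a set"
  edges :: "'a set set"

definition simple_graph :: "'a graph \<Rightarrow> bool" where
  "simple_graph G \<longleftrightarrow> finite (verts G) \<and>
     (\<forall>e\<in>edges G. \<exists>u v. e = {u, v} \<and> u \<noteq> v \<and> u \<in> verts G \<and> v \<in> verts G)"

definition connected_graph :: "'a graph \<Rightarrow> bool" where
  "connected_graph G \<longleftrightarrow> verts G \<noteq> {} \<and>
     (\<forall>u\<in>verts G. \<forall>v\<in>verts G. (u, v) \<in> {(a, b). {a, b} \<in> edges G}\<^sup>*)"

definition delete_verts :: "'a set \<Rightarrow> 'a graph \<Rightarrow> 'a graph" where
  "delete_verts S G = \<lparr>verts = verts G - S, edges = {e \<in> edges G. e \<inter> S = {}}\<rparr>"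

definition vertex_cut :: "'a graph \<Rightarrow> 'a set \<Rightarrow> bool" where
  "vertex_cut G S \<longleftrightarrow> S \<subseteq> verts G \<and> verts G - S \<noteq> {} \<and> \<not> connected_graph (delete_verts S G)"

definition two_connected :: "'a graph \<Rightarrow> bool" where
  "two_connected G \<longleftrightarrow> card (verts G) \<ge> 3 \<and> connected_graph G \<and> (\<forall>v\<in>verts G. \<not> vertex_cut G {v})"

definition delete_edge :: "'a set \<Rightarrow> 'a graph \<Rightarrow> 'a graph" where
  "delete_edge e G = \<lparr>verts = verts G, edges = edges G - {e}\<rparr>"

text \<open>Contraction of the edge \<open>uv\<close>, where the merged vertex keeps the name \<open>u\<close>. Since the edges
  form a set of unordered pairs, parallel edges are replaced by single edges.\<close>

definition contract_edge :: "'a \<Rightarrow> 'a \<Rightarrow> 'a graph \<Rightarrow> 'a graph" where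
  "contract_edge u v G =
     \<lparr>verts = verts G - {v},
      edges = (\<lambda>e. (\<lambda>w. if w = v then u else w) ` e) ` (edges G - {{u, v}})\<rparr>"


section \<open>Closed surfaces and the Euler genus\<close>

text \<open>A closed surface is given as a finite collection of polygons whose sides are glued in pairs,
  the result being connected; every closed surface arises in this way. A flag is an end of a side
  of a polygon. \<open>opp\<close> sends it to the other end of the same side, \<open>turn\<close> to the end of the
  neighbouring side that lies at the same corner of the polygon, and \<open>glue\<close> to the end with which
  it is identified when the side is glued to its partner. Gluings in both directions are allowed,
  so that non-orientable surfaces are included. Polygons with one or two sides are allowed.\<close>

record polygon_gluing =
  flags :: "nat set"
  opp :: "nat \<Rightarrow> nat"
  turn :: "nat \<Rightarrow> nat"
  glue :: "nat \<Rightarrow> nat"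

definition orbit_classes :: "nat set \<Rightarrow> (nat \<Rightarrow> nat) set \<Rightarrow> nat set set" where
  "orbit_classes D fs = D // {(a, b). a \<in> D \<and> (\<exists>f\<in>fs. b = f a)}\<^sup>*"

definition free_involution_on :: "nat set \<Rightarrow> (nat \<Rightarrow> nat) \<Rightarrow> bool" where
  "free_involution_on D f \<longleftrightarrow> (\<forall>a\<in>D. f a \<in> D \<and> f a \<noteq> a \<and> f (f a) = a)"

text \<open>The last two conditions before connectedness say that \<open>glue\<close> matches whole sides, and that
  a side is never glued to itself.\<close>

definition closed_surface :: "polygon_gluing \<Rightarrow> bool" where
  "closed_surface S \<longleftrightarrow> finite (flags S) \<and>
     free_involution_on (flags S) (opp S) \<and>
     free_involution_on (flags S) (turn S) \<and>
     free_involution_on (flags S) (glue S) \<and>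
     (\<forall>a\<in>flags S. opp S (glue S a) = glue S (opp S a)) \<and>
     (\<forall>a\<in>flags S. glue S a \<noteq> opp S a) \<and>
     card (orbit_classes (flags S) {opp S, turn S, glue S}) = 1"

definition surface_verts :: "polygon_gluing \<Rightarrow> nat set set" where
  "surface_verts S = orbit_classes (flags S) {turn S, glue S}"

definition surface_edges :: "polygon_gluing \<Rightarrow> nat set set" where
  "surface_edges S = orbit_classes (flags S) {opp S, glue S}"

definition surface_faces :: "polygon_gluing \<Rightarrow> nat set set" where
  "surface_faces S = orbit_classes (flags S) {opp S, turn S}"

definition euler_char :: "polygon_gluing \<Rightarrow> int" where
  "euler_char S =
     int (card (surface_verts S)) - int (card (surface_edges S)) + int (card (surface_faces S))"

definition surface_euler_genus :: "polygon_gluing \<Rightarrow> int" where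
  "surface_euler_genus S = 2 - euler_char S"

text \<open>A graph drawn in a closed surface can be completed to a cell decomposition of that surface
  (in general with further vertices and edges), so we may take it to be a subgraph of the vertices
  and edges of the gluing. The embedding need not be cellular, and the graph need not be connected.
  As the graph is simple, injectivity on vertices makes different edges of the graph run along
  different edges of the surface.\<close>

definition embeds_in :: "'a graph \<Rightarrow> polygon_gluing \<Rightarrow> bool" where
  "embeds_in G S \<longleftrightarrow>
     (\<exists>f. inj_on f (verts G) \<and> f ` verts G \<subseteq> surface_verts S \<and>
        (\<forall>u v. {u, v} \<in> edges G \<longrightarrow> (\<exists>a\<in>flags S. a \<in> f u \<and> opp S a \<in> f v)))"

definition euler_genus :: "'a graph \<Rightarrow> nat" where
  "euler_genus G =
     (LEAST k. \<exists>S. closed_surface S \<and> embeds_in G S \<and> surface_euler_genus S = int k)"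


section \<open>Graphs with two terminals\<close>

definition G_xy :: "'a \<Rightarrow> 'a \<Rightarrow> 'a graph set" where
  "G_xy x y = {G. simple_graph G \<and> x \<noteq> y \<and> x \<in> verts G \<and> y \<in> verts G}"

definition G_xy_nonadj :: "'a \<Rightarrow> 'a \<Rightarrow> 'a graph set" where
  "G_xy_nonadj x y = {G \<in> G_xy x y. {x, y} \<notin> edges G}"

text \<open>The graphs \<open>\<mu>G\<close> for minor-operations \<open>\<mu>\<close>. An edge other than \<open>xy\<close> has an end \<open>v\<close> that is not
  a terminal; contracting it into the other end keeps the terminals. If neither end is a terminal,
  both (isomorphic) results occur.\<close>

definition minor_results :: "'a \<Rightarrow> 'a \<Rightarrow> 'a graph \<Rightarrow> 'a graph set" where
  "minor_results x y G =
     {delete_edge e G | e. e \<in> edges G} \<union>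
     {contract_edge u v G | u v. {u, v} \<in> edges G \<and> v \<noteq> x \<and> v \<noteq> y}"

definition add_xy :: "'a \<Rightarrow> 'a \<Rightarrow> 'a graph \<Rightarrow> 'a graph" where
  "add_xy x y G = \<lparr>verts = verts G, edges = insert {x, y} (edges G)\<rparr>"

definition euler_genus_plus :: "'a \<Rightarrow> 'a \<Rightarrow> 'a graph \<Rightarrow> nat" where
  "euler_genus_plus x y G = euler_genus (add_xy x y G)"

definition is_xy_sum :: "'a \<Rightarrow> 'a \<Rightarrow> 'a graph \<Rightarrow> 'a graph \<Rightarrow> 'a graph \<Rightarrow> bool" where
  "is_xy_sum x y G G1 G2 \<longleftrightarrow>
     G1 \<in> G_xy x y \<and> G2 \<in> G_xy x y \<and> verts G1 \<inter> verts G2 = {x, y} \<and>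
     G = \<lparr>verts = verts G1 \<union> verts G2, edges = edges G1 \<union> edges G2\<rparr>"

definition plus_critical :: "'a \<Rightarrow> 'a \<Rightarrow> 'a graph \<Rightarrow> bool" where
  "plus_critical x y G \<longleftrightarrow>
     (\<forall>H\<in>minor_results x y G. euler_genus_plus x y H < euler_genus_plus x y G)"

definition C_nonadj :: "'a \<Rightarrow> 'a \<Rightarrow> nat \<Rightarrow> 'a graph set" where
  "C_nonadj x y k =
     {G \<in> G_xy_nonadj x y. plus_critical x y G \<and> euler_genus_plus x y G = k + 1}"

end

theory Submission
  imports Defs
begin

text \<open>The Euler genus is additive for graphs \<open>G1\<close>, \<open>G2\<close> that share exactly an edge \<open>xy\<close>
  (Miller). For the upper bound, both surfaces are cut along \<open>xy\<close> and glued crosswise. For the lower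
  bound, start from a surface containing the union, delete all other edges, double \<open>xy\<close> so that
  each graph has its own copy, and colour each flag by the graph to which its edge belongs. From now on
  only \<open>turn\<close> is changed, by exchanging partners in two of its pairs; such an exchange changes the
  numbers \<open>V\<close> of vertices and \<open>F\<close> of faces by at most one. A one-coloured face segment with both
  ends at the same terminal is closed up to a face of its own, which does not decrease \<open>F - V\<close>. Once
  all segments run between \<open>x\<close> and \<open>y\<close>, they can be joined in pairs to form faces in such a way that
  each terminal has one vertex of each colour; this does not decrease \<open>F\<close> and adds at most two
  vertices. Merging the remaining copies of each vertex yields disjoint embeddings of \<open>G1\<close> and \<open>G2\<close>
  whose Euler genera add up to at most that of the original surface.

  A minor of an \<open>xy\<close>-sum is an \<open>xy\<close>-sum with a minor of a summand, so additivity turns criticality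
  of the sum into criticality of the summands and back. In the converse direction 2-connectedness
  provides the connectedness on which the lower bound relies.\<close>

section \<open>Connectivity classes of a relation\<close>

text \<open>While \<open>turn\<close> is changed, the edges stay fixed, so only \<open>V\<close>,
  \<open>F\<close> and the number of components matter. The final \<open>V\<close> is prescribed:
  one for each pair of vertex and colour that occurs, two more than at the start. It is therefore
  harmless that vertices split on the way, and a bound on \<open>F - V\<close> alone controls the
  final number of faces. The obstacle is that joining segments acts on both terminals at once:
  pairing the ends at \<open>x\<close> also pairs the opposite ends at \<open>y\<close>. A pairing
  that is good at \<open>x\<close> only may leave many vertices at \<open>y\<close>, and merging
  these afterwards can cost faces. One pairing is needed that is transitive with the arrangement
  around \<open>x\<close> and, at the same time, with the arrangement around \<open>y\<close>
  carried over to \<open>x\<close> along the segments; \<open>common_transitive_matching\<close>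
  provides it. Genera are summed over the components of a map because deleting edges can disconnect
  it.\<close>

definition conn :: "'a rel \<Rightarrow> 'a rel" where
  "conn E = (E \<union> E\<inverse>)\<^sup>*"

text \<open>Counts the classes that meet \<open>D\<close>. As \<open>conn\<close> lives on the whole
  type, a class may extend beyond \<open>D\<close>.\<close>

definition ncomp :: "'a set \<Rightarrow> 'a rel \<Rightarrow> nat" where
  "ncomp D E = card (D // conn E)"

definition gr :: "'a set \<Rightarrow> ('a \<Rightarrow> 'a) \<Rightarrow> 'a rel" where
  "gr D f = {(a, f a) | a. a \<in> D}"

lemma gr_iff [simp]: "(a, b) \<in> gr D f \<longleftrightarrow> a \<in> D \<and> b = f a"
  by (auto simp: gr_def)

lemma conn_refl [simp, intro]: "(a, a) \<in> conn E"
  by (simp add: conn_def)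

lemma conn_sym: "(a, b) \<in> conn E \<Longrightarrow> (b, a) \<in> conn E"
  unfolding conn_def by (metis converse_Un converse_converse rtrancl_converseI sup_commute)

lemma conn_sym_iff: "(a, b) \<in> conn E \<longleftrightarrow> (b, a) \<in> conn E"
  using conn_sym by metis

lemma conn_trans [trans]: "(a, b) \<in> conn E \<Longrightarrow> (b, c) \<in> conn E \<Longrightarrow> (a, c) \<in> conn E"
  unfolding conn_def by (rule rtrancl_trans)

lemma equiv_conn: "equiv UNIV (conn E)"
  by (auto intro!: equivI refl_onI symI transI intro: conn_sym conn_trans)

lemma conn_base: "(a, b) \<in> E \<Longrightarrow> (a, b) \<in> conn E"
  by (auto simp: conn_def)

lemma conn_base': "(a, b) \<in> E \<Longrightarrow> (b, a) \<in> conn E"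
  by (auto simp: conn_def)

lemma conn_induct [consumes 1, case_names refl step]:
  assumes "(a, b) \<in> conn E" "P a"
    and "\<And>c d. (a, c) \<in> conn E \<Longrightarrow> P c \<Longrightarrow> (c, d) \<in> E \<or> (d, c) \<in> E \<Longrightarrow> P d"
  shows "P b"
  using assms(1) unfolding conn_def
proof (induction rule: rtrancl_induct)
  case base then show ?case by (rule assms(2))
next
  case (step c d)
  show ?case
  proof (rule assms(3))
    show "(a, c) \<in> conn E" unfolding conn_def by (rule step(1))
    show "P c" by (rule step(3))
    show "(c, d) \<in> E \<or> (d, c) \<in> E" using step(2) by simp
  qed
qed

lemma conn_least:
  assumes "(a, b) \<in> conn E" "\<And>p q. (p, q) \<in> E \<Longrightarrow> (p, q) \<in> conn F"
  shows "(a, b) \<in> conn F"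
  using assms(1)
proof (induction rule: conn_induct)
  case (step c d)
  have "(c, d) \<in> conn F" using step(2) by (elim disjE) (rule assms(2) conn_sym[OF assms(2)], assumption)+
  with step(3) show ?case by (rule conn_trans)
qed simp

lemma conn_mono: "(a, b) \<in> conn E \<Longrightarrow> E \<subseteq> F \<Longrightarrow> (a, b) \<in> conn F"
  by (erule conn_least) (auto intro: conn_base)

text \<open>The usual way of showing that two elements are not connected: an invariant of the
  generating pairs tells them apart.\<close>

lemma conn_key:
  assumes "(a, b) \<in> conn E" "\<And>p q. (p, q) \<in> E \<Longrightarrow> k p = k q"
  shows "k a = k b"
  using assms(1) by (induction rule: conn_induct) (auto dest: assms(2))

lemma conn_closed:
  assumes "(a, b) \<in> conn E" "a \<in> D" "\<And>p q. (p, q) \<in> E \<Longrightarrow> p \<in> D \<longleftrightarrow> q \<in> D"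
  shows "b \<in> D"
  using conn_key[of a b E "\<lambda>p. p \<in> D"] assms by blast

lemma conn_map:
  assumes "(a, b) \<in> conn E" "\<And>p q. (p, q) \<in> E \<Longrightarrow> (g p, g q) \<in> conn F"
  shows "(g a, g b) \<in> conn F"
  using assms(1)
proof (induction rule: conn_induct)
  case (step c d)
  have "(g c, g d) \<in> conn F" using step(2) by (elim disjE) (rule assms(2) conn_sym[OF assms(2)], assumption)+
  with step(3) show ?case by (rule conn_trans)
qed simp

text \<open>No pair of \<open>E\<close> crosses the boundary of \<open>C\<close>, so a walk that
  starts in \<open>C\<close> uses only pairs inside \<open>C\<close>.\<close>

lemma conn_restrict:
  assumes "(a, b) \<in> conn E" "a \<in> C" "\<And>p q. (p, q) \<in> E \<Longrightarrow> p \<in> C \<longleftrightarrow> q \<in> C"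
    and "\<And>p q. (p, q) \<in> E \<Longrightarrow> p \<in> C \<Longrightarrow> q \<in> C \<Longrightarrow> (p, q) \<in> conn F"
  shows "(a, b) \<in> conn F"
proof -
  have "b \<in> C \<and> (a, b) \<in> conn F"
    using assms(1)
  proof (induction rule: conn_induct)
    case (step c d)
    have d: "d \<in> C" using step(2,3) assms(3) by blast
    have "(c, d) \<in> conn F \<or> (d, c) \<in> conn F" using step(2,3) d assms(4)[of c d] assms(4)[of d c] by auto
    then have "(c, d) \<in> conn F" using conn_sym[of d c F] by auto
    then show ?case using step(3) d conn_trans[of a c F d] by auto
  qed (simp add: assms(2))
  then show ?thesis by simp
qed

lemma class_eq_iff: "conn E `` {a} = conn E `` {b} \<longleftrightarrow> (a, b) \<in> conn E"
  using eq_equiv_class_iff[OF equiv_conn, of a b E] by simp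

lemma ncomp_image: "ncomp D E = card ((\<lambda>a. conn E `` {a}) ` D)"
  unfolding ncomp_def quotient_def by (rule arg_cong[of _ _ card]) auto

text \<open>On \<open>D\<close> the map \<open>g\<close> factors through \<open>f\<close>. The
  comparisons of \<open>ncomp\<close> with a labelling or with a coarser relation rest on
  this.\<close>

lemma card_image_factor_le:
  assumes "finite D" "\<And>a b. a \<in> D \<Longrightarrow> b \<in> D \<Longrightarrow> f a = f b \<Longrightarrow> g a = g b"
  shows "card (g ` D) \<le> card (f ` D)"
proof -
  have "g a = g (inv_into D f (f a))" if "a \<in> D" for a
    using that assms(2) by (metis f_inv_into_f imageI inv_into_into)
  then have "g ` D = (\<lambda>c. g (inv_into D f c)) ` f ` D" by (force simp: image_image)
  then show ?thesis by (simp add: assms(1) card_image_le)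
qed

lemma ncomp_key_le:
  assumes "finite D" "\<And>a b. a \<in> D \<Longrightarrow> b \<in> D \<Longrightarrow> k a = k b \<Longrightarrow> (a, b) \<in> conn E"
  shows "ncomp D E \<le> card (k ` D)"
  unfolding ncomp_image by (rule card_image_factor_le[OF assms(1)]) (simp only: class_eq_iff assms(2))

lemma ncomp_key_ge:
  assumes "finite D" "\<And>a b. a \<in> D \<Longrightarrow> b \<in> D \<Longrightarrow> (a, b) \<in> conn E \<Longrightarrow> k a = k b"
  shows "card (k ` D) \<le> ncomp D E"
  unfolding ncomp_image by (rule card_image_factor_le[OF assms(1)]) (simp only: class_eq_iff, rule assms(2))

lemma ncomp_key:
  assumes "finite D" "\<And>a b. a \<in> D \<Longrightarrow> b \<in> D \<Longrightarrow> (a, b) \<in> conn E \<longleftrightarrow> k a = k b"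
  shows "ncomp D E = card (k ` D)"
  using ncomp_key_le[of D k E] ncomp_key_ge[of D E k] assms by auto

lemma ncomp_cong:
  assumes "\<And>a b. a \<in> D \<Longrightarrow> b \<in> D \<Longrightarrow> (a, b) \<in> conn E \<longleftrightarrow> (a, b) \<in> conn F" "finite D"
  shows "ncomp D E = ncomp D F"
  using ncomp_key[of D E "\<lambda>a. conn F `` {a}"] assms by (simp add: class_eq_iff ncomp_image)

text \<open>\<open>g\<close> induces a bijection of the classes: the last assumption makes it well
  defined and injective, the one before it surjective.\<close>

lemma ncomp_transfer:
  assumes "finite D" "g ` D \<subseteq> D'" "\<And>d. d \<in> D' \<Longrightarrow> \<exists>a\<in>D. (g a, d) \<in> conn F"
    and "\<And>a b. a \<in> D \<Longrightarrow> b \<in> D \<Longrightarrow> (a, b) \<in> conn E \<longleftrightarrow> (g a, g b) \<in> conn F"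
  shows "ncomp D E = ncomp D' F"
proof -
  have "(\<lambda>d. conn F `` {d}) ` D' = (\<lambda>a. conn F `` {g a}) ` D"
  proof (intro equalityI subsetI)
    fix C assume "C \<in> (\<lambda>d. conn F `` {d}) ` D'"
    then obtain d where d: "d \<in> D'" "C = conn F `` {d}" by blast
    then obtain a where "a \<in> D" "(g a, d) \<in> conn F" using assms(3) by blast
    then have "C = conn F `` {g a}" using d class_eq_iff by metis
    then show "C \<in> (\<lambda>a. conn F `` {g a}) ` D" using \<open>a \<in> D\<close> by blast
  next
    fix C assume "C \<in> (\<lambda>a. conn F `` {g a}) ` D"
    then show "C \<in> (\<lambda>d. conn F `` {d}) ` D'" using assms(2) by blast
  qed
  moreover have "ncomp D E = card ((\<lambda>a. conn F `` {g a}) ` D)"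
    using assms(1,4) by (intro ncomp_key) (auto simp: class_eq_iff)
  ultimately show ?thesis by (simp add: ncomp_image)
qed

lemma ncomp_le:
  assumes "finite D" "\<And>a b. a \<in> D \<Longrightarrow> b \<in> D \<Longrightarrow> (a, b) \<in> conn E \<Longrightarrow> (a, b) \<in> conn F"
  shows "ncomp D F \<le> ncomp D E"
  unfolding ncomp_image by (rule card_image_factor_le[OF assms(1)]) (simp only: class_eq_iff assms(2))

lemma ncomp_1:
  assumes "finite D" "a \<in> D" "\<And>b. b \<in> D \<Longrightarrow> (a, b) \<in> conn E"
  shows "ncomp D E = 1"
proof -
  have "ncomp D E = card ((\<lambda>_. ()) ` D)"
    using assms by (intro ncomp_key) (auto intro: conn_trans conn_sym)
  also have "(\<lambda>_. ()) ` D = {()}" using assms(2) by blast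
  finally show ?thesis by simp
qed

lemma ncomp_1_conn:
  assumes "ncomp D E = 1" "a \<in> D" "b \<in> D"
  shows "(a, b) \<in> conn E"
proof -
  obtain C where C: "(\<lambda>a. conn E `` {a}) ` D = {C}"
    using assms(1) unfolding ncomp_image by (rule card_1_singletonE)
  have "conn E `` {a} \<in> {C}" "conn E `` {b} \<in> {C}"
    unfolding C[symmetric] by (rule imageI, fact)+
  then have "conn E `` {a} = conn E `` {b}" by (simp only: singleton_iff)
  then show ?thesis by (simp only: class_eq_iff)
qed

lemma ncomp_disjoint_union:
  assumes "finite D1" "finite D2"
    and "\<And>a b. a \<in> D1 \<Longrightarrow> b \<in> D2 \<Longrightarrow> (a, b) \<notin> conn E"
  shows "ncomp (D1 \<union> D2) E = ncomp D1 E + ncomp D2 E"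
  unfolding ncomp_image image_Un using assms
  by (intro card_Un_disjoint) (auto simp: class_eq_iff)

text \<open>A walk never has to use the new pair more than once, in one of its two
  directions.\<close>

lemma conn_insert:
  "(p, q) \<in> conn (insert (a, b) E) \<longleftrightarrow>
     (p, q) \<in> conn E \<or> (p, a) \<in> conn E \<and> (b, q) \<in> conn E \<or> (p, b) \<in> conn E \<and> (a, q) \<in> conn E"
  (is "_ \<longleftrightarrow> ?R p q")
proof
  assume "(p, q) \<in> conn (insert (a, b) E)"
  then show "?R p q"
  proof (induction rule: conn_induct)
    case (step c d)
    note tr = conn_trans[of p c E d] conn_trans[of b c E d] conn_trans[of a c E d]
    have "(c, d) \<in> conn E \<or> c = a \<and> d = b \<or> c = b \<and> d = a"
      using step(2) by (auto intro: conn_base conn_base')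
    then show ?case using step(3) tr conn_refl by metis
  qed simp
next
  have m: "(p, q) \<in> conn (insert (a, b) E)" if "(p, q) \<in> conn E" for p q
    using that by (rule conn_mono) auto
  have "(a, b) \<in> conn (insert (a, b) E)" "(b, a) \<in> conn (insert (a, b) E)"
    by (auto intro: conn_base conn_base')
  then show "?R p q \<Longrightarrow> (p, q) \<in> conn (insert (a, b) E)"
    using m[of p q] m[of p a] m[of b q] m[of p b] m[of a q]
      conn_trans[of p a _ b] conn_trans[of p b _ q] conn_trans[of p b _ a] conn_trans[of p a _ q]
    by blast
qed

lemma ncomp_insert_same:
  assumes "(a, b) \<in> conn E"
  shows "ncomp D (insert (a, b) E) = ncomp D E"
proof -
  have "conn (insert (a, b) E) = conn E"
  proof (intro equalityI subrelI)
    fix p q assume "(p, q) \<in> conn (insert (a, b) E)"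
    then show "(p, q) \<in> conn E"
      by (rule conn_least) (use assms in \<open>auto intro: conn_base\<close>)
  qed (simp add: conn_insert)
  then show ?thesis by (simp add: ncomp_def)
qed

lemma ncomp_insert_diff:
  assumes "finite D" "a \<in> D" "b \<in> D" "(a, b) \<notin> conn E"
  shows "ncomp D E = Suc (ncomp D (insert (a, b) E))"
proof -
  let ?c = "\<lambda>d. conn E `` {d}" and ?c' = "\<lambda>d. conn (insert (a, b) E) `` {d}"
  \<comment> \<open>The classes that the new pair does not touch. They occur on both sides, beside
    two classes before the insertion and one after it.\<close>
  define X where "X = ?c ` {d \<in> D. (d, a) \<notin> conn E \<and> (d, b) \<notin> conn E}"
  have fX: "finite X" using assms(1) by (simp add: X_def)
  have eq: "?c' d = ?c d" if "(d, a) \<notin> conn E" "(d, b) \<notin> conn E" for d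
    using that by (auto simp: conn_insert)
  have ab: "?c' d = ?c' a" if "(d, a) \<in> conn E \<or> (d, b) \<in> conn E" for d
    unfolding class_eq_iff conn_insert using that by auto
  have 1: "?c ` D = insert (?c a) (insert (?c b) X)"
  proof (intro equalityI subsetI)
    fix C assume "C \<in> ?c ` D"
    then obtain d where "d \<in> D" "C = ?c d" by blast
    then show "C \<in> insert (?c a) (insert (?c b) X)"
      unfolding X_def by (cases "(d, a) \<in> conn E"; cases "(d, b) \<in> conn E") (auto simp: class_eq_iff)
  qed (auto simp: X_def assms)
  have 2: "?c' ` D = insert (?c' a) X"
  proof (intro equalityI subsetI)
    fix C assume "C \<in> ?c' ` D"
    then obtain d where d: "d \<in> D" "C = ?c' d" by blast
    show "C \<in> insert (?c' a) X"
    proof (cases "(d, a) \<in> conn E \<or> (d, b) \<in> conn E")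
      case True then show ?thesis using d ab[of d] by simp
    next
      case False then show ?thesis using d eq[of d] by (auto simp: X_def)
    qed
  next
    fix C assume C: "C \<in> insert (?c' a) X"
    show "C \<in> ?c' ` D"
    proof (cases "C = ?c' a")
      case True then show ?thesis using assms(2) by blast
    next
      case False
      then obtain d where "d \<in> D" "(d, a) \<notin> conn E" "(d, b) \<notin> conn E" "C = ?c d"
        using C by (auto simp: X_def)
      then show ?thesis using eq[of d] by (metis imageI)
    qed
  qed
  have n: "?c a \<noteq> ?c b" "?c a \<notin> X" "?c b \<notin> X"
    using assms(4) conn_sym_iff[of a b E] by (auto simp: X_def class_eq_iff)
  have n': "?c' a \<notin> X"
  proof
    assume "?c' a \<in> X"
    then obtain d where "(d, a) \<notin> conn E" "?c' a = ?c d" by (auto simp: X_def)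
    moreover have "a \<in> ?c' a" by simp
    ultimately show False by simp
  qed
  show ?thesis unfolding ncomp_image 1 2 using n n' fX by simp
qed

lemma ncomp_insert_bounds:
  assumes "finite D" "a \<in> D" "b \<in> D"
  shows "ncomp D (insert (a, b) E) \<le> ncomp D E" "ncomp D E \<le> Suc (ncomp D (insert (a, b) E))"
  using ncomp_insert_same[of a b E D] ncomp_insert_diff[OF assms, of E] by linarith+

text \<open>The forest bound: starting from singletons, each pair lowers the number of classes by at
  most one.\<close>

lemma ncomp_ge:
  assumes "finite E" "finite D" "E \<subseteq> D \<times> D"
  shows "card D \<le> ncomp D E + card E"
  using assms(1,3)
proof (induction E rule: finite_induct)
  case empty
  have "conn {} = (Id :: 'a rel)" by (auto simp: conn_def)
  then have "ncomp D {} = card ((\<lambda>d. d) ` D)"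
    by (intro ncomp_key) (auto simp: assms(2))
  then show ?case by simp
next
  case (insert e E)
  obtain a b where "e = (a, b)" by force
  then show ?case using insert ncomp_insert_bounds(2)[OF assms(2), of a b E] by simp
qed

lemma card_classes:
  assumes "finite D" "\<And>d. d \<in> D \<Longrightarrow> conn E `` {d} \<subseteq> D"
  shows "card D = (\<Sum>C\<in>D // conn E. card C)"
proof -
  have "D = \<Union> (D // conn E)"
    unfolding quotient_def using assms(2) conn_refl by fastforce
  moreover have "card (\<Union> (D // conn E)) = (\<Sum>C\<in>D // conn E. card C)"
  proof (rule card_Union_disjoint)
    show "pairwise disjnt (D // conn E)"
      unfolding pairwise_def disjnt_def
    proof (intro ballI impI)
      fix A B assume "A \<in> D // conn E" "B \<in> D // conn E" "A \<noteq> B"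
      then have "A \<in> UNIV // conn E" "B \<in> UNIV // conn E" by (auto simp: quotient_def)
      then show "A \<inter> B = {}" using quotient_disj[OF equiv_conn] \<open>A \<noteq> B\<close> by blast
    qed
    show "finite C" if "C \<in> D // conn E" for C
      using that assms by (auto simp: quotient_def intro: finite_subset)
  qed
  ultimately show ?thesis by simp
qed

lemma ncomp_class_card_ge:
  assumes "finite D" "\<And>d. d \<in> D \<Longrightarrow> conn E `` {d} \<subseteq> D" "\<And>d. d \<in> D \<Longrightarrow> n \<le> card (conn E `` {d})"
  shows "n * ncomp D E \<le> card D"
proof -
  have "(\<Sum>C\<in>D // conn E. n) \<le> (\<Sum>C\<in>D // conn E. card C)"
    by (rule sum_mono) (auto simp: quotient_def assms(3))
  then show ?thesis using card_classes[OF assms(1,2)] by (simp add: ncomp_def mult.commute)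
qed

lemma ncomp_class_card_eq:
  assumes "finite D" "\<And>d. d \<in> D \<Longrightarrow> conn E `` {d} \<subseteq> D" "\<And>d. d \<in> D \<Longrightarrow> card (conn E `` {d}) = n"
  shows "n * ncomp D E = card D"
proof -
  have "(\<Sum>C\<in>D // conn E. n) = (\<Sum>C\<in>D // conn E. card C)"
    by (rule sum.cong) (auto simp: quotient_def assms(3))
  then show ?thesis using card_classes[OF assms(1,2)] by (simp add: ncomp_def mult.commute)
qed

section \<open>Matchings\<close>

definition matching :: "'a set \<Rightarrow> ('a \<Rightarrow> 'a) \<Rightarrow> bool" where
  "matching D f \<longleftrightarrow> (\<forall>a\<in>D. f a \<in> D \<and> f a \<noteq> a \<and> f (f a) = a)"

lemma matchingD:
  assumes "matching D f" "a \<in> D"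
  shows "f a \<in> D" "f a \<noteq> a" "f (f a) = a"
  using assms by (auto simp: matching_def)

lemma matching_cong: "matching D f \<Longrightarrow> (\<And>a. a \<in> D \<Longrightarrow> f a = g a) \<Longrightarrow> matching D g"
  by (auto simp: matching_def)

lemma matching_Un: "matching A f \<Longrightarrow> matching B f \<Longrightarrow> matching (A \<union> B) f"
  by (auto simp: matching_def)

lemma matching_Diff: "matching D f \<Longrightarrow> matching W f \<Longrightarrow> matching (D - W) f"
  unfolding matching_def by (metis Diff_iff)

lemma matching_iff: "matching D f \<Longrightarrow> W \<subseteq> D \<Longrightarrow> (\<And>a. a \<in> W \<Longrightarrow> f a \<in> W) \<Longrightarrow> matching W f"
  by (auto simp: matching_def)

lemma matching_inj: "matching D f \<Longrightarrow> a \<in> D \<Longrightarrow> b \<in> D \<Longrightarrow> f a = f b \<longleftrightarrow> a = b"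
  by (metis matching_def)

lemma matching_half:
  assumes "finite D" "matching D f"
  shows "\<exists>H. H \<inter> f ` H = {} \<and> H \<union> f ` H = D"
  using assms
proof (induction "card D" arbitrary: D rule: less_induct)
  case less
  show ?case
  proof (cases "D = {}")
    case True then show ?thesis by auto
  next
    case False
    then obtain a where a: "a \<in> D" by blast
    note f = matchingD[OF less(3)]
    have "matching (D - {a, f a}) f" by (intro matching_Diff less(3)) (use f[OF a] in \<open>auto simp: matching_def\<close>)
    moreover have "card (D - {a, f a}) < card D"
      using a less(2) by (intro psubset_card_mono) auto
    ultimately obtain H where H: "H \<inter> f ` H = {}" "H \<union> f ` H = D - {a, f a}"
      using less(1)[of "D - {a, f a}"] less(2) by auto
    have HD: "H \<subseteq> D - {a, f a}" using H(2) by (metis Un_upper1)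
    have "f a \<notin> f ` H"
    proof
      assume "f a \<in> f ` H"
      then obtain h where "h \<in> H" "f a = f h" by auto
      then show False using matching_inj[OF less(3) a, of h] HD by auto
    qed
    moreover have "a \<notin> f ` H" "f a \<notin> H" using H(2) HD by auto
    ultimately have "insert a H \<inter> f ` insert a H = {}" using H(1) f[OF a] by auto
    moreover have "insert a H \<union> f ` insert a H = insert a (insert (f a) (H \<union> f ` H))" by auto
    then have "insert a H \<union> f ` insert a H = D" unfolding H(2) using a f[OF a] by auto
    ultimately have "\<exists>H. H \<inter> f ` H = {} \<and> H \<union> f ` H = D" by (rule_tac exI conjI)+
    then show ?thesis by blast
  qed
qed

text \<open>One direction of each matched pair already generates the same classes. This halves the
  number of pairs to be counted in \<open>ncomp_ge\<close>.\<close>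

lemma matching_half_card:
  assumes "finite D" "matching D f"
  obtains H where "H \<subseteq> D" "card D = 2 * card H" "\<And>E. conn (gr H f \<union> E) = conn (gr D f \<union> E)" "f ` H \<subseteq> D"
proof -
  obtain H where H: "H \<inter> f ` H = {}" "H \<union> f ` H = D" using matching_half[OF assms] by blast
  have "finite H" using H(2) assms(1) finite_Un by metis
  have "inj_on f H" using matching_inj[OF assms(2)] H(2) by (intro inj_onI) blast
  then have "card (f ` H) = card H" by (rule card_image)
  then have "card D = 2 * card H"
    using card_Un_disjoint[of H "f ` H"] H \<open>finite H\<close> by simp
  moreover have "conn (gr H f \<union> E) = conn (gr D f \<union> E)" for E
  proof (intro equalityI subrelI)
    fix a b assume "(a, b) \<in> conn (gr D f \<union> E)"
    then show "(a, b) \<in> conn (gr H f \<union> E)"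
    proof (rule conn_least)
      fix p q assume pq: "(p, q) \<in> gr D f \<union> E"
      show "(p, q) \<in> conn (gr H f \<union> E)"
      proof (cases "(p, q) \<in> gr H f \<union> E")
        case True then show ?thesis by (rule conn_base)
      next
        case False
        with pq have "p \<in> D" "q = f p" "p \<notin> H" by auto
        then obtain h where h: "h \<in> H" "p = f h" using H(2) by blast
        then have "q = h" using \<open>q = f p\<close> matchingD(3)[OF assms(2), of h] H(2) by blast
        then have "(q, p) \<in> gr H f \<union> E" using h by simp
        then show ?thesis by (rule conn_base')
      qed
    qed
  next
    fix a b assume "(a, b) \<in> conn (gr H f \<union> E)"
    then show "(a, b) \<in> conn (gr D f \<union> E)" by (rule conn_mono) (use H(2) in auto)
  qed
  ultimately show ?thesis using that H(2) by blast
qed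

lemma matching_even: "finite D \<Longrightarrow> matching D f \<Longrightarrow> even (card D)"
  by (rule matching_half_card) auto

lemma gr_sym: "matching D f \<Longrightarrow> (p, q) \<in> gr D f \<Longrightarrow> (q, p) \<in> gr D f"
  by (auto simp: matching_def)

text \<open>The graph formed by a perfect matching \<open>t\<close> and a partial matching \<open>s\<close> consists of cycles and
  of paths whose ends are the elements unmatched by \<open>s\<close>: a component has even size, and too few
  edges to be connected if it contains more than two unmatched elements.\<close>

lemma path_partner:
  assumes "finite D" "matching D t" "W \<subseteq> D" "matching W s"
  obtains B where "matching (D - W) B"
    "\<And>a b. a \<in> D - W \<Longrightarrow> b \<in> D - W \<Longrightarrow> (a, b) \<in> conn (gr D t \<union> gr W s) \<longleftrightarrow> b = a \<or> b = B a"
proof -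
  let ?E = "gr D t \<union> gr W s"
  have cl: "p \<in> D \<longleftrightarrow> q \<in> D" if "(p, q) \<in> ?E" for p q
    using that assms(2,3,4) by (auto dest: matchingD)
  have ex: "\<exists>b. b \<noteq> a \<and> conn ?E `` {a} \<inter> (D - W) = {a, b}" if a: "a \<in> D - W" for a
  proof -
    define C where "C = conn ?E `` {a}"
    have CD: "C \<subseteq> D" using a conn_closed[of a _ ?E D, OF _ _ cl] by (auto simp: C_def)
    have fC: "finite C" using CD assms(1) finite_subset by blast
    have Ccl: "q \<in> C" if "p \<in> C" "(p, q) \<in> ?E" for p q
      using that conn_trans[of a p ?E q] conn_base[of p q ?E] unfolding C_def by blast
    have t: "matching C t" 
    proof (rule matching_iff[OF assms(2) CD])
      show "t p \<in> C" if "p \<in> C" for p using Ccl[OF that, of "t p"] that CD by auto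
    qed
    have s: "matching (C \<inter> W) s"
    proof (rule matching_iff[OF assms(4)])
      show "s p \<in> C \<inter> W" if "p \<in> C \<inter> W" for p
        using Ccl[of p "s p"] that matchingD(1)[OF assms(4), of p] by auto
    qed simp
    obtain H where H: "H \<subseteq> C" "card C = 2 * card H"
      "\<And>E. conn (gr H t \<union> E) = conn (gr C t \<union> E)" "t ` H \<subseteq> C"
      by (rule matching_half_card[OF fC t], rule that, assumption+)
    have fCW: "finite (C \<inter> W)" using fC by simp
    obtain K where K: "K \<subseteq> C \<inter> W" "card (C \<inter> W) = 2 * card K"
      "\<And>E. conn (gr K s \<union> E) = conn (gr (C \<inter> W) s \<union> E)" "s ` K \<subseteq> C \<inter> W"
      by (rule matching_half_card[OF fCW s], rule that, assumption+)
    have fHK: "finite H" "finite K" using H(1) K(1) fC finite_subset by blast+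
    have im: "gr H t = (\<lambda>h. (h, t h)) ` H" "gr K s = (\<lambda>h. (h, s h)) ` K" by auto
    have "card (gr H t \<union> gr K s) \<le> card (gr H t) + card (gr K s)" by (rule card_Un_le)
    also have "\<dots> \<le> card H + card K" unfolding im by (intro add_mono card_image_le fHK)
    finally have cHK: "card (gr H t \<union> gr K s) \<le> card H + card K" .
    have "card C \<le> ncomp C (gr H t \<union> gr K s) + card (gr H t \<union> gr K s)"
      by (rule ncomp_ge) (use H(1,4) K(1,4) fC fHK in \<open>auto simp: im\<close>)
    moreover have "ncomp C (gr H t \<union> gr K s) = 1"
    proof (rule ncomp_1[OF fC])
      show "a \<in> C" by (simp add: C_def)
      fix b assume "b \<in> C"
      then have "(a, b) \<in> conn ?E" by (simp add: C_def)
      then have "(a, b) \<in> conn (gr C t \<union> gr (C \<inter> W) s)"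
      proof (rule conn_restrict[where C = C])
        show "a \<in> C" by (simp add: C_def)
        show "p \<in> C \<longleftrightarrow> q \<in> C" if "(p, q) \<in> ?E" for p q
          using that Ccl[of p q] Ccl[of q p] gr_sym[OF assms(2), of p q] gr_sym[OF assms(4), of p q] by blast
        show "(p, q) \<in> conn (gr C t \<union> gr (C \<inter> W) s)" if "(p, q) \<in> ?E" "p \<in> C" "q \<in> C" for p q
          by (rule conn_base) (use that in auto)
      qed
      then have "(a, b) \<in> conn (gr H t \<union> gr (C \<inter> W) s)" by (simp only: H(3))
      then have "(a, b) \<in> conn (gr (C \<inter> W) s \<union> gr H t)" by (simp only: Un_commute)
      then have "(a, b) \<in> conn (gr K s \<union> gr H t)" by (simp only: K(3))
      then show "(a, b) \<in> conn (gr H t \<union> gr K s)" by (simp only: Un_commute)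
    qed
    ultimately have "card C \<le> 1 + card H + card K" using cHK by linarith
    then have "card C \<le> 2 + card (C \<inter> W)" using H(2) K(2) by linarith
    moreover have "card (C - W) + card (C \<inter> W) = card C"
      using card_Diff_subset_Int[of C W] fC card_mono[of C "C \<inter> W"] by simp
    moreover have "card (C - W) > 0" using a fC by (auto simp: card_gt_0_iff C_def)
    moreover have "even (card C)" "even (card (C \<inter> W))"
      using matching_even[OF fC t] matching_even[OF _ s] fC by auto
    ultimately have "card (C - W) = 2" by presburger
    then obtain p q where pq: "C - W = {p, q}" "p \<noteq> q" by (meson card_2_iff)
    have "a \<in> {p, q}" unfolding pq(1)[symmetric] using a by (simp add: C_def)
    then have "\<exists>b. b \<noteq> a \<and> C - W = {a, b}" unfolding pq(1) using pq(2) by (auto simp: insert_commute)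
    then obtain b where "b \<noteq> a" "C - W = {a, b}" by blast
    moreover have "C \<inter> (D - W) = C - W" using CD by auto
    ultimately show ?thesis unfolding C_def by metis
  qed
  then obtain B where B: "\<And>a. a \<in> D - W \<Longrightarrow> B a \<noteq> a \<and> conn ?E `` {a} \<inter> (D - W) = {a, B a}"
    by metis
  have iff: "(a, b) \<in> conn ?E \<longleftrightarrow> b = a \<or> b = B a" if "a \<in> D - W" "b \<in> D - W" for a b
    using B[OF that(1)] that(2) by auto
  have BD: "B a \<in> D - W" if "a \<in> D - W" for a using B[OF that] by auto
  have "matching (D - W) B"
    unfolding matching_def
  proof (intro ballI conjI)
    fix a assume a: "a \<in> D - W"
    show "B a \<in> D - W" "B a \<noteq> a" using BD a B by auto
    have "(a, B a) \<in> conn ?E" using iff[OF a BD[OF a]] by simp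
    then have "(B a, a) \<in> conn ?E" by (rule conn_sym)
    then show "B (B a) = a" using iff[OF BD[OF a] a] B[OF a] by auto
  qed
  then show ?thesis using that iff by blast
qed

section \<open>Exchanging partners in two pairs of a matching\<close>

definition swap_pairs :: "('a \<Rightarrow> 'a) \<Rightarrow> 'a \<Rightarrow> 'a \<Rightarrow> 'a \<Rightarrow> 'a" where
  "swap_pairs s a b = s(a := b, b := a, s a := s b, s b := s a)"

lemma swap_pairs_other: "d \<notin> {a, b, s a, s b} \<Longrightarrow> swap_pairs s a b d = s d"
  by (auto simp: swap_pairs_def)

lemma swap_pairs_values:
  assumes "matching D s" "a \<in> D" "b \<in> D" "b \<noteq> a" "b \<noteq> s a"
  shows "swap_pairs s a b a = b" "swap_pairs s a b b = a"
    "swap_pairs s a b (s a) = s b" "swap_pairs s a b (s b) = s a"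
  using matchingD[OF assms(1,2)] matchingD[OF assms(1,3)] assms(4,5) by (auto simp: swap_pairs_def)

lemma matching_quad: "matching D s \<Longrightarrow> a \<in> D \<Longrightarrow> b \<in> D \<Longrightarrow> matching {a, b, s a, s b} s"
  by (auto simp: matching_def)

lemma matching_swap_pairs:
  assumes "matching D s" "a \<in> D" "b \<in> D" "b \<noteq> a" "b \<noteq> s a"
  shows "matching D (swap_pairs s a b)"
proof -
  let ?Q = "{a, b, s a, s b}"
  have Q: "?Q \<subseteq> D" using assms matchingD by auto
  have "matching (D - ?Q) s" by (intro matching_Diff assms(1) matching_quad[OF assms(1)] assms(2,3))
  then have 1: "matching (D - ?Q) (swap_pairs s a b)"
    by (rule matching_cong) (auto simp: swap_pairs_other)
  have "s a \<noteq> s b" using matching_inj[OF assms(1,2,3)] assms(4) by auto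
  then have 2: "matching ?Q (swap_pairs s a b)"
    unfolding matching_def by (simp add: swap_pairs_values[OF assms]) (use assms in auto)
  have "D - ?Q \<union> ?Q = D" using Q by blast
  then show ?thesis using matching_Un[OF 1 2] by simp
qed

text \<open>Before and after the exchange the relation is a common remainder together with two
  pairs, so the effect of an exchange can be read off from insertions into the remainder.\<close>

lemma conn_swap_pairs_sets:
  assumes "matching D s" "a \<in> D" "b \<in> D" "b \<noteq> a" "b \<noteq> s a"
  defines "Q \<equiv> {a, b, s a, s b}"
  shows "conn (gr D s \<union> E) = conn (insert (a, s a) (insert (b, s b) (gr (D - Q) s \<union> E)))"
    "conn (gr D (swap_pairs s a b) \<union> E) = conn (insert (a, b) (insert (s a, s b) (gr (D - Q) s \<union> E)))"
proof -
  have QD: "Q \<subseteq> D" using assms matchingD by auto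
  have "(p, q) \<in> conn (insert (a, s a) (insert (b, s b) (gr (D - Q) s \<union> E)))"
    if "(p, q) \<in> gr D s \<union> E" for p q
  proof (cases "p \<in> Q \<and> (p, q) \<notin> E")
    case True
    then have "q = s p" using that by auto
    with True consider "(p, q) = (a, s a)" | "(p, q) = (b, s b)" | "(q, p) = (a, s a)" | "(q, p) = (b, s b)"
      using matchingD[OF assms(1)] assms(2,3) unfolding Q_def by auto
    then show ?thesis by cases (auto intro: conn_base conn_base')
  next
    case False then show ?thesis using that by (intro conn_base) auto
  qed
  moreover have "(p, q) \<in> conn (gr D s \<union> E)"
    if "(p, q) \<in> insert (a, s a) (insert (b, s b) (gr (D - Q) s \<union> E))" for p q
    by (rule conn_base) (use that assms(2,3) in auto)
  ultimately show "conn (gr D s \<union> E) = conn (insert (a, s a) (insert (b, s b) (gr (D - Q) s \<union> E)))"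
    by (intro equalityI subrelI) (erule conn_least, blast)+
  let ?s = "swap_pairs s a b"
  note v = swap_pairs_values[OF assms(1-5)]
  have "(p, q) \<in> conn (insert (a, b) (insert (s a, s b) (gr (D - Q) s \<union> E)))"
    if "(p, q) \<in> gr D ?s \<union> E" for p q
  proof (cases "p \<in> Q \<and> (p, q) \<notin> E")
    case True
    then have "q = ?s p" using that by auto
    with True consider "(p, q) = (a, b)" | "(p, q) = (s a, s b)" | "(q, p) = (a, b)" | "(q, p) = (s a, s b)"
      using v unfolding Q_def by auto
    then show ?thesis by cases (auto intro: conn_base conn_base')
  next
    case False then show ?thesis using that by (intro conn_base) (auto simp: Q_def swap_pairs_other)
  qed
  moreover have "(p, q) \<in> conn (gr D ?s \<union> E)"
    if "(p, q) \<in> insert (a, b) (insert (s a, s b) (gr (D - Q) s \<union> E))" for p q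
    by (rule conn_base) (use that assms(2,3) QD v in \<open>auto simp: Q_def swap_pairs_other\<close>)
  ultimately show "conn (gr D ?s \<union> E) = conn (insert (a, b) (insert (s a, s b) (gr (D - Q) s \<union> E)))"
    by (intro equalityI subrelI) (erule conn_least, blast)+
qed

text \<open>Without the two pairs, the union of the matchings has four path ends, and
  \<open>path_partner\<close> joins them in one of three ways. Either each old pair closes a path of
  its own, so that two cycles become one; or each new pair does, so that one cycle becomes two; or
  neither happens, and one cycle remains one.\<close>

lemma swap_pairs_cases:
  assumes "finite D" "matching D t" "matching D s" "a \<in> D" "b \<in> D" "b \<noteq> a" "b \<noteq> s a"
  defines "r \<equiv> gr (D - {a, b, s a, s b}) s \<union> gr D t"
  defines "n \<equiv> ncomp D (gr D s \<union> gr D t)"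
  defines "n' \<equiv> ncomp D (gr D (swap_pairs s a b) \<union> gr D t)"
  obtains
    (apart) "(a, s a) \<in> conn r" "(b, s b) \<in> conn r" "(a, b) \<notin> conn (gr D s \<union> gr D t)" "n = Suc n'"
  | (along) "(a, b) \<in> conn r" "(s a, s b) \<in> conn r" "(a, s a) \<notin> conn r" "n' = Suc n"
  | (cross) "(a, s b) \<in> conn r" "(s a, b) \<in> conn r" "(a, b) \<notin> conn r" "(a, s a) \<notin> conn r" "n' = n"
proof -
  let ?Q = "{a, b, s a, s b}"
  have QD: "?Q \<subseteq> D" using assms matchingD by auto
  then have DQ: "D - (D - ?Q) = ?Q" by auto
  have sab: "s a \<noteq> s b" "s a \<noteq> a" "s b \<noteq> b" "s b \<noteq> a" "s a \<in> D" "s b \<in> D"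
    using matching_inj[OF assms(3,4,5)] assms(6,7) matchingD[OF assms(3,4)] matchingD[OF assms(3,5)] by auto
  have "matching (D - ?Q) s" by (intro matching_Diff assms(3) matching_quad[OF assms(3)] assms(4,5))
  then obtain B where B: "matching ?Q B"
    "\<And>p q. p \<in> ?Q \<Longrightarrow> q \<in> ?Q \<Longrightarrow> (p, q) \<in> conn r \<longleftrightarrow> q = p \<or> q = B p"
    using path_partner[OF assms(1,2), of "D - ?Q" s] unfolding r_def DQ Un_commute[of "gr D t"] by blast
  have n: "n = ncomp D (insert (a, s a) (insert (b, s b) r))"
    and n': "n' = ncomp D (insert (a, b) (insert (s a, s b) r))"
    unfolding n_def n'_def r_def ncomp_def using conn_swap_pairs_sets[OF assms(3-7)] by simp_all
  have cE: "conn (gr D s \<union> gr D t) = conn (insert (a, s a) (insert (b, s b) r))"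
    unfolding r_def using conn_swap_pairs_sets[OF assms(3-7)] by simp
  note same = ncomp_insert_same
  note diff = ncomp_insert_diff[OF assms(1)]
  note Bi = matchingD[OF B(1)]
  have "B a = s a \<or> B a = b \<or> B a = s b" using Bi[of a] by auto
  then consider "B a = s a" | "B a = b" | "B a = s b" by blast
  then show ?thesis
  proof cases
    case 1
    then have "B b = s b" using Bi[of b] Bi[of a] Bi[of "s a"] assms(6,7) sab by auto
    have c: "(a, s a) \<in> conn r" "(b, s b) \<in> conn r" "(a, b) \<notin> conn r" "(s a, s b) \<notin> conn r"
      "(s a, b) \<notin> conn r" "(a, s b) \<notin> conn r"
      using B(2) 1 \<open>B b = s b\<close> Bi[of a] assms(6,7) sab by auto
    have "n = ncomp D r" unfolding n using c by (simp add: same conn_insert)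
    moreover have "ncomp D r = Suc (ncomp D (insert (s a, s b) r))" by (rule diff) (use c sab in auto)
    moreover have "ncomp D (insert (a, b) (insert (s a, s b) r)) = ncomp D (insert (s a, s b) r)"
      by (rule same) (use c conn_sym[OF c(2)] in \<open>auto simp: conn_insert\<close>)
    moreover have "(a, b) \<notin> conn (gr D s \<union> gr D t)"
      unfolding cE conn_insert using c conn_sym_iff by metis
    ultimately show ?thesis using apart c n n' by simp
  next
    case 2
    then have "B (s a) = s b" using Bi[of b] Bi[of a] Bi[of "s a"] assms(6,7) sab by auto
    have c: "(a, b) \<in> conn r" "(s a, s b) \<in> conn r" "(a, s a) \<notin> conn r" "(b, s b) \<notin> conn r"
      "(s a, b) \<notin> conn r" "(a, s b) \<notin> conn r"
      using B(2) 2 \<open>B (s a) = s b\<close> Bi[of a] assms(6,7) sab by auto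
    have "n' = ncomp D r" unfolding n' using c by (simp add: same conn_insert)
    moreover have "ncomp D r = Suc (ncomp D (insert (b, s b) r))" by (rule diff) (use c sab assms in auto)
    moreover have "ncomp D (insert (a, s a) (insert (b, s b) r)) = ncomp D (insert (b, s b) r)"
      by (rule same) (use c conn_sym[OF c(2)] in \<open>auto simp: conn_insert\<close>)
    ultimately show ?thesis using along c n by simp
  next
    case 3
    then have "B (s a) = b" using Bi[of "s b"] Bi[of a] Bi[of "s a"] assms(6,7) sab by auto
    have c: "(a, s b) \<in> conn r" "(s a, b) \<in> conn r" "(a, s a) \<notin> conn r" "(b, s b) \<notin> conn r"
      "(s a, s b) \<notin> conn r" "(a, b) \<notin> conn r"
      using B(2) 3 \<open>B (s a) = b\<close> Bi[of a] Bi[of "s a"] assms(6,7) sab by auto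
    have "ncomp D r = Suc (ncomp D (insert (s a, s b) r))" by (rule diff) (use c sab assms in auto)
    moreover have "ncomp D r = Suc (ncomp D (insert (b, s b) r))" by (rule diff) (use c sab assms in auto)
    moreover have "ncomp D (insert (a, s a) (insert (b, s b) r)) = ncomp D (insert (b, s b) r)"
      by (rule same) (use c conn_sym[OF c(2)] in \<open>auto simp: conn_insert\<close>)
    moreover have "ncomp D (insert (a, b) (insert (s a, s b) r)) = ncomp D (insert (s a, s b) r)"
      by (rule same) (use c conn_sym[OF c(2)] in \<open>auto simp: conn_insert\<close>)
    ultimately show ?thesis using cross c n n' by simp
  qed
qed

context
  fixes D :: "'a set" and t s :: "'a \<Rightarrow> 'a" and a b :: 'a
  assumes asm: "finite D" "matching D t" "matching D s" "a \<in> D" "b \<in> D"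
begin

lemma ncomp_swap_pairs_le:
  assumes "b \<noteq> a" "b \<noteq> s a"
  shows "ncomp D (gr D (swap_pairs s a b) \<union> gr D t) \<le> Suc (ncomp D (gr D s \<union> gr D t))"
    "ncomp D (gr D s \<union> gr D t) \<le> Suc (ncomp D (gr D (swap_pairs s a b) \<union> gr D t))"
  by (rule swap_pairs_cases[OF asm assms]; simp)+

text \<open>Among the three cases only \<open>apart\<close> is compatible with \<open>a\<close> and
  \<open>b\<close> lying in different orbits.\<close>

lemma ncomp_swap_pairs_merge:
  assumes "(a, b) \<notin> conn (gr D s \<union> gr D t)"
  shows "b \<noteq> a" "b \<noteq> s a" "ncomp D (gr D s \<union> gr D t) = Suc (ncomp D (gr D (swap_pairs s a b) \<union> gr D t))"
proof -
  show ne: "b \<noteq> a" "b \<noteq> s a" using assms asm(4) by (auto intro: conn_base)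
  have r: "(p, q) \<in> conn (gr D s \<union> gr D t)" if "(p, q) \<in> conn (gr (D - {a, b, s a, s b}) s \<union> gr D t)" for p q
    using that by (rule conn_mono) auto
  have b: "(s b, b) \<in> conn (gr D s \<union> gr D t)" by (rule conn_base') (simp add: asm)
  show "ncomp D (gr D s \<union> gr D t) = Suc (ncomp D (gr D (swap_pairs s a b) \<union> gr D t))"
  proof (rule swap_pairs_cases[OF asm ne])
    assume "(a, b) \<in> conn (gr (D - {a, b, s a, s b}) s \<union> gr D t)"
    from r[OF this] show ?thesis using assms by simp
  next
    assume "(a, s b) \<in> conn (gr (D - {a, b, s a, s b}) s \<union> gr D t)"
    from conn_trans[OF r[OF this] b] show ?thesis using assms by simp
  qed
qed

text \<open>A path from \<open>a\<close> to \<open>b\<close> that avoids both pairs leaves only the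
  case \<open>along\<close>.\<close>

lemma ncomp_swap_pairs_split:
  assumes "b \<noteq> a" "b \<noteq> s a" "(a, b) \<in> conn (gr (D - {a, b, s a, s b}) s \<union> gr D t)"
  shows "ncomp D (gr D (swap_pairs s a b) \<union> gr D t) = Suc (ncomp D (gr D s \<union> gr D t))"
proof (rule swap_pairs_cases[OF asm assms(1,2)])
  assume "(a, b) \<notin> conn (gr D s \<union> gr D t)"
  moreover have "(a, b) \<in> conn (gr D s \<union> gr D t)" using assms(3) by (rule conn_mono) auto
  ultimately show ?thesis by simp
qed (use assms in auto)

end

text \<open>Only \<open>along\<close> creates an orbit. It cannot occur for \<open>b\<close> and for
  \<open>s b\<close>: the remainder is the same in both cases, and \<open>a\<close> would be
  connected with \<open>s a\<close> in it.\<close>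

lemma ncomp_swap_pairs_choice:
  assumes "finite D" "matching D t" "matching D s" "a \<in> D" "b \<in> D" "b \<noteq> a" "b \<noteq> s a"
  shows "ncomp D (gr D (swap_pairs s a b) \<union> gr D t) \<le> ncomp D (gr D s \<union> gr D t) \<or>
    ncomp D (gr D (swap_pairs s a (s b)) \<union> gr D t) \<le> ncomp D (gr D s \<union> gr D t)"
proof (rule swap_pairs_cases[OF assms])
  let ?r = "conn (gr (D - {a, b, s a, s b}) s \<union> gr D t)"
  assume ab: "(a, b) \<in> ?r" "(s a, s b) \<in> ?r" "(a, s a) \<notin> ?r"
  have sb: "s b \<in> D" "s b \<noteq> a" "s b \<noteq> s a" "s (s b) = b"
    using matchingD[OF assms(3)] matching_inj[OF assms(3)] assms(4-7) by metis+
  have eq: "{a, s b, s a, s (s b)} = {a, b, s a, s b}" using sb by auto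
  show ?thesis
  proof (rule swap_pairs_cases[OF assms(1-4) sb(1-3)], unfold eq)
    assume "(a, s b) \<in> ?r"
    then have "(a, s a) \<in> ?r" using conn_trans conn_sym[OF ab(2)] by metis
    then show ?thesis using ab by simp
  qed auto
qed auto

text \<open>For two matchings, the number of cycles in their union. Depending on which two of the
  three flag involutions are taken, these are the vertices, edges or faces of a map.\<close>

abbreviation orbs :: "'a set \<Rightarrow> ('a \<Rightarrow> 'a) \<Rightarrow> ('a \<Rightarrow> 'a) \<Rightarrow> nat" where
  "orbs D f g \<equiv> ncomp D (gr D f \<union> gr D g)"

lemma orbs_commute: "orbs D f g = orbs D g f"
  by (simp add: Un_commute)

section \<open>Improving a matching by repeated exchanges\<close>

lemma swap_pairs_key:
  assumes "matching D s" "a \<in> D" "b \<in> D" "b \<noteq> a" "b \<noteq> s a" "key a = key b" "key (s a) = key (s b)"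
    and "d \<in> D" "d \<notin> {a, b, s a, s b} \<Longrightarrow> key (s d) = key d"
  shows "key (swap_pairs s a b d) = key d"
  using swap_pairs_values[OF assms(1-5)] swap_pairs_other[of d a b s] assms(6-9)
  by (cases "d \<in> {a, b, s a, s b}") auto

lemma ex_le_trans:
  fixes f :: "'a \<Rightarrow> int"
  assumes "\<exists>s. A s \<and> B s \<and> C s \<and> y \<le> f s" "x \<le> y"
  shows "\<exists>s. A s \<and> B s \<and> C s \<and> x \<le> f s"
  using assms by (meson order_trans)

text \<open>Each exchange joins two orbits of \<open>s1\<close> and \<open>s2\<close> that have the
  same key. It lowers their number by exactly one and the number of orbits of \<open>s1\<close> and
  \<open>s0\<close> by at most one, so the difference cannot drop.\<close>

lemma merge_orbits:
  assumes "finite D" "matching D s0" "matching D s2" "\<And>d. d \<in> D \<Longrightarrow> key (s2 d) = key d"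
    and "matching D s1" "\<forall>d\<in>D. key (s1 d) = key d"
  shows "\<exists>s. matching D s \<and> (\<forall>d\<in>D. key (s d) = key d) \<and>
    (\<forall>a\<in>D. \<forall>b\<in>D. (a, b) \<in> conn (gr D s \<union> gr D s2) \<longleftrightarrow> key a = key b) \<and>
    int (orbs D s1 s0) - int (orbs D s1 s2) \<le> int (orbs D s s0) - int (orbs D s s2)"
  using assms(5,6)
proof (induction "orbs D s1 s2" arbitrary: s1 rule: less_induct)
  case less
  have pres: "key a = key b" if "(a, b) \<in> conn (gr D s1 \<union> gr D s2)" for a b
    using that by (rule conn_key) (use less(3) assms(4) in auto)
  show ?case
  proof (cases "\<forall>a\<in>D. \<forall>b\<in>D. key a = key b \<longrightarrow> (a, b) \<in> conn (gr D s1 \<union> gr D s2)")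
    case True
    then have "\<forall>a\<in>D. \<forall>b\<in>D. (a, b) \<in> conn (gr D s1 \<union> gr D s2) \<longleftrightarrow> key a = key b"
      using pres by blast
    then show ?thesis using less(2,3) by (intro exI[of _ s1] conjI) simp_all
  next
    case False
    then obtain a b where ab: "a \<in> D" "b \<in> D" "key a = key b" "(a, b) \<notin> conn (gr D s1 \<union> gr D s2)" by blast
    note m = ncomp_swap_pairs_merge[OF assms(1,3) less(2) ab(1,2,4)]
    let ?s = "swap_pairs s1 a b"
    have f: "matching D ?s" using matching_swap_pairs less(2) ab m by metis
    have ka: "key (s1 a) = key (s1 b)" using less(3)[rule_format, OF ab(1)] less(3)[rule_format, OF ab(2)] ab(3) by simp
    have k': "key (?s d) = key d" if "d \<in> D" for d
      using swap_pairs_key[OF less(2) ab(1,2) m(1,2) ab(3) ka that] less(3)[rule_format, OF that] by blast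
    then have k: "\<forall>d\<in>D. key (?s d) = key d" by blast
    have "orbs D ?s s2 < orbs D s1 s2" using m(3) by simp
    note IH = less(1)[OF this f k]
    have "orbs D s1 s0 \<le> Suc (orbs D ?s s0)"
      using ncomp_swap_pairs_le(2)[OF assms(1,2) less(2) ab(1,2) m(1,2)] .
    then have "int (orbs D s1 s0) - int (orbs D s1 s2) \<le> int (orbs D ?s s0) - int (orbs D ?s s2)"
      using m(3) by linarith
    with IH show ?thesis by (rule ex_le_trans)
  qed
qed

text \<open>A segment is a path formed by \<open>s0\<close> and the part of \<open>s\<close> that
  keeps the colour; it ends at flags where \<open>s\<close> changes the colour. Closing a segment
  removes its ends from these mixed flags and creates no new ones, so their number is the induction
  measure.\<close>

lemma resolve_returning_segments:
  fixes col :: "'a \<Rightarrow> bool"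
  assumes "finite D" "matching D s0" "matching D s2" "\<And>d. d \<in> D \<Longrightarrow> col (s0 d) = col d"
    and "matching D s1" "\<forall>d\<in>D. lab (s1 d) = lab d"
  shows "\<exists>s. matching D s \<and> (\<forall>d\<in>D. lab (s d) = lab d) \<and>
    (\<forall>a\<in>D. \<forall>b\<in>D. col (s a) \<noteq> col a \<longrightarrow> col (s b) \<noteq> col b \<longrightarrow> a \<noteq> b \<longrightarrow>
      (a, b) \<in> conn (gr D s0 \<union> gr {d \<in> D. col (s d) = col d} s) \<longrightarrow> lab a \<noteq> lab b) \<and>
    int (orbs D s1 s0) - int (orbs D s1 s2) \<le> int (orbs D s s0) - int (orbs D s s2)"
  using assms(5,6)
proof (induction "card {d \<in> D. col (s1 d) \<noteq> col d}" arbitrary: s1 rule: less_induct)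
  case less
  let ?W = "{d \<in> D. col (s1 d) = col d}"
  show ?case
  proof (cases "\<forall>a\<in>D. \<forall>b\<in>D. col (s1 a) \<noteq> col a \<longrightarrow> col (s1 b) \<noteq> col b \<longrightarrow> a \<noteq> b \<longrightarrow>
      (a, b) \<in> conn (gr D s0 \<union> gr ?W s1) \<longrightarrow> lab a \<noteq> lab b")
    case True
    then show ?thesis using less(2,3) by (intro exI[of _ s1] conjI ballI) simp_all
  next
    case False
    then obtain a b where ab: "a \<in> D" "b \<in> D" "col (s1 a) \<noteq> col a" "col (s1 b) \<noteq> col b" "a \<noteq> b"
      "(a, b) \<in> conn (gr D s0 \<union> gr ?W s1)" "lab a = lab b" by blast
    have c: "col a = col b"
      using ab(6) by (rule conn_key) (use assms(4) in auto)
    have ne: "b \<noteq> a" "b \<noteq> s1 a" using ab(3,5) c by auto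
    let ?s = "swap_pairs s1 a b"
    have f: "matching D ?s" using matching_swap_pairs less(2) ab ne by metis
    have la: "lab (s1 a) = lab (s1 b)" using less(3)[rule_format, OF ab(1)] less(3)[rule_format, OF ab(2)] ab(7) by simp
    have k': "lab (?s d) = lab d" if "d \<in> D" for d
      using swap_pairs_key[OF less(2) ab(1,2) ne ab(7) la that] less(3)[rule_format, OF that] by blast
    then have k: "\<forall>d\<in>D. lab (?s d) = lab d" by blast
    \<comment> \<open>All four exchanged flags are mixed, so the segment from \<open>a\<close> to
      \<open>b\<close> survives the removal of the two pairs.\<close>
    have "?W \<subseteq> D - {a, b, s1 a, s1 b}"
      using ab(3,4) matchingD(3)[OF less(2) ab(1)] matchingD(3)[OF less(2) ab(2)] by auto
    then have "(a, b) \<in> conn (gr (D - {a, b, s1 a, s1 b}) s1 \<union> gr D s0)"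
      by (intro conn_mono[OF ab(6)]) auto
    note F = ncomp_swap_pairs_split[OF assms(1,2) less(2) ab(1,2) ne this]
    have V: "orbs D ?s s2 \<le> Suc (orbs D s1 s2)"
      using ncomp_swap_pairs_le(1)[OF assms(1,3) less(2) ab(1,2) ne] .
    have ca: "col (s1 a) = col (s1 b)" using ab(3,4) c by blast
    have keep: "col (?s d) = col d" if "d \<in> D" "col (s1 d) = col d" for d
      using swap_pairs_key[OF less(2) ab(1,2) ne c ca that(1)] that(2) by simp
    have "col (?s a) = col a" using swap_pairs_values[OF less(2) ab(1,2) ne] c by simp
    then have "{d \<in> D. col (?s d) \<noteq> col d} \<subset> {d \<in> D. col (s1 d) \<noteq> col d}"
      using keep ab(1,3) by blast
    then have "card {d \<in> D. col (?s d) \<noteq> col d} < card {d \<in> D. col (s1 d) \<noteq> col d}"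
      using assms(1) by (intro psubset_card_mono) auto
    note IH = less(1)[OF this f k]
    have "int (orbs D s1 s0) - int (orbs D s1 s2) \<le> int (orbs D ?s s0) - int (orbs D ?s s2)"
      using F V by linarith
    with IH show ?thesis by (rule ex_le_trans)
  qed
qed

text \<open>A cycle that avoids \<open>D - W\<close> is not affected by the values of
  \<open>s'\<close> there. Any other cycle is recovered from its trace on \<open>D - W\<close>,
  where \<open>B\<close> jumps along a whole path. Two extensions of \<open>s\<close> on
  \<open>W\<close> can thus be compared on \<open>D - W\<close> alone.\<close>

lemma ncomp_path_ends:
  assumes "finite D" "matching D t" "W \<subseteq> D" "matching W s" "matching (D - W) B"
    and B: "\<And>a b. a \<in> D - W \<Longrightarrow> b \<in> D - W \<Longrightarrow> (a, b) \<in> conn (gr D t \<union> gr W s) \<longleftrightarrow> b = a \<or> b = B a"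
    and s': "matching (D - W) s'" "\<And>d. d \<in> W \<Longrightarrow> s' d = s d"
  shows "orbs D s' t =
    ncomp {d \<in> D. conn (gr D t \<union> gr W s) `` {d} \<inter> (D - W) = {}} (gr D t \<union> gr W s) + orbs (D - W) s' B"
proof -
  let ?E = "gr D s' \<union> gr D t" and ?r = "gr D t \<union> gr W s" and ?M = "D - W"
  let ?E' = "gr ?M s' \<union> gr ?M B"
  define D0 where "D0 = {d \<in> D. conn ?r `` {d} \<inter> ?M = {}}"
  have rE: "(p, q) \<in> conn ?E" if "(p, q) \<in> conn ?r" for p q
    using that by (rule conn_mono) (use assms(3) s'(2) in auto)
  have fD: "matching D s'"
  proof -
    have "matching W s'" using assms(4) s'(2) matching_cong by metis
    moreover have "W \<union> ?M = D" using assms(3) by blast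
    ultimately show ?thesis using matching_Un[of W s' ?M] s'(1) by simp
  qed
  have edge: "(p, q) \<in> ?r \<or> p \<in> ?M \<and> q \<in> ?M \<and> q = s' p" if "(p, q) \<in> ?E" for p q
    using that s' matchingD(1)[OF s'(1), of p] by (cases "p \<in> W") auto
  have rcl: "conn ?r `` {p} = conn ?r `` {q}" if "(p, q) \<in> ?r" for p q
    using that by (simp only: class_eq_iff conn_base)
  have D0cl: "p \<in> D0 \<longleftrightarrow> q \<in> D0" if pq: "(p, q) \<in> ?E" for p q
    using edge[OF pq]
  proof
    assume "(p, q) \<in> ?r"
    moreover have "p \<in> D" "q \<in> D" using pq matchingD(1)[OF fD] matchingD(1)[OF assms(2)] by auto
    ultimately show ?thesis using rcl[of p q] by (simp add: D0_def)
  next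
    assume "p \<in> ?M \<and> q \<in> ?M \<and> q = s' p"
    then show ?thesis by (auto simp: D0_def)
  qed
  \<comment> \<open>Induction along the walk: all ends of the path currently visited are reachable
    from \<open>a\<close> by \<open>s'\<close> and \<open>B\<close> alone.\<close>
  have ends: "(a, m) \<in> conn ?E'" if ab: "(a, b) \<in> conn ?E" "a \<in> ?M" "m \<in> ?M" "(m, b) \<in> conn ?r" for a b m
  proof -
    have BM: "(d, m) \<in> conn ?E'" if "d \<in> ?M" "m \<in> ?M" "(m, d) \<in> conn ?r" for d m
    proof -
      have "m = d \<or> m = B d" using that B[of d m] conn_sym_iff[of m d ?r] by blast
      then show ?thesis using that(1) by (auto intro: conn_base)
    qed
    have "\<forall>m\<in>?M. (m, b) \<in> conn ?r \<longrightarrow> (a, m) \<in> conn ?E'"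
      using ab(1)
    proof (induction rule: conn_induct)
      case refl
      then show ?case using BM[OF ab(2)] by blast
    next
      case (step c d)
      consider "(c, d) \<in> conn ?r" | "c \<in> ?M" "d \<in> ?M" "(c, d) \<in> conn ?E'"
        using step(2) edge[of c d] edge[of d c] conn_base[of c d ?r] conn_base'[of d c ?r]
          conn_base[of c d ?E'] conn_base'[of d c ?E'] by auto
      then show ?case
      proof cases
        case 1
        show ?thesis
        proof (intro ballI impI)
          fix m assume "m \<in> ?M" "(m, d) \<in> conn ?r"
          then show "(a, m) \<in> conn ?E'"
            using step(3) conn_trans[of m d ?r c] conn_sym[OF 1] by blast
        qed
      next
        case 2
        then have "(a, d) \<in> conn ?E'" using step(3) conn_trans[of a c ?E' d] by blast
        then show ?thesis using BM[OF 2(2)] conn_trans[of a d ?E'] by blast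
      qed
    qed
    then show ?thesis using ab(3,4) by blast
  qed
  have "ncomp (D0 \<union> (D - D0)) ?E = ncomp D0 ?E + ncomp (D - D0) ?E"
  proof (rule ncomp_disjoint_union)
    show "(a, b) \<notin> conn ?E" if "a \<in> D0" "b \<in> D - D0" for a b
      using conn_closed[of a b ?E D0] D0cl that by blast
  qed (use assms(1) in \<open>auto simp: D0_def\<close>)
  moreover have "D0 \<union> (D - D0) = D" by (auto simp: D0_def)
  moreover have "ncomp D0 ?E = ncomp D0 ?r"
  proof (rule ncomp_cong)
    fix a b assume ab: "a \<in> D0" "b \<in> D0"
    show "(a, b) \<in> conn ?E \<longleftrightarrow> (a, b) \<in> conn ?r"
    proof
      assume "(a, b) \<in> conn ?E"
      then show "(a, b) \<in> conn ?r"
      proof (rule conn_restrict[where C = D0])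
        fix p q assume "(p, q) \<in> ?E" "p \<in> D0"
        moreover have "p \<notin> ?M" using \<open>p \<in> D0\<close> by (auto simp: D0_def)
        ultimately show "(p, q) \<in> conn ?r" using edge[of p q] conn_base[of p q ?r] by blast
      qed (use ab D0cl in auto)
    qed (rule rE)
  qed (use assms(1) in \<open>auto simp: D0_def\<close>)
  moreover have "orbs ?M s' B = ncomp (D - D0) ?E"
  proof (rule ncomp_transfer[where g = "\<lambda>d. d"])
    show "(\<lambda>d. d) ` ?M \<subseteq> D - D0" by (auto simp: D0_def)
    show "\<exists>a\<in>?M. (a, d) \<in> conn ?E" if "d \<in> D - D0" for d
    proof -
      have "conn ?r `` {d} \<inter> ?M \<noteq> {}" using that by (simp add: D0_def)
      then obtain a where "a \<in> ?M" "(d, a) \<in> conn ?r" by blast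
      then show ?thesis using rE conn_sym by metis
    qed
    fix a b assume ab: "a \<in> ?M" "b \<in> ?M"
    show "(a, b) \<in> conn ?E' \<longleftrightarrow> (a, b) \<in> conn ?E"
    proof
      assume "(a, b) \<in> conn ?E'"
      then show "(a, b) \<in> conn ?E"
      proof (rule conn_least)
        fix p q assume "(p, q) \<in> ?E'"
        then consider "(p, q) \<in> gr D s'" | "p \<in> ?M" "q = B p" by auto
        then show "(p, q) \<in> conn ?E"
        proof cases
          case 1 then show ?thesis by (intro conn_base) auto
        next
          case 2
          then show ?thesis using rE B[of p "B p"] matchingD(1)[OF assms(5), of p] by blast
        qed
      qed
    next
      assume "(a, b) \<in> conn ?E"
      then show "(a, b) \<in> conn ?E'" using ends[of a b b] ab by blast
    qed
  qed (use assms(1) in auto)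
  ultimately show ?thesis unfolding D0_def by simp
qed

text \<open>Minimise the total number of orbits: of the two ways to join two orbits of \<open>R\<close> and \<open>f\<close>, one
  does not increase the number of orbits of \<open>R\<close> and \<open>g\<close>.\<close>

lemma common_transitive_matching:
  assumes "finite Q" "matching Q f" "matching Q g"
  obtains R where "matching Q R" "\<And>a b. a \<in> Q \<Longrightarrow> b \<in> Q \<Longrightarrow> (a, b) \<in> conn (gr Q R \<union> gr Q f)"
    "\<And>a b. a \<in> Q \<Longrightarrow> b \<in> Q \<Longrightarrow> (a, b) \<in> conn (gr Q R \<union> gr Q g)"
proof -
  obtain R where R: "matching Q R" "\<And>R'. matching Q R' \<Longrightarrow> orbs Q R f + orbs Q R g \<le> orbs Q R' f + orbs Q R' g"
    using ex_has_least_nat[of "matching Q" f "\<lambda>R. orbs Q R f + orbs Q R g"] assms(2) by blast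
  have key: "(a, b) \<in> conn (gr Q R \<union> gr Q f)"
    if fg: "matching Q f" "matching Q g" and ab: "a \<in> Q" "b \<in> Q"
      and min: "\<And>R'. matching Q R' \<Longrightarrow> orbs Q R f + orbs Q R g \<le> orbs Q R' f + orbs Q R' g" for f g a b
  proof (rule ccontr)
    assume nc: "(a, b) \<notin> conn (gr Q R \<union> gr Q f)"
    note m = ncomp_swap_pairs_merge[OF assms(1) fg(1) R(1) ab nc]
    have Rb: "R b \<in> Q" "R (R b) = b" using matchingD[OF R(1) ab(2)] by auto
    have "(R b, b) \<in> conn (gr Q R \<union> gr Q f)" by (rule conn_base) (use Rb in auto)
    then have nc': "(a, R b) \<notin> conn (gr Q R \<union> gr Q f)" using nc conn_trans by metis
    note m' = ncomp_swap_pairs_merge[OF assms(1) fg(1) R(1) ab(1) Rb(1) nc']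
    have "matching Q (swap_pairs R a b)" "matching Q (swap_pairs R a (R b))"
      using matching_swap_pairs[OF R(1) ab m(1,2)] matching_swap_pairs[OF R(1) ab(1) Rb(1) m'(1,2)] by auto
    then show False
      using min[of "swap_pairs R a b"] min[of "swap_pairs R a (R b)"] m(3) m'(3)
        ncomp_swap_pairs_choice[OF assms(1) fg(2) R(1) ab m(1,2)] by linarith
  qed
  show ?thesis
  proof
    show "matching Q R" by (rule R(1))
    show "(a, b) \<in> conn (gr Q R \<union> gr Q f)" if "a \<in> Q" "b \<in> Q" for a b
      using key[OF assms(2,3) that R(2)] .
    show "(a, b) \<in> conn (gr Q R \<union> gr Q g)" if "a \<in> Q" "b \<in> Q" for a b
      using key[OF assms(3,2) that] R(2) by (simp add: add.commute)
  qed
qed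

section \<open>Separating two colours\<close>

text \<open>The new matching \<open>R\<close> of the mixed flags commutes with the map \<open>T\<close> that exchanges the ends of
  a face segment, so each new face consists of just two segments, whereas each old mixed face contains
  at least one segment of each colour.\<close>

lemma rematch_crossing_segments:
  fixes col :: "'a \<Rightarrow> bool"
  assumes fin: "finite D" and s0: "matching D s0" and s2: "matching D s2" and s1: "matching D s1"
    and c0: "\<And>d. d \<in> D \<Longrightarrow> col (s0 d) = col d" and c2: "\<And>d. d \<in> D \<Longrightarrow> col (s2 d) = col d"
    and l1: "\<And>d. d \<in> D \<Longrightarrow> lab (s1 d) = lab d" and l2: "\<And>d. d \<in> D \<Longrightarrow> lab (s2 d) = lab d"
    and xy: "\<And>d. d \<in> D \<Longrightarrow> col (s1 d) \<noteq> col d \<Longrightarrow> lab d \<in> {x, y}"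
    and cross: "\<And>a b. \<lbrakk>a \<in> D; b \<in> D; col (s1 a) \<noteq> col a; col (s1 b) \<noteq> col b; a \<noteq> b;
      (a, b) \<in> conn (gr D s0 \<union> gr {d \<in> D. col (s1 d) = col d} s1)\<rbrakk> \<Longrightarrow> lab a \<noteq> lab b"
  shows "\<exists>s. matching D s \<and> (\<forall>d\<in>D. lab (s d) = lab d) \<and> (\<forall>d\<in>D. col (s d) = col d) \<and>
    orbs D s1 s0 \<le> orbs D s s0 \<and> orbs D s s2 \<le> orbs D s1 s2 + 2"
proof -
  define W where "W = {d \<in> D. col (s1 d) = col d}"
  define M where "M = D - W"
  have WD: "W \<subseteq> D" by (auto simp: W_def)
  have MD: "M \<subseteq> D" by (auto simp: M_def)
  have M_iff: "d \<in> M \<longleftrightarrow> d \<in> D \<and> col (s1 d) \<noteq> col d" for d by (auto simp: M_def W_def)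
  have finM: "finite M" using fin MD finite_subset by blast
  have W1: "matching W s1"
  proof (rule matching_iff[OF s1 WD])
    fix d assume "d \<in> W"
    then show "s1 d \<in> W" using matchingD[OF s1, of d] by (simp add: W_def)
  qed
  have M1: "matching M s1" unfolding M_def by (rule matching_Diff[OF s1 W1])
  \<comment> \<open>\<open>T\<close> leads from one end of a one-coloured face segment to the other;
    \<open>B\<close> below does the same for one-coloured runs around a vertex.\<close>
  obtain T where "matching (D - W) T"
    "\<And>a b. a \<in> D - W \<Longrightarrow> b \<in> D - W \<Longrightarrow> (a, b) \<in> conn (gr D s0 \<union> gr W s1) \<longleftrightarrow> b = a \<or> b = T a"
    using path_partner[OF fin s0 WD W1] by blast
  note T = this[folded M_def]
  obtain B where "matching (D - W) B"
    "\<And>a b. a \<in> D - W \<Longrightarrow> b \<in> D - W \<Longrightarrow> (a, b) \<in> conn (gr D s2 \<union> gr W s1) \<longleftrightarrow> b = a \<or> b = B a"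
    using path_partner[OF fin s2 WD W1] by blast
  note B = this[folded M_def]
  note TM = matchingD[OF T(1)] and BM = matchingD[OF B(1)] and sM = matchingD[OF M1]
  have labM: "lab d = x \<or> lab d = y" if "d \<in> M" for d using xy[of d] that M_iff by blast
  have Tconn: "(d, T d) \<in> conn (gr D s0 \<union> gr W s1)" if "d \<in> M" for d
    using T(2)[OF that TM(1)[OF that]] by blast
  have Tcol: "col (T d) = col d" if "d \<in> M" for d
  proof -
    have "col d = col (T d)"
      by (rule conn_key[OF Tconn[OF that], of col]) (auto simp: c0 W_def)
    then show ?thesis by simp
  qed
  have Tlab: "lab (T d) \<noteq> lab d" if "d \<in> M" for d
    using cross[of d "T d"] Tconn[OF that] TM[OF that] that M_iff unfolding W_def by metis
  have Bconn: "(d, B d) \<in> conn (gr D s2 \<union> gr W s1)" if "d \<in> M" for d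
    using B(2)[OF that BM(1)[OF that]] by blast
  have Bkey: "lab (B d) = lab d" "col (B d) = col d" if "d \<in> M" for d
  proof -
    have "lab d = lab (B d)"
      by (rule conn_key[OF Bconn[OF that], of lab]) (use WD in \<open>auto simp: l2 l1\<close>)
    moreover have "col d = col (B d)"
      by (rule conn_key[OF Bconn[OF that], of col]) (auto simp: c2 W_def)
    ultimately show "lab (B d) = lab d" "col (B d) = col d" by simp_all
  qed
  have Tother: "lab (T d) = (if lab d = x then y else x)" if "d \<in> M" for d
    using Tlab[OF that] labM[OF that] labM[OF TM(1)[OF that]] by auto
  \<comment> \<open>It suffices to choose \<open>R\<close> at the ends labelled \<open>x\<close>,
    separately for each colour; commuting with \<open>T\<close> then determines it at
    \<open>y\<close>. The matching \<open>B\<close> at \<open>y\<close>, carried back to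
    \<open>x\<close>, is \<open>T\<close> after \<open>B\<close> after \<open>T\<close>. This
    explains the two matchings with which the choice has to be transitive.\<close>
  define Q where "Q c = {d \<in> M. lab d = x \<and> col d = c}" for c
  have "\<exists>R. matching (Q c) R \<and> (\<forall>a\<in>Q c. \<forall>b\<in>Q c. (a, b) \<in> conn (gr (Q c) R \<union> gr (Q c) B)) \<and>
      (\<forall>a\<in>Q c. \<forall>b\<in>Q c. (a, b) \<in> conn (gr (Q c) R \<union> gr (Q c) (\<lambda>d. T (B (T d)))))" for c
  proof -
    have QM: "Q c \<subseteq> M" by (auto simp: Q_def)
    have f: "matching (Q c) B"
      by (rule matching_iff[OF B(1) QM]) (auto simp: Q_def Bkey BM(1))
    have TQ: "T (B (T d)) \<in> Q c" "T (B (T d)) \<noteq> d" "T (B (T (T (B (T d))))) = d" if "d \<in> Q c" for d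
    proof -
      have d: "d \<in> M" "lab d = x" "col d = c" using that by (auto simp: Q_def)
      have m: "T d \<in> M" "B (T d) \<in> M" "T (B (T d)) \<in> M" using d TM(1) BM(1) by simp_all
      have xy: "x \<noteq> y" using Tlab[OF d(1)] Tother[OF d(1)] d by auto
      show "T (B (T d)) \<in> Q c"
        using m d xy by (simp add: Q_def Tcol Bkey Tother)
      show "T (B (T d)) \<noteq> d" using m d TM(3) BM(2) by metis
      show "T (B (T (T (B (T d))))) = d" using m d TM(3) BM(3) by simp
    qed
    then have g: "matching (Q c) (\<lambda>d. T (B (T d)))" by (auto simp: matching_def)
    have "finite (Q c)" using QM finM finite_subset by blast
    from common_transitive_matching[OF this f g] show ?thesis by metis
  qed
  then obtain R' where R': "\<And>c. matching (Q c) (R' c)"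
    "\<And>c a b. a \<in> Q c \<Longrightarrow> b \<in> Q c \<Longrightarrow> (a, b) \<in> conn (gr (Q c) (R' c) \<union> gr (Q c) B)"
    "\<And>c a b. a \<in> Q c \<Longrightarrow> b \<in> Q c \<Longrightarrow> (a, b) \<in> conn (gr (Q c) (R' c) \<union> gr (Q c) (\<lambda>d. T (B (T d))))"
    by metis
  define R where "R d = (if lab d = x then R' (col d) d else T (R' (col d) (T d)))" for d
  have QT: "T d \<in> Q (col d)" if "d \<in> M" "lab d \<noteq> x" for d
    using that by (simp add: Q_def TM(1) Tother Tcol)
  have QI: "d \<in> Q (col d)" if "d \<in> M" "lab d = x" for d using that by (simp add: Q_def)
  have RQ: "R d = R' c d" "R' c d \<in> Q c" if "d \<in> Q c" for c d
    using that matchingD[OF R'(1) that] by (auto simp: R_def Q_def)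
  have QD: "d \<in> M" "lab d = x" "col d = c" if "d \<in> Q c" for c d using that by (auto simp: Q_def)
  have RT: "R (T d) = T (R d)" if "d \<in> Q c" for c d
    using QD[OF that] Tlab[of d] by (simp add: R_def Tcol TM(3))
  have RM: "R d \<in> M" "lab (R d) = lab d" "col (R d) = col d" "R d \<noteq> d" "R (R d) = d" "R (T d) = T (R d)"
    if d: "d \<in> M" for d
  proof -
    have "R d \<in> M \<and> lab (R d) = lab d \<and> col (R d) = col d \<and> R d \<noteq> d \<and> R (R d) = d \<and> R (T d) = T (R d)"
    proof (cases "lab d = x")
      case True
      note q = QI[OF d True]
      have "R (R d) = d" using RQ(1)[OF q] RQ(1)[OF RQ(2)[OF q]] matchingD(3)[OF R'(1) q] by simp
      moreover have "R d \<noteq> d" using RQ(1)[OF q] matchingD(2)[OF R'(1) q] by simp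
      ultimately show ?thesis using QD[OF RQ(2)[OF q]] RQ(1)[OF q] RT[OF q] True by simp
    next
      case False
      define e where "e = T d"
      have q: "e \<in> Q (col d)" using QT[OF d False] by (simp add: e_def)
      note q' = RQ(2)[OF q]
      have de: "d = T e" using TM(3)[OF d] by (simp add: e_def)
      have Re: "R e \<in> Q (col d)" using RQ[OF q] by simp
      have R1: "R d = T (R e)" using RT[OF q] de by simp
      have RRe: "R (R e) = e" using RQ(1)[OF q] RQ(1)[OF q'] matchingD(3)[OF R'(1) q] by simp
      have "R (R d) = d" using R1 RT[OF Re] RRe de by simp
      moreover have "R e \<noteq> e" using RQ(1)[OF q] matchingD(2)[OF R'(1) q] by simp
      then have "R d \<noteq> d" using R1 de TM(3)[OF QD(1)[OF Re]] TM(3)[OF QD(1)[OF q]] by metis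
      moreover have "R (T d) = T (R d)"
        using R1 TM(3)[OF QD(1)[OF Re]] by (simp add: e_def)
      moreover have "lab (R d) = lab d"
        using QD[OF Re] QD[OF q] R1 by (simp add: Tother de)
      moreover have "R d \<in> M" "col (R d) = col d"
        using QD[OF Re] R1 by (simp_all add: TM(1) Tcol)
      ultimately show ?thesis by simp
    qed
    then show "R d \<in> M" "lab (R d) = lab d" "col (R d) = col d" "R d \<noteq> d" "R (R d) = d" "R (T d) = T (R d)"
      by auto
  qed
  have fR: "matching M R" using RM by (auto simp: matching_def)
  have RB: "(a, b) \<in> conn (gr M R \<union> gr M B)" if ab: "a \<in> M" "b \<in> M" "lab a = lab b" "col a = col b" for a b
  proof (cases "lab a = x")
    case True
    then have q: "a \<in> Q (col a)" "b \<in> Q (col a)" using ab by (auto simp: Q_def)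
    show ?thesis
    proof (rule conn_mono[OF R'(2)[OF q]])
      show "gr (Q (col a)) (R' (col a)) \<union> gr (Q (col a)) B \<subseteq> gr M R \<union> gr M B"
        using RQ(1) QD(1) by auto
    qed
  next
    case False
    then have q: "T a \<in> Q (col a)" "T b \<in> Q (col a)" using QT[of a] QT[of b] ab by simp_all
    have "(T (T a), T (T b)) \<in> conn (gr M R \<union> gr M B)"
    proof (rule conn_map[OF R'(3)[OF q]])
      fix p p' assume "(p, p') \<in> gr (Q (col a)) (R' (col a)) \<union> gr (Q (col a)) (\<lambda>d. T (B (T d)))"
      then consider "p \<in> Q (col a)" "p' = R p" | "p \<in> Q (col a)" "p' = T (B (T p))"
        using RQ(1) by auto
      then show "(T p, T p') \<in> conn (gr M R \<union> gr M B)"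
      proof cases
        case 1
        then have "(T p, T p') \<in> gr M R" using RM(6)[OF QD(1)[OF 1(1)]] TM(1)[OF QD(1)[OF 1(1)]] by simp
        then show ?thesis by (intro conn_base) simp
      next
        case 2
        have "T p \<in> M" using TM(1)[OF QD(1)[OF 2(1)]] .
        then have "(T p, T p') \<in> gr M B" using 2(2) TM(3)[OF BM(1)] by simp
        then show ?thesis by (intro conn_base) simp
      qed
    qed
    then show ?thesis using TM(3) ab by simp
  qed
  define s where "s d = (if d \<in> M then R d else s1 d)" for d
  have sW: "s d = s1 d" if "d \<in> W" for d using that by (auto simp: s_def M_def)
  have sMR: "matching M s" by (rule matching_cong[OF fR]) (simp add: s_def)
  have "matching W s" by (rule matching_cong[OF W1]) (simp add: sW)
  then have fs: "matching D s" using matching_Un[of W s M] sMR WD by (simp add: M_def Un_absorb1)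
  have keys: "lab (s d) = lab d" "col (s d) = col d" if "d \<in> D" for d
    using that RM[of d] l1 M_iff[of d] by (auto simp: s_def)
  have F1: "orbs D s1 s0 = ncomp {d \<in> D. conn (gr D s0 \<union> gr W s1) `` {d} \<inter> M = {}} (gr D s0 \<union> gr W s1) + orbs M s1 T"
    by (rule ncomp_path_ends[OF fin s0 WD W1, folded M_def]) (use T M1 in blast)+
  have F2: "orbs D s s0 = ncomp {d \<in> D. conn (gr D s0 \<union> gr W s1) `` {d} \<inter> M = {}} (gr D s0 \<union> gr W s1) + orbs M s T"
    by (rule ncomp_path_ends[OF fin s0 WD W1, folded M_def]) (use T sMR sW in blast)+
  have V1: "orbs D s1 s2 = ncomp {d \<in> D. conn (gr D s2 \<union> gr W s1) `` {d} \<inter> M = {}} (gr D s2 \<union> gr W s1) + orbs M s1 B"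
    by (rule ncomp_path_ends[OF fin s2 WD W1, folded M_def]) (use B M1 in blast)+
  have V2: "orbs D s s2 = ncomp {d \<in> D. conn (gr D s2 \<union> gr W s1) `` {d} \<inter> M = {}} (gr D s2 \<union> gr W s1) + orbs M s B"
    by (rule ncomp_path_ends[OF fin s2 WD W1, folded M_def]) (use B sMR sW in blast)+
  have grs: "gr M s = gr M R" by (auto simp: s_def)
  have clM: "conn (gr M f \<union> gr M T) `` {d} \<subseteq> M" if "matching M f" "d \<in> M" for f d
  proof
    fix q assume "q \<in> conn (gr M f \<union> gr M T) `` {d}"
    then have q: "(d, q) \<in> conn (gr M f \<union> gr M T)" by simp
    show "q \<in> M"
    proof (rule conn_closed[OF q that(2)])
      fix p q assume "(p, q) \<in> gr M f \<union> gr M T"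
      then show "p \<in> M \<longleftrightarrow> q \<in> M" using matchingD(1)[OF that(1), of p] TM(1)[of p] by auto
    qed
  qed
  have "4 * orbs M s1 T \<le> card M"
  proof (rule ncomp_class_card_ge[OF finM clM[OF M1]])
    fix d assume d: "d \<in> M"
    let ?E = "gr M s1 \<union> gr M T"
    have m: "s1 d \<in> M" "T d \<in> M" "T (s1 d) \<in> M" using d sM(1) TM(1) by auto
    have e: "(p, s1 p) \<in> conn ?E" "(p, T p) \<in> conn ?E" if "p \<in> M" for p
      using that by (auto intro: conn_base)
    have "{d, s1 d, T d, T (s1 d)} \<subseteq> conn ?E `` {d}"
      using e[OF d] conn_trans[OF e(1)[OF d] e(2)[OF m(1)]] by auto
    moreover have "card {d, s1 d, T d, T (s1 d)} = 4"
    proof -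
      have "col (s1 d) \<noteq> col d" "lab (s1 d) = lab d" using d M_iff l1 by auto
      moreover have "col (T (s1 d)) = col (s1 d)" "lab (T (s1 d)) \<noteq> lab (s1 d)" "col (T d) = col d" "lab (T d) \<noteq> lab d"
        using Tcol Tlab d m by auto
      ultimately have "d \<noteq> s1 d" "d \<noteq> T d" "d \<noteq> T (s1 d)" "s1 d \<noteq> T d" "s1 d \<noteq> T (s1 d)" "T d \<noteq> T (s1 d)"
        by metis+
      then show ?thesis by simp
    qed
    moreover have "finite (conn ?E `` {d})" using clM[OF M1 d] finM finite_subset by blast
    ultimately show "4 \<le> card (conn ?E `` {d})" using card_mono by metis
  qed
  moreover have "4 * orbs M R T = card M"
  proof (rule ncomp_class_card_eq[OF finM clM[OF fR]])
    fix d assume d: "d \<in> M"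
    let ?E = "gr M R \<union> gr M T"
    have m: "R d \<in> M" "T d \<in> M" "T (R d) \<in> M" using d RM(1) TM(1) by auto
    have e: "(p, R p) \<in> conn ?E" "(p, T p) \<in> conn ?E" if "p \<in> M" for p
      using that by (auto intro: conn_base)
    have "{d, R d, T d, T (R d)} \<subseteq> conn ?E `` {d}"
      using e[OF d] conn_trans[OF e(1)[OF d] e(2)[OF m(1)]] by auto
    moreover have "q \<in> {d, R d, T d, T (R d)}" if q: "(d, q) \<in> conn ?E" for q
    proof (rule conn_closed[OF q])
      have Rc: "R p \<in> {d, R d, T d, T (R d)}" "T p \<in> {d, R d, T d, T (R d)}" if "p \<in> {d, R d, T d, T (R d)}" for p
        using that RM(5,6)[OF d] RM(6)[OF m(1)] TM(3)[OF d] TM(3)[OF m(1)] by auto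
      fix p p' assume "(p, p') \<in> ?E"
      then have "p \<in> M" "p' = R p \<or> p' = T p" by auto
      then have "p = R p' \<or> p = T p'" using RM(5)[of p] TM(3)[of p] by auto
      then show "p \<in> {d, R d, T d, T (R d)} \<longleftrightarrow> p' \<in> {d, R d, T d, T (R d)}"
        using Rc \<open>p' = R p \<or> p' = T p\<close> by blast
    qed simp
    ultimately have "conn ?E `` {d} = {d, R d, T d, T (R d)}" by blast
    moreover have "card {d, R d, T d, T (R d)} = 4"
    proof -
      have "R d \<noteq> d" "lab (R d) = lab d" using RM d by auto
      moreover have "lab (T (R d)) \<noteq> lab (R d)" "lab (T d) \<noteq> lab d"
        using Tlab d m by auto
      moreover have "T d \<noteq> T (R d)" using TM(3) d m \<open>R d \<noteq> d\<close> by metis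
      ultimately have "d \<noteq> R d" "d \<noteq> T d" "d \<noteq> T (R d)" "R d \<noteq> T d" "R d \<noteq> T (R d)" "T d \<noteq> T (R d)"
        by metis+
      then show ?thesis by simp
    qed
    ultimately show "card (conn ?E `` {d}) = 4" by simp
  qed
  ultimately have F: "orbs D s1 s0 \<le> orbs D s s0" unfolding F1 F2 grs by simp
  \<comment> \<open>After the rematching there are at most four classes, one for each terminal and
    colour. Before it there were at least two, one for each terminal, unless there is no mixed flag
    at all.\<close>
  have "orbs M R B \<le> orbs M s1 B + 2"
  proof (cases "M = {}")
    case True then show ?thesis by (simp add: ncomp_def)
  next
    case False
    then obtain d where d: "d \<in> M" by blast
    have "orbs M R B \<le> card ((\<lambda>d. (lab d, col d)) ` M)"
      by (rule ncomp_key_le[OF finM]) (use RB in auto)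
    also have "\<dots> \<le> card ({x, y} \<times> (UNIV :: bool set))"
      by (rule card_mono) (use labM in auto)
    also have "\<dots> \<le> 4" by (simp add: card_insert_if)
    finally have "orbs M R B \<le> 4" .
    moreover have "card (lab ` M) \<le> orbs M s1 B"
    proof (rule ncomp_key_ge[OF finM])
      fix a b assume "(a, b) \<in> conn (gr M s1 \<union> gr M B)"
      then show "lab a = lab b"
      proof (rule conn_key)
        fix p q assume "(p, q) \<in> gr M s1 \<union> gr M B"
        then show "lab p = lab q" using Bkey(1)[of p] l1[of p] MD by auto
      qed
    qed
    moreover have "card {lab d, lab (T d)} \<le> card (lab ` M)"
      by (rule card_mono) (use d TM(1) finM in auto)
    ultimately show ?thesis using Tlab[OF d] by simp
  qed
  then have "orbs D s s2 \<le> orbs D s1 s2 + 2" unfolding V1 V2 grs by simp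
  then show ?thesis using fs keys F by blast
qed

text \<open>The three procedures in succession; only the rematching has a cost, namely two. Merging
  with the pair of label and colour as key makes the final vertices exactly the pairs that occur.
  Assumption \<open>xy\<close> confines mixed flags to the two terminals, as the rematching
  demands.\<close>

lemma separate_colours:
  fixes col :: "'a \<Rightarrow> bool"
  assumes fin: "finite D" and s0: "matching D s0" and s2: "matching D s2" and s1: "matching D s1"
    and c0: "\<And>d. d \<in> D \<Longrightarrow> col (s0 d) = col d" and c2: "\<And>d. d \<in> D \<Longrightarrow> col (s2 d) = col d"
    and l1: "\<And>d. d \<in> D \<Longrightarrow> lab (s1 d) = lab d" and l2: "\<And>d. d \<in> D \<Longrightarrow> lab (s2 d) = lab d"
    and xy: "\<And>a b. a \<in> D \<Longrightarrow> b \<in> D \<Longrightarrow> lab a = lab b \<Longrightarrow> col a \<noteq> col b \<Longrightarrow> lab a \<in> {x, y}"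
  obtains s where "matching D s" "\<And>d. d \<in> D \<Longrightarrow> lab (s d) = lab d" "\<And>d. d \<in> D \<Longrightarrow> col (s d) = col d"
    "\<And>a b. a \<in> D \<Longrightarrow> b \<in> D \<Longrightarrow> (a, b) \<in> conn (gr D s \<union> gr D s2) \<longleftrightarrow> lab a = lab b \<and> col a = col b"
    "int (orbs D s1 s0) - int (orbs D s1 s2) - 2 \<le> int (orbs D s s0) - int (orbs D s s2)"
proof -
  obtain t where t: "matching D t" "\<forall>d\<in>D. lab (t d) = lab d"
    "\<forall>a\<in>D. \<forall>b\<in>D. col (t a) \<noteq> col a \<longrightarrow> col (t b) \<noteq> col b \<longrightarrow> a \<noteq> b \<longrightarrow>
      (a, b) \<in> conn (gr D s0 \<union> gr {d \<in> D. col (t d) = col d} t) \<longrightarrow> lab a \<noteq> lab b"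
    "int (orbs D s1 s0) - int (orbs D s1 s2) \<le> int (orbs D t s0) - int (orbs D t s2)"
    using resolve_returning_segments[OF fin s0 s2, of col s1 lab] c0 s1 l1 by blast
  have "\<exists>s. matching D s \<and> (\<forall>d\<in>D. lab (s d) = lab d) \<and> (\<forall>d\<in>D. col (s d) = col d) \<and>
    orbs D t s0 \<le> orbs D s s0 \<and> orbs D s s2 \<le> orbs D t s2 + 2"
  proof (rule rematch_crossing_segments[where x = x and y = y])
    show "lab d \<in> {x, y}" if "d \<in> D" "col (t d) \<noteq> col d" for d
      using xy[of d "t d"] matchingD[OF t(1) that(1)] t(2) that by auto
  qed (use fin s0 s2 t c0 c2 l2 in blast)+
  then obtain u where u: "matching D u" "\<forall>d\<in>D. lab (u d) = lab d" "\<forall>d\<in>D. col (u d) = col d"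
    "orbs D t s0 \<le> orbs D u s0" "orbs D u s2 \<le> orbs D t s2 + 2" by blast
  obtain s where s: "matching D s" "\<forall>d\<in>D. (lab (s d), col (s d)) = (lab d, col d)"
    "\<forall>a\<in>D. \<forall>b\<in>D. (a, b) \<in> conn (gr D s \<union> gr D s2) \<longleftrightarrow> (lab a, col a) = (lab b, col b)"
    "int (orbs D u s0) - int (orbs D u s2) \<le> int (orbs D s s0) - int (orbs D s s2)"
    using merge_orbits[OF fin s0 s2, of "\<lambda>d. (lab d, col d)" u] c2 l2 u(1,2,3) by auto
  show ?thesis
  proof
    show "matching D s" by (rule s(1))
    show "int (orbs D s1 s0) - int (orbs D s1 s2) - 2 \<le> int (orbs D s s0) - int (orbs D s s2)"
      using t(4) u(4,5) s(4) by linarith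
  qed (use s(2,3) in auto)
qed

section \<open>Flag maps and the deletion of edges\<close>

text \<open>A closed surface over any flag type, except that it may be empty or disconnected;
  deletions lead to such maps.\<close>

definition flag_map :: "'f set \<Rightarrow> ('f \<Rightarrow> 'f) \<Rightarrow> ('f \<Rightarrow> 'f) \<Rightarrow> ('f \<Rightarrow> 'f) \<Rightarrow> bool" where
  "flag_map D s0 s1 s2 \<longleftrightarrow> finite D \<and> matching D s0 \<and> matching D s1 \<and> matching D s2 \<and>
     (\<forall>a\<in>D. s0 (s2 a) = s2 (s0 a)) \<and> (\<forall>a\<in>D. s2 a \<noteq> s0 a)"

lemma flag_mapD:
  assumes "flag_map D s0 s1 s2"
  shows "finite D" "matching D s0" "matching D s1" "matching D s2"
    "\<And>a. a \<in> D \<Longrightarrow> s0 (s2 a) = s2 (s0 a)" "\<And>a. a \<in> D \<Longrightarrow> s2 a \<noteq> s0 a"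
  using assms by (auto simp: flag_map_def)

definition components :: "'f set \<Rightarrow> ('f \<Rightarrow> 'f) \<Rightarrow> ('f \<Rightarrow> 'f) \<Rightarrow> ('f \<Rightarrow> 'f) \<Rightarrow> nat" where
  "components D s0 s1 s2 = ncomp D (gr D s1 \<union> (gr D s2 \<union> gr D s0))"

text \<open>Four times the sum of the Euler genera of the components.\<close>

definition defect :: "'f set \<Rightarrow> ('f \<Rightarrow> 'f) \<Rightarrow> ('f \<Rightarrow> 'f) \<Rightarrow> ('f \<Rightarrow> 'f) \<Rightarrow> int" where
  "defect D s0 s1 s2 =
     4 * (2 * int (components D s0 s1 s2) - int (orbs D s1 s2) - int (orbs D s1 s0)) + int (card D)"

text \<open>The path from \<open>s z\<close> through \<open>z\<close> and \<open>z'\<close> to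
  \<open>s z'\<close> is shortened to a single pair. If \<open>z\<close> and \<open>z'\<close> are
  partners, nothing remains to be joined.\<close>

definition bypass :: "('a \<Rightarrow> 'a) \<Rightarrow> 'a \<Rightarrow> 'a \<Rightarrow> 'a \<Rightarrow> 'a" where
  "bypass s z z' = (if s z = z' then s else s(s z := s z', s z' := s z))"

lemma matching_bypass:
  assumes "matching D s" "z \<in> D" "z' \<in> D" "z \<noteq> z'"
  shows "matching (D - {z, z'}) (bypass s z z')"
proof (cases "s z = z'")
  case True
  then have "matching {z, z'} s" using assms by (auto simp: matching_def)
  then show ?thesis using True assms(1) by (simp add: bypass_def matching_Diff)
next
  case False
  note f = matchingD[OF assms(1)]
  have "s z' \<noteq> z" using False f(3)[OF assms(3)] by auto
  have inj: "s p = s q \<longleftrightarrow> p = q" if "p \<in> D" "q \<in> D" for p q using matching_inj[OF assms(1) that] .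
  show ?thesis
    unfolding matching_def
  proof
    fix p assume p: "p \<in> D - {z, z'}"
    consider "p = s z" | "p = s z'" | "p \<noteq> s z" "p \<noteq> s z'" by blast
    then show "bypass s z z' p \<in> D - {z, z'} \<and> bypass s z z' p \<noteq> p \<and> bypass s z z' (bypass s z z' p) = p"
    proof cases
      case 3
      have "s p \<noteq> z" "s p \<noteq> z'" using 3 p f(3)[of p] by auto
      moreover have "s p \<noteq> s z" "s p \<noteq> s z'" using inj p assms by auto
      ultimately show ?thesis using 3 p f[of p] False by (simp add: bypass_def)
    qed (use False \<open>s z' \<noteq> z\<close> inj[OF assms(2,3)] assms f[OF assms(2)] f[OF assms(3)] in \<open>auto simp: bypass_def\<close>)
  qed
qed

text \<open>\<open>X\<close> collects the other generators; it links \<open>z\<close> with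
  \<open>z'\<close> and neither of them with anything else. Hence the removal preserves the
  connections between the remaining elements, and the only class that can vanish is
  \<open>{z, z'}\<close>.\<close>

lemma bypass_conn:
  assumes "finite D" "matching D s" "z \<in> D" "z' \<in> D" "z \<noteq> z'"
    and X: "(z, z') \<in> X" "X \<subseteq> D \<times> D"
      "\<And>p q. (p, q) \<in> X \<Longrightarrow> p \<in> {z, z'} \<or> q \<in> {z, z'} \<Longrightarrow> p \<in> {z, z'} \<and> q \<in> {z, z'}"
  defines "D' \<equiv> D - {z, z'}"
  defines "E' \<equiv> gr D' (bypass s z z') \<union> {(p, q) \<in> X. p \<in> D'}"
  shows "p \<in> D' \<Longrightarrow> q \<in> D' \<Longrightarrow> (p, q) \<in> conn E' \<longleftrightarrow> (p, q) \<in> conn (gr D s \<union> X)"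
    "ncomp D (gr D s \<union> X) = ncomp D' E' + (if s z = z' then 1 else 0)"
proof -
  let ?E = "gr D s \<union> X"
  note f = matchingD[OF assms(2)]
  have D'D: "D' \<subseteq> D" "finite D'" using assms(1) by (auto simp: D'_def)
  have "(\<forall>p\<in>D'. \<forall>q\<in>D'. (p, q) \<in> conn E' \<longleftrightarrow> (p, q) \<in> conn ?E) \<and>
    ncomp D ?E = ncomp D' E' + (if s z = z' then 1 else 0)"
  proof (cases "s z = z'")
    case True
    then have sz': "s z' = z" using f(3)[OF assms(3)] by auto
    have byp: "bypass s z z' = s" using True by (simp add: bypass_def)
    have cl: "p \<in> D' \<longleftrightarrow> q \<in> D'" if "(p, q) \<in> ?E" for p q
      using that
    proof
      assume "(p, q) \<in> gr D s"
      then have p: "p \<in> D" "q = s p" by auto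
      have "q \<in> D" "s q = p" using f(1)[OF p(1)] f(3)[OF p(1)] p(2) by simp_all
      then have "p \<in> {z, z'} \<longleftrightarrow> q \<in> {z, z'}" using p(2) True sz' by blast
      then show ?thesis using \<open>q \<in> D\<close> p(1) unfolding D'_def by blast
    next
      assume "(p, q) \<in> X"
      then show ?thesis using X(2) X(3)[of p q] unfolding D'_def by blast
    qed
    have iff: "(p, q) \<in> conn E' \<longleftrightarrow> (p, q) \<in> conn ?E" if "p \<in> D'" "q \<in> D'" for p q
    proof
      assume "(p, q) \<in> conn E'"
      then show "(p, q) \<in> conn ?E" by (rule conn_mono) (auto simp: E'_def byp D'_def)
    next
      assume "(p, q) \<in> conn ?E"
      then show "(p, q) \<in> conn E'"
      proof (rule conn_restrict[where C = D'])
        show "(p, q) \<in> conn E'" if "(p, q) \<in> ?E" "p \<in> D'" for p q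
          by (rule conn_base) (use that in \<open>auto simp: E'_def byp\<close>)
      qed (use cl that in auto)
    qed
    have "ncomp (D' \<union> {z, z'}) ?E = ncomp D' ?E + ncomp {z, z'} ?E"
    proof (rule ncomp_disjoint_union)
      show "(a, b) \<notin> conn ?E" if "a \<in> D'" "b \<in> {z, z'}" for a b
        using conn_closed[of a b ?E D'] cl that by (auto simp: D'_def)
    qed (use D'D in auto)
    moreover have "D' \<union> {z, z'} = D" using assms(3,4) by (auto simp: D'_def)
    moreover have "ncomp {z, z'} ?E = 1"
      by (rule ncomp_1[of _ z]) (use X(1) in \<open>auto intro: conn_base\<close>)
    moreover have "ncomp D' ?E = ncomp D' E'"
      by (rule ncomp_cong) (use iff D'D in auto)
    ultimately show ?thesis using iff True by simp
  next
    case False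
    have nz: "s z' \<noteq> z" using False f(3)[OF assms(4)] by auto
    have inD': "s z \<in> D'" "s z' \<in> D'" using False nz f[OF assms(3)] f[OF assms(4)] by (auto simp: D'_def)
    have ne: "s z \<noteq> s z'" using matching_inj[OF assms(2,3,4)] assms(5) by simp
    have b: "bypass s z z' (s z) = s z'" "bypass s z z' (s z') = s z"
      "p \<noteq> s z \<Longrightarrow> p \<noteq> s z' \<Longrightarrow> bypass s z z' p = s p" for p
      using False ne by (auto simp: bypass_def)
    have zz: "(s z, s z') \<in> conn ?E"
    proof -
      have "(s z, z) \<in> conn ?E" by (rule conn_base') (use assms(3) in simp)
      also have "(z, z') \<in> conn ?E" by (rule conn_base) (use X(1) in simp)
      also have "(z', s z') \<in> conn ?E" by (rule conn_base) (use assms(4) in simp)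
      finally show ?thesis .
    qed
    \<comment> \<open>Moves each removed element to its partner, so that walks in \<open>D\<close>
      become walks in \<open>D'\<close>.\<close>
    define g where "g p = (if p = z then s z else if p = z' then s z' else p)" for p
    have zz': "(s z, s z') \<in> conn E'" by (rule conn_base) (use inD' b in \<open>auto simp: E'_def\<close>)
    have gE: "(g p, g q) \<in> conn E'" if pq: "(p, q) \<in> ?E" for p q
    proof (cases "p \<in> {z, z', s z, s z'} \<and> q = s p")
      case True
      then show ?thesis
        using False nz inD' f(3)[OF assms(3)] f(3)[OF assms(4)] assms(5) unfolding g_def D'_def by auto
    next
      case notq: False
      show ?thesis
      proof (cases "(p, q) \<in> X \<and> (p \<in> {z, z'} \<or> q \<in> {z, z'})")
        case True
        then have "p \<in> {z, z'}" "q \<in> {z, z'}" using X(3) by auto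
        then show ?thesis using zz' conn_sym[OF zz'] by (auto simp: g_def)
      next
        case notX: False
        have "p \<in> D'" "q \<notin> {z, z'}" "(p, q) \<in> E'"
        proof -
          have "p \<in> D' \<and> q \<notin> {z, z'} \<and> (p, q) \<in> E'"
          proof (cases "(p, q) \<in> X")
            case True
            then show ?thesis using notX X(2) by (auto simp: D'_def E'_def)
          next
            case False
            then have p: "p \<in> D" "q = s p" using pq by auto
            then have n: "p \<notin> {z, z', s z, s z'}" using notq by auto
            then have "s p \<noteq> z" "s p \<noteq> z'" using f(3)[OF p(1)] by auto
            then show ?thesis using n p b(3)[of p] by (auto simp: D'_def E'_def)
          qed
          then show "p \<in> D'" "q \<notin> {z, z'}" "(p, q) \<in> E'" by auto
        qed
        then show ?thesis by (auto simp: g_def D'_def intro: conn_base)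
      qed
    qed
    have iff: "(p, q) \<in> conn E' \<longleftrightarrow> (p, q) \<in> conn ?E" if "p \<in> D'" "q \<in> D'" for p q
    proof
      assume "(p, q) \<in> conn E'"
      then show "(p, q) \<in> conn ?E"
      proof (rule conn_least)
        fix p q assume pq: "(p, q) \<in> E'"
        show "(p, q) \<in> conn ?E"
        proof (cases "(p, q) \<in> X")
          case True then show ?thesis by (intro conn_base) simp
        next
          case False
          then have p: "p \<in> D" "q = bypass s z z' p" using pq D'D by (auto simp: E'_def)
          consider "p = s z" | "p = s z'" | "p \<noteq> s z" "p \<noteq> s z'" by blast
          then show ?thesis
            using zz conn_sym[OF zz] b p by cases (auto intro: conn_base)
        qed
      qed
    next
      assume "(p, q) \<in> conn ?E"
      then have "(g p, g q) \<in> conn E'" by (rule conn_map) (rule gE)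
      moreover have "g p = p" "g q = q" using that by (auto simp: g_def D'_def)
      ultimately show "(p, q) \<in> conn E'" by simp
    qed
    have "ncomp D' E' = ncomp D ?E"
    proof (rule ncomp_transfer[where g = "\<lambda>p. p"])
      fix d assume d: "d \<in> D"
      show "\<exists>a\<in>D'. (a, d) \<in> conn ?E"
      proof (cases "d \<in> D'")
        case False
        then have "d = z \<or> d = z'" using d by (auto simp: D'_def)
        then have "s d \<in> D'" "(s d, d) \<in> conn ?E" using inD' d by (auto intro: conn_base')
        then show ?thesis by blast
      qed auto
    qed (use D'D iff in auto)
    then show ?thesis using iff False by simp
  qed
  then show "p \<in> D' \<Longrightarrow> q \<in> D' \<Longrightarrow> (p, q) \<in> conn E' \<longleftrightarrow> (p, q) \<in> conn ?E"
    "ncomp D ?E = ncomp D' E' + (if s z = z' then 1 else 0)" by auto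
qed

text \<open>Where \<open>t\<close> and \<open>s2\<close> agree, \<open>{z, s2 z}\<close> is isolated
  in the relation of \<open>t\<close>, in that of \<open>s2\<close> and in their union, so
  \<open>bypass_conn\<close> applies to all three. Components, vertices and faces drop by the same
  amount, which cancels in twice the first minus the other two.\<close>

lemma remove_invisible_pair:
  assumes fin: "finite D" and t: "matching D t" and s2: "matching D s2" and s1: "matching D s1" and z: "z \<in> D" and tz: "t z = s2 z"
  defines "D' \<equiv> D - {z, s2 z}"
  defines "s \<equiv> bypass s1 z (s2 z)"
  shows "matching D' t" "matching D' s2" "matching D' s"
    "\<And>p q. p \<in> D' \<Longrightarrow> q \<in> D' \<Longrightarrow> (p, q) \<in> conn (gr D' s \<union> gr D' s2) \<longleftrightarrow> (p, q) \<in> conn (gr D s1 \<union> gr D s2)"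
    "2 * int (components D' t s s2) - int (orbs D' s s2) - int (orbs D' s t) =
     2 * int (components D t s1 s2) - int (orbs D s1 s2) - int (orbs D s1 t)"
proof -
  let ?z' = "s2 z"
  have z': "?z' \<in> D" "z \<noteq> ?z'" "s2 ?z' = z" "t ?z' = z"
    using matchingD[OF s2 z] matchingD[OF t z] tz by auto
  have pair: "matching {z, ?z'} t" "matching {z, ?z'} s2" using z' tz by (auto simp: matching_def)
  show "matching D' t" "matching D' s2" unfolding D'_def using matching_Diff t s2 pair by metis+
  show "matching D' s" unfolding D'_def s_def by (rule matching_bypass[OF s1 z z'(1,2)])
  have c: "f p \<in> {z, ?z'} \<longleftrightarrow> p \<in> {z, ?z'}" if "matching D f" "f z = ?z'" "p \<in> D" for f p
    using that matchingD[OF that(1)] z z' by (metis insert_iff singletonD)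
  have e: "p \<in> D \<and> q \<in> D \<and> (q \<in> {z, ?z'} \<longleftrightarrow> p \<in> {z, ?z'})" if "(p, q) \<in> gr D s2 \<union> gr D t" for p q
    using that
  proof
    assume "(p, q) \<in> gr D s2"
    then have p: "p \<in> D" "q = s2 p" by auto
    show ?thesis unfolding p(2) using c[OF s2 refl p(1)] p(1) matchingD(1)[OF s2 p(1)] by blast
  next
    assume "(p, q) \<in> gr D t"
    then have p: "p \<in> D" "q = t p" by auto
    show ?thesis unfolding p(2) using c[OF t tz p(1)] p(1) matchingD(1)[OF t p(1)] by blast
  qed
  have X: "(z, ?z') \<in> X" "X \<subseteq> D \<times> D"
    "\<And>p q. (p, q) \<in> X \<Longrightarrow> p \<in> {z, ?z'} \<or> q \<in> {z, ?z'} \<Longrightarrow> p \<in> {z, ?z'} \<and> q \<in> {z, ?z'}"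
    if "X = gr D s2 \<or> X = gr D t \<or> X = gr D s2 \<union> gr D t" for X
  proof -
    have XE: "X \<subseteq> gr D s2 \<union> gr D t" using that by auto
    show "(z, ?z') \<in> X" using that z tz by auto
    show "X \<subseteq> D \<times> D"
    proof (rule subrelI)
      fix p q assume "(p, q) \<in> X"
      then show "(p, q) \<in> D \<times> D" using XE e[of p q] by blast
    qed
    show "p \<in> {z, ?z'} \<and> q \<in> {z, ?z'}" if "(p, q) \<in> X" "p \<in> {z, ?z'} \<or> q \<in> {z, ?z'}" for p q
      using XE e[of p q] that by blast
  qed
  have X': "{(p, q) \<in> gr D s2. p \<in> D'} = gr D' s2" "{(p, q) \<in> gr D t. p \<in> D'} = gr D' t"
    "{(p, q) \<in> gr D s2 \<union> gr D t. p \<in> D'} = gr D' s2 \<union> gr D' t"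
    by (auto simp: D'_def)
  note b = bypass_conn[OF fin s1 z z'(1,2)]
  show "(p, q) \<in> conn (gr D' s \<union> gr D' s2) \<longleftrightarrow> (p, q) \<in> conn (gr D s1 \<union> gr D s2)"
    if "p \<in> D'" "q \<in> D'" for p q
    using b(1)[OF X[of "gr D s2"], of p q] that X' unfolding D'_def s_def by auto
  show "2 * int (components D' t s s2) - int (orbs D' s s2) - int (orbs D' s t) =
     2 * int (components D t s1 s2) - int (orbs D s1 s2) - int (orbs D s1 t)"
    using b(2)[OF X[of "gr D s2"]] b(2)[OF X[of "gr D t"]] b(2)[OF X[of "gr D s2 \<union> gr D t"]] X'
    unfolding D'_def s_def components_def by auto
qed

text \<open>An exchange in \<open>s0\<close> replaces the edge by two dangling halves, one at each
  end, which \<open>remove_invisible_pair\<close> then discards. The loss of four flags lowers the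
  defect by four, so twice the number of components minus the number of faces may rise by
  one.\<close>

lemma delete_edge_flags:
  assumes fm: "flag_map D s0 s1 s2" and a: "a \<in> D"
  defines "D' \<equiv> D - {a, s0 a, s2 a, s0 (s2 a)}"
  shows "\<exists>s. flag_map D' s0 s s2 \<and>
    (\<forall>p\<in>D'. \<forall>q\<in>D'. (p, q) \<in> conn (gr D' s \<union> gr D' s2) \<longleftrightarrow> (p, q) \<in> conn (gr D s1 \<union> gr D s2)) \<and>
    defect D' s0 s s2 \<le> defect D s0 s1 s2"
proof -
  note fm = flag_mapD[OF fm]
  define b where "b = s2 a"
  define t where "t = swap_pairs s0 a b"
  have b: "b \<in> D" "b \<noteq> a" "b \<noteq> s0 a" "s2 b = a" using matchingD[OF fm(4) a] fm(6)[OF a] by (auto simp: b_def)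
  have ab: "s0 a \<in> D" "s0 b \<in> D" "s0 b = s2 (s0 a)" "s2 (s0 b) = s0 a"
  proof -
    show i: "s0 a \<in> D" "s0 b \<in> D" using matchingD(1)[OF fm(2)] a b(1) by auto
    show eq: "s0 b = s2 (s0 a)" unfolding b_def by (rule fm(5)[OF a])
    show "s2 (s0 b) = s0 a" unfolding eq by (rule matchingD(3)[OF fm(4) i(1)])
  qed
  note tv = swap_pairs_values[OF fm(2) a b(1-3), folded t_def]
  have ft: "matching D t" unfolding t_def by (rule matching_swap_pairs[OF fm(2) a b(1-3)])
  let ?K = "gr D s1 \<union> (gr D s2 \<union> gr D s0)" and ?K' = "gr D s1 \<union> (gr D s2 \<union> gr D t)"
  \<comment> \<open>Putting back the single pair \<open>(a, s0 a)\<close> restores the old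
    connections, because \<open>b\<close> and \<open>s0 b\<close> are still linked to its two
    elements. Hence at most one component is gained, and none if \<open>a\<close> and
    \<open>s0 a\<close> are still connected.\<close>
  have KK': "(p, q) \<in> conn (insert (a, s0 a) ?K')" if pq: "(p, q) \<in> conn ?K" for p q
    using pq
  proof (rule conn_least)
    fix p q assume e: "(p, q) \<in> ?K"
    let ?c = "conn (insert (a, s0 a) ?K')"
    have 1: "(a, s0 a) \<in> ?c" by (rule conn_base) simp
    have 2: "(a, b) \<in> ?c" by (rule conn_base) (simp add: a b_def)
    have 3: "(s0 a, s0 b) \<in> ?c" by (rule conn_base) (simp add: ab)
    have 4: "(b, s0 b) \<in> ?c" using conn_trans[OF conn_sym[OF 2] conn_trans[OF 1 3]] .
    show "(p, q) \<in> ?c"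
    proof (cases "p \<in> {a, b, s0 a, s0 b} \<and> q = s0 p")
      case True
      then show ?thesis
        using 1 4 conn_sym[OF 1] conn_sym[OF 4] matchingD(3)[OF fm(2) a] matchingD(3)[OF fm(2) b(1)] by auto
    next
      case False
      then show ?thesis using e by (intro conn_base) (auto simp: t_def swap_pairs_other)
    qed
  qed
  have k1: "ncomp D (insert (a, s0 a) ?K') \<le> ncomp D ?K"
    by (rule ncomp_le[OF fm(1)]) (rule KK')
  have k2: "ncomp D ?K' \<le> Suc (ncomp D ?K)"
    using ncomp_insert_bounds(2)[OF fm(1) a ab(1), of ?K'] k1 by linarith
  have k3: "ncomp D ?K' \<le> ncomp D ?K" if "(a, s0 a) \<in> conn ?K'"
    using ncomp_insert_same[OF that, of D] k1 by simp
  have r: "(p, q) \<in> conn ?K'" if "(p, q) \<in> conn (gr (D - {a, b, s0 a, s0 b}) s0 \<union> gr D s1)" for p q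
    using that by (rule conn_mono) (auto simp: t_def swap_pairs_other)
  \<comment> \<open>If two faces merge, or if one face is merely rerouted, then \<open>a\<close> and
    \<open>s0 a\<close> are still connected and no component is gained. If a face splits, the new
    face compensates for one half of the loss from a possible new component.\<close>
  have main: "2 * int (components D t s1 s2) - int (orbs D s1 t) \<le> 2 * int (components D s0 s1 s2) - int (orbs D s1 s0) + 1"
  proof (rule swap_pairs_cases[OF fm(1,3,2) a b(1-3)], fold t_def)
    assume "(a, s0 a) \<in> conn (gr (D - {a, b, s0 a, s0 b}) s0 \<union> gr D s1)"
      "orbs D s0 s1 = Suc (orbs D t s1)"
    then show ?thesis using k3[OF r] by (simp add: components_def orbs_commute[of D s1])
  next
    assume "orbs D t s1 = Suc (orbs D s0 s1)"
    then show ?thesis using k2 by (simp add: components_def orbs_commute[of D s1])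
  next
    assume h: "(a, s0 b) \<in> conn (gr (D - {a, b, s0 a, s0 b}) s0 \<union> gr D s1)"
      "orbs D t s1 = orbs D s0 s1"
    have "(s0 b, s0 a) \<in> conn ?K'" by (rule conn_base') (simp add: ab)
    then have "(a, s0 a) \<in> conn ?K'" using conn_trans[OF r[OF h(1)]] by blast
    then show ?thesis using k3 h(2) by (simp add: components_def orbs_commute[of D s1])
  qed
  define D1 where "D1 = D - {a, s2 a}"
  define u where "u = bypass s1 a (s2 a)"
  have ta: "t a = s2 a" using tv by (simp add: b_def)
  note R1 = remove_invisible_pair[OF fm(1) ft fm(4,3) a ta, folded D1_def u_def]
  have z: "s0 a \<in> D1" using ab(1) matchingD(2)[OF fm(2) a] b(3) by (auto simp: D1_def b_def)
  have tz: "t (s0 a) = s2 (s0 a)" using tv ab by simp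
  have finD1: "finite D1" using fm(1) by (simp add: D1_def)
  define s where "s = bypass u (s0 a) (s2 (s0 a))"
  have D': "D' = D1 - {s0 a, s2 (s0 a)}" using fm(5)[OF a] by (auto simp: D'_def D1_def)
  note R2 = remove_invisible_pair[OF finD1 R1(1-3) z tz, folded D' s_def]
  have D'Q: "D' = D - {a, b, s0 a, s0 b}" by (auto simp: D'_def b_def)
  have t0: "t p = s0 p" if "p \<in> D'" for p using that by (simp add: D'Q t_def swap_pairs_other)
  then have gt: "gr D' t = gr D' s0" by auto
  have "flag_map D' s0 s s2"
    using R2(1-3) t0 matching_cong[of D' t s0] fm(1,5,6) by (auto simp: flag_map_def D'_def)
  moreover have "(p, q) \<in> conn (gr D' s \<union> gr D' s2) \<longleftrightarrow> (p, q) \<in> conn (gr D s1 \<union> gr D s2)"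
    if "p \<in> D'" "q \<in> D'" for p q
    using R1(4)[of p q] R2(4)[OF that] that by (auto simp: D')
  moreover have "card D' + 4 = card D"
  proof -
    have "card {a, b, s0 a, s0 b} = 4"
    proof -
      have "s0 a \<noteq> a" "s0 b \<noteq> b" "s0 b \<noteq> a" "s0 a \<noteq> s0 b"
        using matchingD[OF fm(2) a] matchingD[OF fm(2) b(1)] matching_inj[OF fm(2) a b(1)] b(2,3) by auto
      then show ?thesis using b(2,3) by auto
    qed
    moreover have "{a, b, s0 a, s0 b} \<subseteq> D" using a b ab by auto
    ultimately show ?thesis unfolding D'Q using card_Diff_subset[of "{a, b, s0 a, s0 b}" D] card_mono[OF fm(1), of "{a, b, s0 a, s0 b}"] by auto
  qed
  then have c4: "int (card D') + 4 = int (card D)" by linarith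
  have ar: "4 * e2 + c' \<le> 4 * (2 * k - v - f) + c"
    if "2 * k1 - v - f1 = e1" "e2 = e1" "2 * k1 - f1 \<le> 2 * k - f + 1" "c' + 4 = c"
    for k k1 v f f1 e1 e2 c c' :: int using that by presburger
  have "defect D' s0 s s2 \<le> defect D s0 s1 s2"
    unfolding defect_def
    by (rule ar[OF R1(5)[symmetric] _ main c4]) (use R2(5) in \<open>simp add: components_def gt\<close>)
  ultimately show ?thesis by blast
qed

text \<open>The closure conditions make \<open>U\<close> a union of edges, so the edges outside it
  can be deleted one at a time.\<close>

lemma restrict_flags:
  assumes "flag_map D s0 s1 s2" "U \<subseteq> D" "\<And>a. a \<in> U \<Longrightarrow> s0 a \<in> U" "\<And>a. a \<in> U \<Longrightarrow> s2 a \<in> U"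
  shows "\<exists>s. flag_map U s0 s s2 \<and>
    (\<forall>p\<in>U. \<forall>q\<in>U. (p, q) \<in> conn (gr U s \<union> gr U s2) \<longleftrightarrow> (p, q) \<in> conn (gr D s1 \<union> gr D s2)) \<and>
    defect U s0 s s2 \<le> defect D s0 s1 s2"
  using assms(1,2)
proof (induction "card D" arbitrary: D s1 rule: less_induct)
  case less
  note fm = flag_mapD[OF less(2)]
  show ?case
  proof (cases "U = D")
    case True
    then show ?thesis using less(2) by (intro exI[of _ s1]) simp
  next
    case False
    then obtain a where a: "a \<in> D" "a \<notin> U" using less(3) by blast
    let ?D = "D - {a, s0 a, s2 a, s0 (s2 a)}"
    obtain s where s: "flag_map ?D s0 s s2"
      "\<forall>p\<in>?D. \<forall>q\<in>?D. (p, q) \<in> conn (gr ?D s \<union> gr ?D s2) \<longleftrightarrow> (p, q) \<in> conn (gr D s1 \<union> gr D s2)"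
      "defect ?D s0 s s2 \<le> defect D s0 s1 s2"
      using delete_edge_flags[OF less(2) a(1)] by blast
    have "s0 a \<notin> U" "s2 a \<notin> U" using a assms(3,4) matchingD(3)[OF fm(2) a(1)] matchingD(3)[OF fm(4) a(1)] by metis+
    moreover have "s0 (s2 a) \<notin> U"
      using \<open>s2 a \<notin> U\<close> assms(3) matchingD(3)[OF fm(2)] matchingD(1)[OF fm(4) a(1)] by metis
    ultimately have U: "U \<subseteq> ?D" using less(3) a by blast
    have "card ?D < card D" using a fm(1) by (intro psubset_card_mono) auto
    then obtain s' where s': "flag_map U s0 s' s2"
      "\<forall>p\<in>U. \<forall>q\<in>U. (p, q) \<in> conn (gr U s' \<union> gr U s2) \<longleftrightarrow> (p, q) \<in> conn (gr ?D s \<union> gr ?D s2)"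
      "defect U s0 s' s2 \<le> defect ?D s0 s s2"
      using less(1)[OF _ s(1) U] by blast
    have "\<forall>p\<in>U. \<forall>q\<in>U. (p, q) \<in> conn (gr U s' \<union> gr U s2) \<longleftrightarrow> (p, q) \<in> conn (gr D s1 \<union> gr D s2)"
    proof (intro ballI)
      fix p q assume "p \<in> U" "q \<in> U"
      then show "(p, q) \<in> conn (gr U s' \<union> gr U s2) \<longleftrightarrow> (p, q) \<in> conn (gr D s1 \<union> gr D s2)"
        using s'(2) s(2) U by (meson subsetD)
    qed
    then show ?thesis using s'(1,3) s(3) by (intro exI[of _ s']) (auto intro: order_trans)
  qed
qed

text \<open>Deleting all edges does not raise the defect, and the empty map has defect zero. This is
  Euler's inequality.\<close>

lemma defect_nonneg:
  assumes "flag_map D s0 s1 s2"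
  shows "0 \<le> defect D s0 s1 s2"
  using restrict_flags[OF assms, of "{}"] by (auto simp: defect_def components_def ncomp_def)

section \<open>Gluing along an edge\<close>

context
  fixes A :: "'a set" and B :: "'b set" and f g :: "'a \<Rightarrow> 'a" and f' g' :: "'b \<Rightarrow> 'b"
begin

abbreviation "sum_rel \<equiv> gr (A <+> B) (map_sum f f') \<union> gr (A <+> B) (map_sum g g')"

lemma conn_Inl_iff: "(Inl p, Inl q) \<in> conn sum_rel \<longleftrightarrow> (p, q) \<in> conn (gr A f \<union> gr A g)"
proof
  let ?h = "case_sum (\<lambda>a. a) (\<lambda>_. p) :: 'a + 'b \<Rightarrow> 'a"
  assume "(Inl p, Inl q) \<in> conn sum_rel"
  then have "(?h (Inl p), ?h (Inl q)) \<in> conn (gr A f \<union> gr A g)"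
    by (rule conn_map) (auto intro: conn_base)
  then show "(p, q) \<in> conn (gr A f \<union> gr A g)" by simp
next
  assume "(p, q) \<in> conn (gr A f \<union> gr A g)"
  then show "(Inl p, Inl q) \<in> conn sum_rel"
    by (rule conn_map[where g = Inl]) (auto intro: conn_base)
qed

lemma conn_Inr_iff: "(Inr p, Inr q) \<in> conn sum_rel \<longleftrightarrow> (p, q) \<in> conn (gr B f' \<union> gr B g')"
proof
  let ?h = "case_sum (\<lambda>_. p) (\<lambda>a. a) :: 'a + 'b \<Rightarrow> 'b"
  assume "(Inr p, Inr q) \<in> conn sum_rel"
  then have "(?h (Inr p), ?h (Inr q)) \<in> conn (gr B f' \<union> gr B g')"
    by (rule conn_map) (auto intro: conn_base)
  then show "(p, q) \<in> conn (gr B f' \<union> gr B g')" by simp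
next
  assume "(p, q) \<in> conn (gr B f' \<union> gr B g')"
  then show "(Inr p, Inr q) \<in> conn sum_rel"
    by (rule conn_map[where g = Inr]) (auto intro: conn_base)
qed

lemma conn_Inl_Inr: "(Inl p, Inr q) \<notin> conn sum_rel"
proof
  assume "(Inl p, Inr q) \<in> conn sum_rel"
  then have "isl (Inl p :: 'a + 'b) = isl (Inr q :: 'a + 'b)"
    by (rule conn_key) (auto simp: isl_map_sum)
  then show False by simp
qed

end

lemma orbs_sum:
  assumes "finite A" "finite B"
  shows "orbs (A <+> B) (map_sum f f') (map_sum g g') = orbs A f g + orbs B f' g'"
proof -
  let ?E = "gr (A <+> B) (map_sum f f') \<union> gr (A <+> B) (map_sum g g')"
  have "ncomp (Inl ` A \<union> Inr ` B) ?E = ncomp (Inl ` A) ?E + ncomp (Inr ` B) ?E"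
    by (rule ncomp_disjoint_union) (use assms in \<open>auto simp: conn_Inl_Inr\<close>)
  moreover have "orbs A f g = ncomp (Inl ` A) ?E"
    by (rule ncomp_transfer[where g = Inl]) (use assms in \<open>auto simp: conn_Inl_iff\<close>)
  moreover have "orbs B f' g' = ncomp (Inr ` B) ?E"
    by (rule ncomp_transfer[where g = Inr]) (use assms in \<open>auto simp: conn_Inr_iff\<close>)
  ultimately show ?thesis by (simp add: Plus_def)
qed

lemma matching_map_sum: "matching A f \<Longrightarrow> matching B g \<Longrightarrow> matching (A <+> B) (map_sum f g)"
  by (auto simp: matching_def)

text \<open>In the case \<open>apart\<close> the lost pairs remain connected through the remainder,
  so the only visible effect is that two classes merge.\<close>

lemma swap_pairs_merge_conn:
  assumes "finite D" "matching D t" "matching D s" "a \<in> D" "b \<in> D" "(a, b) \<notin> conn (gr D s \<union> gr D t)"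
  shows "conn (gr D (swap_pairs s a b) \<union> gr D t) = conn (insert (a, b) (gr D s \<union> gr D t))"
proof -
  note ne = ncomp_swap_pairs_merge(1,2)[OF assms]
  let ?E' = "gr D (swap_pairs s a b) \<union> gr D t"
  define r where "r = gr (D - {a, b, s a, s b}) s \<union> gr D t"
  have ns: "(a, s b) \<notin> conn (gr D s \<union> gr D t)"
  proof
    assume "(a, s b) \<in> conn (gr D s \<union> gr D t)"
    also have "(s b, b) \<in> conn (gr D s \<union> gr D t)" by (rule conn_base') (simp add: assms(5))
    finally show False using assms(6) by simp
  qed
  have rE: "(p, q) \<in> conn (gr D s \<union> gr D t)" if "(p, q) \<in> conn r" for p q
    using that by (rule conn_mono) (auto simp: r_def)
  have rs: "(a, s a) \<in> conn r" "(b, s b) \<in> conn r"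
    using swap_pairs_cases[OF assms(1-5) ne, folded r_def, of "(a, s a) \<in> conn r \<and> (b, s b) \<in> conn r"]
      rE[of a b] rE[of a "s b"] assms(6) ns by blast+
  have eq: "conn ?E' = conn (insert (a, b) (insert (s a, s b) r))"
    "conn (gr D s \<union> gr D t) = conn (insert (a, s a) (insert (b, s b) r))"
    using conn_swap_pairs_sets[OF assms(3-5) ne] by (auto simp: r_def)
  have m: "(p, q) \<in> conn (insert (a, b) X)" if "(p, q) \<in> conn X" for p q and X :: "'a rel"
    using that by (rule conn_mono) auto
  let ?F = "insert (a, b) (gr D s \<union> gr D t)"
  have "(s a, a) \<in> conn ?F" "(a, b) \<in> conn ?F" "(b, s b) \<in> conn ?F"
    by (rule m conn_sym[OF m] rE rs conn_base insertI1)+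
  then have sab: "(s a, s b) \<in> conn ?F" using conn_trans by metis
  show ?thesis
  proof (intro equalityI subrelI)
    fix p q assume "(p, q) \<in> conn ?E'"
    then show "(p, q) \<in> conn ?F"
      unfolding eq(1)
    proof (rule conn_least)
      fix p q assume "(p, q) \<in> insert (a, b) (insert (s a, s b) r)"
      then consider "(p, q) \<in> r" | "p = a" "q = b" | "p = s a" "q = s b" by auto
      then show "(p, q) \<in> conn ?F"
        using sab m[OF rE[OF conn_base, of p q]] by cases (auto intro: conn_base)
    qed
  next
    fix p q assume "(p, q) \<in> conn ?F"
    then show "(p, q) \<in> conn ?E'"
      unfolding eq(1)
    proof (rule conn_least)
      let ?G = "insert (a, b) (insert (s a, s b) r)"
      fix p q assume "(p, q) \<in> ?F"
      then have "(p, q) = (a, b) \<or> (p, q) \<in> conn (insert (a, s a) (insert (b, s b) r))"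
        using conn_base[of p q "gr D s \<union> gr D t", unfolded eq(2)] by blast
      then show "(p, q) \<in> conn ?G"
      proof
        assume "(p, q) \<in> conn (insert (a, s a) (insert (b, s b) r))"
        then show ?thesis
        proof (rule conn_least)
          have rG: "(p, q) \<in> conn ?G" if "(p, q) \<in> conn r" for p q
            using that by (rule conn_mono) auto
          fix p q assume "(p, q) \<in> insert (a, s a) (insert (b, s b) r)"
          then have "(p, q) \<in> conn r" using rs conn_base[of p q r] by blast
          then show "(p, q) \<in> conn ?G" by (rule rG)
        qed
      qed (auto intro: conn_base)
    qed
  qed
qed

text \<open>One exchange in the side gluing for each end of the edge; only after both does the
  result commute again with exchanging the ends of sides.\<close>

definition glue_sides :: "('f \<Rightarrow> 'f) \<Rightarrow> ('f \<Rightarrow> 'f) \<Rightarrow> ('g \<Rightarrow> 'g) \<Rightarrow> ('g \<Rightarrow> 'g) \<Rightarrow> 'f \<Rightarrow> 'g \<Rightarrow> 'f + 'g \<Rightarrow> 'f + 'g" where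
  "glue_sides s0 s2 t0 t2 a b =
     swap_pairs (swap_pairs (map_sum s2 t2) (Inl a) (Inr b)) (Inl (s0 a)) (Inr (t0 b))"

text \<open>The two sides of each edge are separated and glued to the sides of the other edge, so that two
  parallel edges result.\<close>

lemma glue_along_edge:
  assumes A: "flag_map A s0 s1 s2" and B: "flag_map B t0 t1 t2" and a: "a \<in> A" and b: "b \<in> B"
    and na: "(a, s0 a) \<notin> conn (gr A s1 \<union> gr A s2)" and nb: "(b, t0 b) \<notin> conn (gr B t1 \<union> gr B t2)"
  defines "D \<equiv> A <+> B" and "u0 \<equiv> map_sum s0 t0" and "u1 \<equiv> map_sum s1 t1" and "u2 \<equiv> glue_sides s0 s2 t0 t2 a b"
  shows "flag_map D u0 u1 u2"
    "orbs D u1 u2 + 2 = orbs A s1 s2 + orbs B t1 t2"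
    "orbs D u1 u0 = orbs A s1 s0 + orbs B t1 t0"
    "conn (gr D u1 \<union> gr D u2) =
      conn (insert (Inl (s0 a), Inr (t0 b)) (insert (Inl a, Inr b) (gr D u1 \<union> gr D (map_sum s2 t2))))"
    "u2 (Inl a) = Inr b" "u2 (Inr b) = Inl a" "u2 (Inl (s2 a)) = Inr (t2 b)" "u2 (Inr (t2 b)) = Inl (s2 a)"
    "u2 (Inl (s0 a)) = Inr (t0 b)" "u2 (Inr (t0 b)) = Inl (s0 a)"
    "u2 (Inl (s0 (s2 a))) = Inr (t0 (t2 b))" "u2 (Inr (t0 (t2 b))) = Inl (s0 (s2 a))"
    "\<And>p. p \<notin> {a, s2 a, s0 a, s0 (s2 a)} \<Longrightarrow> u2 (Inl p) = Inl (s2 p)"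
    "\<And>p. p \<notin> {b, t2 b, t0 b, t0 (t2 b)} \<Longrightarrow> u2 (Inr p) = Inr (t2 p)"
proof -
  note fA = flag_mapD[OF A] and fB = flag_mapD[OF B]
  define m where "m = (map_sum s2 t2 :: 'a + 'b \<Rightarrow> _)"
  define m' where "m' = swap_pairs m (Inl a) (Inr b)"
  have u2: "u2 = swap_pairs m' (Inl (s0 a)) (Inr (t0 b))" by (simp add: u2_def glue_sides_def m'_def m_def)
  have finD: "finite D" using fA(1) fB(1) by (simp add: D_def)
  have fu0: "matching D u0" and fu1: "matching D u1" and fm: "matching D m"
    unfolding D_def u0_def u1_def m_def by (rule matching_map_sum fA fB)+
  have inD: "Inl a \<in> D" "Inr b \<in> D" "Inl (s0 a) \<in> D" "Inr (t0 b) \<in> D"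
    using a b matchingD(1)[OF fA(2) a] matchingD(1)[OF fB(2) b] by (auto simp: D_def)
  have n1: "(Inl a, Inr b) \<notin> conn (gr D m \<union> gr D u1)"
    unfolding D_def m_def u1_def by (rule conn_Inl_Inr)
  note M1 = ncomp_swap_pairs_merge[OF finD fu1 fm inD(1,2) n1, folded m'_def]
  note C1 = swap_pairs_merge_conn[OF finD fu1 fm inD(1,2) n1, folded m'_def]
  have fm': "matching D m'" unfolding m'_def by (rule matching_swap_pairs[OF fm inD(1,2) M1(1,2)])
  \<comment> \<open>The first exchange merges the vertices of \<open>a\<close> and \<open>b\<close>
    only. By \<open>na\<close> the edge is not a loop, so its other ends still lie at different
    vertices and the second exchange merges two vertices as well.\<close>
  have n2: "(Inl (s0 a), Inr (t0 b)) \<notin> conn (gr D m' \<union> gr D u1)"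
  proof -
    have i: "(Inl p, Inr q) \<notin> conn (gr D m \<union> gr D u1)" for p q
      unfolding D_def m_def u1_def by (rule conn_Inl_Inr)
    have "(Inl (s0 a), Inl a) \<notin> conn (gr D m \<union> gr D u1)"
      unfolding D_def m_def u1_def conn_Inl_iff using na by (simp add: Un_commute conn_sym_iff)
    then show ?thesis unfolding C1 conn_insert using i by blast
  qed
  note M2 = ncomp_swap_pairs_merge[OF finD fu1 fm' inD(3,4) n2, folded u2]
  note C2 = swap_pairs_merge_conn[OF finD fu1 fm' inD(3,4) n2, folded u2]
  have fu2: "matching D u2" unfolding u2 by (rule matching_swap_pairs[OF fm' inD(3,4) M2(1,2)])
  show "orbs D u1 u2 + 2 = orbs A s1 s2 + orbs B t1 t2"
    using M1(3) M2(3) orbs_sum[OF fA(1) fB(1), of s1 t1 s2 t2] orbs_commute[of D u1]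
    by (simp add: D_def u1_def m_def)
  show "orbs D u1 u0 = orbs A s1 s0 + orbs B t1 t0"
    unfolding D_def u1_def u0_def by (rule orbs_sum[OF fA(1) fB(1)])
  have "conn (gr D u2 \<union> gr D u1) = conn (insert (Inl (s0 a), Inr (t0 b)) (insert (Inl a, Inr b) (gr D m \<union> gr D u1)))"
  proof -
    have i: "conn (insert e X) = conn (insert e Y)" if "conn X = conn Y" for e and X Y :: "('a + 'b) rel"
      by (cases e) (simp add: set_eq_iff conn_insert that)
    show ?thesis unfolding C2 by (rule i[OF C1])
  qed
  then show "conn (gr D u1 \<union> gr D u2) =
      conn (insert (Inl (s0 a), Inr (t0 b)) (insert (Inl a, Inr b) (gr D u1 \<union> gr D (map_sum s2 t2))))"
    by (simp add: Un_commute m_def)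
  have neA: "s0 a \<noteq> a" "s0 a \<noteq> s2 a" "s2 (s0 a) \<noteq> a" "s2 (s0 a) \<noteq> s2 a" "s2 a \<noteq> a" "s0 (s2 a) = s2 (s0 a)" "s2 (s0 a) \<noteq> s0 a"
    and neB: "t0 b \<noteq> b" "t0 b \<noteq> t2 b" "t2 (t0 b) \<noteq> b" "t2 (t0 b) \<noteq> t2 b" "t2 b \<noteq> b" "t0 (t2 b) = t2 (t0 b)" "t2 (t0 b) \<noteq> t0 b"
    using matchingD[OF fA(2) a] matchingD[OF fA(4) a] fA(5,6)[OF a] matching_inj[OF fA(4) a, of "s0 a"] matchingD[OF fA(4), of "s0 a"]
      matchingD[OF fB(2) b] matchingD[OF fB(4) b] fB(5,6)[OF b] matching_inj[OF fB(4) b, of "t0 b"] matchingD[OF fB(4), of "t0 b"]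
    by auto
  have m'v: "m' (Inl a) = Inr b" "m' (Inr b) = Inl a" "m' (Inl (s2 a)) = Inr (t2 b)" "m' (Inr (t2 b)) = Inl (s2 a)"
    "\<And>p. p \<notin> {a, s2 a} \<Longrightarrow> m' (Inl p) = Inl (s2 p)" "\<And>p. p \<notin> {b, t2 b} \<Longrightarrow> m' (Inr p) = Inr (t2 p)"
    using swap_pairs_values[OF fm inD(1,2) M1(1,2)] swap_pairs_other[of _ "Inl a" "Inr b" m]
    by (auto simp: m'_def m_def)
  have m's: "m' (Inl (s0 a)) = Inl (s0 (s2 a))" "m' (Inr (t0 b)) = Inr (t0 (t2 b))"
    using m'v(5)[of "s0 a"] m'v(6)[of "t0 b"] neA neB by auto
  note v = swap_pairs_values[OF fm' inD(3,4) M2(1,2), folded u2, unfolded m's]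
  have o: "u2 d = m' d" if "d \<notin> {Inl (s0 a), Inr (t0 b), Inl (s0 (s2 a)), Inr (t0 (t2 b))}" for d
    using swap_pairs_other[of d "Inl (s0 a)" "Inr (t0 b)" m'] that unfolding u2 m's by blast
  have A4: "a \<notin> {s0 a, s0 (s2 a)}" "s2 a \<notin> {s0 a, s0 (s2 a)}" using neA by auto
  have B4: "b \<notin> {t0 b, t0 (t2 b)}" "t2 b \<notin> {t0 b, t0 (t2 b)}" using neB by auto
  show uv: "u2 (Inl a) = Inr b" "u2 (Inr b) = Inl a" "u2 (Inl (s2 a)) = Inr (t2 b)" "u2 (Inr (t2 b)) = Inl (s2 a)"
    "u2 (Inl (s0 a)) = Inr (t0 b)" "u2 (Inr (t0 b)) = Inl (s0 a)"
    "u2 (Inl (s0 (s2 a))) = Inr (t0 (t2 b))" "u2 (Inr (t0 (t2 b))) = Inl (s0 (s2 a))"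
    using v A4 B4 m'v(1-4) by (auto simp: o)
  show uo: "u2 (Inl p) = Inl (s2 p)" if "p \<notin> {a, s2 a, s0 a, s0 (s2 a)}" for p
    using that m'v(5)[of p] o[of "Inl p"] by auto
  show uo': "u2 (Inr p) = Inr (t2 p)" if "p \<notin> {b, t2 b, t0 b, t0 (t2 b)}" for p
    using that m'v(6)[of p] o[of "Inr p"] by auto
  show "flag_map D u0 u1 u2"
    unfolding flag_map_def
  proof (intro conjI finD fu0 fu1 fu2 ballI)
    have q: "s0 p \<in> {a, s2 a, s0 a, s0 (s2 a)} \<longleftrightarrow> p \<in> {a, s2 a, s0 a, s0 (s2 a)}" if "p \<in> A" for p
      using matchingD(3)[OF fA(2) that] matchingD(3)[OF fA(2) a] matchingD(3)[OF fA(2) matchingD(1)[OF fA(4) a]] by auto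
    have q': "t0 p \<in> {b, t2 b, t0 b, t0 (t2 b)} \<longleftrightarrow> p \<in> {b, t2 b, t0 b, t0 (t2 b)}" if "p \<in> B" for p
      using matchingD(3)[OF fB(2) that] matchingD(3)[OF fB(2) b] matchingD(3)[OF fB(2) matchingD(1)[OF fB(4) b]] by auto
    have inv: "s0 (s0 a) = a" "s0 (s0 (s2 a)) = s2 a" "t0 (t0 b) = b" "t0 (t0 (t2 b)) = t2 b"
      using matchingD(3)[OF fA(2) a] matchingD(3)[OF fA(2) matchingD(1)[OF fA(4) a]]
        matchingD(3)[OF fB(2) b] matchingD(3)[OF fB(2) matchingD(1)[OF fB(4) b]] by auto
    fix d assume "d \<in> D"
    then consider p where "d = Inl p" "p \<in> A" | p where "d = Inr p" "p \<in> B" by (auto simp: D_def)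
    then have "u0 (u2 d) = u2 (u0 d) \<and> u2 d \<noteq> u0 d"
    proof cases
      case (1 p)
      show ?thesis
      proof (cases "p \<in> {a, s2 a, s0 a, s0 (s2 a)}")
        case True
        then consider "p = a" | "p = s2 a" | "p = s0 a" | "p = s0 (s2 a)" by blast
        then show ?thesis by cases (simp_all add: 1(1) uv u0_def inv)
      next
        case False
        then show ?thesis using q[OF 1(2)] uo[of p] uo[of "s0 p"] fA(5,6)[OF 1(2)] by (simp add: 1(1) u0_def)
      qed
    next
      case (2 p)
      show ?thesis
      proof (cases "p \<in> {b, t2 b, t0 b, t0 (t2 b)}")
        case True
        then consider "p = b" | "p = t2 b" | "p = t0 b" | "p = t0 (t2 b)" by blast
        then show ?thesis by cases (simp_all add: 2(1) uv u0_def inv)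
      next
        case False
        then show ?thesis using q'[OF 2(2)] uo'[of p] uo'[of "t0 p"] fB(5,6)[OF 2(2)] by (simp add: 2(1) u0_def)
      qed
    qed
    then show "u0 (u2 d) = u2 (u0 d)" "u2 d \<noteq> u0 d" by auto
  qed
qed

section \<open>Euler genus of graphs\<close>

lemma conn_symmetric:
  assumes "\<And>p q. (p, q) \<in> E \<Longrightarrow> (q, p) \<in> E"
  shows "conn E = E\<^sup>*"
proof -
  have "E \<union> E\<inverse> = E" using assms by auto
  then show ?thesis by (simp add: conn_def)
qed

text \<open>A matching is its own inverse, so the one-directional reachability in
  \<open>orbit_classes\<close> is already symmetric.\<close>

lemma orbit_classes_2:
  assumes "matching D f" "matching D g"
  shows "orbit_classes D {f, g} = D // conn (gr D f \<union> gr D g)"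
proof -
  have "{(a, b). a \<in> D \<and> (\<exists>h\<in>{f, g}. b = h a)} = gr D f \<union> gr D g" by auto
  moreover have "conn (gr D f \<union> gr D g) = (gr D f \<union> gr D g)\<^sup>*"
  proof (rule conn_symmetric)
    show "(q, p) \<in> gr D f \<union> gr D g" if "(p, q) \<in> gr D f \<union> gr D g" for p q
      using that gr_sym[OF assms(1), of p q] gr_sym[OF assms(2), of p q] by blast
  qed
  ultimately show ?thesis unfolding orbit_classes_def by (simp only:)
qed

lemma orbit_classes_3:
  assumes "matching D f" "matching D g" "matching D h"
  shows "orbit_classes D {f, g, h} = D // conn (gr D g \<union> (gr D h \<union> gr D f))"
proof -
  have "{(a, b). a \<in> D \<and> (\<exists>k\<in>{f, g, h}. b = k a)} = gr D g \<union> (gr D h \<union> gr D f)" by auto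
  moreover have "conn (gr D g \<union> (gr D h \<union> gr D f)) = (gr D g \<union> (gr D h \<union> gr D f))\<^sup>*"
  proof (rule conn_symmetric)
    show "(q, p) \<in> gr D g \<union> (gr D h \<union> gr D f)" if "(p, q) \<in> gr D g \<union> (gr D h \<union> gr D f)" for p q
      using that gr_sym[OF assms(1), of p q] gr_sym[OF assms(2), of p q] gr_sym[OF assms(3), of p q] by blast
  qed
  ultimately show ?thesis unfolding orbit_classes_def by (simp only:)
qed

lemma edge_class:
  assumes "flag_map D s0 s1 s2" "a \<in> D"
  shows "conn (gr D s0 \<union> gr D s2) `` {a} = {a, s0 a, s2 a, s0 (s2 a)}"
    "card {a, s0 a, s2 a, s0 (s2 a)} = 4" "{a, s0 a, s2 a, s0 (s2 a)} \<subseteq> D"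
proof -
  note fm = flag_mapD[OF assms(1)]
  let ?E = "gr D s0 \<union> gr D s2" and ?Q = "{a, s0 a, s2 a, s0 (s2 a)}"
  have D: "s0 a \<in> D" "s2 a \<in> D" "s0 (s2 a) \<in> D"
    using matchingD(1)[OF fm(2)] matchingD(1)[OF fm(4)] assms(2) by auto
  then show "?Q \<subseteq> D" using assms(2) by auto
  have c: "s0 (s0 a) = a" "s2 (s2 a) = a" "s0 (s0 (s2 a)) = s2 a" "s2 (s0 a) = s0 (s2 a)" "s2 (s0 (s2 a)) = s0 a"
    using matchingD(3)[OF fm(2) assms(2)] matchingD(3)[OF fm(4) assms(2)] matchingD(3)[OF fm(2) D(2)]
      fm(5)[OF assms(2)] matchingD(3)[OF fm(4) D(1)] by simp_all
  have Qc: "s0 p \<in> ?Q" "s2 p \<in> ?Q" if "p \<in> ?Q" for p using that c by auto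
  have "b \<in> ?Q" if "(a, b) \<in> conn ?E" for b
    using that
  proof (rule conn_closed)
    fix p q assume pq: "(p, q) \<in> ?E"
    then have "q = s0 p \<or> q = s2 p" by auto
    moreover have "p = s0 q \<or> p = s2 q" using pq matchingD(3)[OF fm(2), of p] matchingD(3)[OF fm(4), of p] by auto
    ultimately show "p \<in> ?Q \<longleftrightarrow> q \<in> ?Q" using Qc[of p] Qc[of q] by metis
  qed simp
  moreover have "(a, s0 a) \<in> conn ?E" "(a, s2 a) \<in> conn ?E" "(s2 a, s0 (s2 a)) \<in> conn ?E"
    using assms(2) D by (auto intro: conn_base)
  moreover from this have "(a, s0 (s2 a)) \<in> conn ?E" using conn_trans by metis
  ultimately show "conn ?E `` {a} = ?Q" by auto
  have "s0 a \<noteq> a" "s2 a \<noteq> a" "s2 a \<noteq> s0 a" "s0 (s2 a) \<noteq> s2 a" "s0 (s2 a) \<noteq> s0 a" "s0 (s2 a) \<noteq> a"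
    using matchingD(2)[OF fm(2)] matchingD(2)[OF fm(4)] fm(6) assms(2) D matching_inj[OF fm(2) D(2) assms(2)] c by metis+
  then show "card ?Q = 4" by auto
qed

text \<open>The origin of the term \<open>card D\<close> in \<open>defect\<close>: it is four times
  the number of edges, so no division is necessary.\<close>

lemma card_flags:
  assumes "flag_map D s0 s1 s2"
  shows "4 * ncomp D (gr D s0 \<union> gr D s2) = card D"
  by (rule ncomp_class_card_eq) (use flag_mapD(1)[OF assms] edge_class[OF assms] in auto)

lemma closed_surface_iff:
  "closed_surface S \<longleftrightarrow> flag_map (flags S) (opp S) (turn S) (glue S) \<and>
     components (flags S) (opp S) (turn S) (glue S) = 1"
proof -
  have "card (orbit_classes (flags S) {opp S, turn S, glue S}) = components (flags S) (opp S) (turn S) (glue S)"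
    if "flag_map (flags S) (opp S) (turn S) (glue S)"
    using flag_mapD(2-4)[OF that] by (simp add: orbit_classes_3 components_def ncomp_def)
  moreover have "free_involution_on D f = matching D f" for D f by (auto simp: free_involution_on_def matching_def)
  ultimately show ?thesis unfolding closed_surface_def flag_map_def by (auto simp: flag_map_def)
qed

lemma defect_surface:
  assumes "closed_surface S"
  shows "4 * surface_euler_genus S = defect (flags S) (opp S) (turn S) (glue S)"
proof -
  have fm: "flag_map (flags S) (opp S) (turn S) (glue S)" "components (flags S) (opp S) (turn S) (glue S) = 1"
    using assms by (auto simp: closed_surface_iff)
  note f = flag_mapD(2-4)[OF fm(1)]
  show ?thesis
    unfolding surface_euler_genus_def euler_char_def surface_verts_def surface_edges_def surface_faces_def defect_def fm(2)
      orbit_classes_2[OF f(2,3)] orbit_classes_2[OF f(1,3)] orbit_classes_2[OF f(1,2)]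
    using card_flags[OF fm(1)] by (simp add: ncomp_def[symmetric] Un_commute)
qed

text \<open>The counterpart of \<open>embeds_in\<close> for any flag type: a graph vertex is
  represented by a flag instead of by its orbit, so a choice of flags can be kept while the orbits
  change.\<close>

definition drawn :: "'a graph \<Rightarrow> 'f set \<Rightarrow> ('f \<Rightarrow> 'f) \<Rightarrow> ('f \<Rightarrow> 'f) \<Rightarrow> ('f \<Rightarrow> 'f) \<Rightarrow> bool" where
  "drawn G D s0 s1 s2 \<longleftrightarrow> (\<exists>f. f ` verts G \<subseteq> D \<and>
     (\<forall>u\<in>verts G. \<forall>v\<in>verts G. (f u, f v) \<in> conn (gr D s1 \<union> gr D s2) \<longrightarrow> u = v) \<and>
     (\<forall>u v. {u, v} \<in> edges G \<longrightarrow>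
       (\<exists>a\<in>D. (f u, a) \<in> conn (gr D s1 \<union> gr D s2) \<and> (f v, s0 a) \<in> conn (gr D s1 \<union> gr D s2))))"

lemma simple_graph_edge:
  assumes "simple_graph G" "{u, v} \<in> edges G"
  shows "u \<in> verts G" "v \<in> verts G" "u \<noteq> v"
  using assms unfolding simple_graph_def by (auto simp: doubleton_eq_iff)

lemma embeds_in_iff:
  assumes "closed_surface S" "simple_graph G"
  shows "embeds_in G S \<longleftrightarrow> drawn G (flags S) (opp S) (turn S) (glue S)"
proof -
  let ?D = "flags S"
  let ?E = "gr ?D (turn S) \<union> gr ?D (glue S)"
  have fm: "flag_map ?D (opp S) (turn S) (glue S)" using assms by (simp add: closed_surface_iff)
  note f = flag_mapD(2-4)[OF fm]
  have sv: "surface_verts S = ?D // conn ?E" unfolding surface_verts_def by (rule orbit_classes_2[OF f(2,3)])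
  show ?thesis
  proof
    assume "embeds_in G S"
    then obtain h where h: "inj_on h (verts G)" "h ` verts G \<subseteq> ?D // conn ?E"
      "\<And>u v. {u, v} \<in> edges G \<Longrightarrow> \<exists>a\<in>?D. a \<in> h u \<and> opp S a \<in> h v"
      unfolding embeds_in_def sv by blast
    have "\<exists>d\<in>?D. h u = conn ?E `` {d}" if "u \<in> verts G" for u
      using h(2) that by (auto simp: quotient_def)
    then obtain k where k: "\<And>u. u \<in> verts G \<Longrightarrow> k u \<in> ?D \<and> h u = conn ?E `` {k u}" by metis
    show "drawn G ?D (opp S) (turn S) (glue S)"
      unfolding drawn_def
    proof (intro exI[of _ k] conjI ballI allI impI)
      show "k ` verts G \<subseteq> ?D" using k by auto
    next
      fix u v assume uv: "u \<in> verts G" "v \<in> verts G" "(k u, k v) \<in> conn ?E"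
      then have "h u = h v" using k by (simp add: class_eq_iff)
      then show "u = v" using h(1) uv by (simp add: inj_on_eq_iff)
    next
      fix u v assume e: "{u, v} \<in> edges G"
      obtain a where "a \<in> ?D" "a \<in> h u" "opp S a \<in> h v" using h(3)[OF e] by blast
      then show "\<exists>a\<in>?D. (k u, a) \<in> conn ?E \<and> (k v, opp S a) \<in> conn ?E"
        using k simple_graph_edge[OF assms(2) e] by auto
    qed
  next
    assume "drawn G ?D (opp S) (turn S) (glue S)"
    then obtain k where k: "k ` verts G \<subseteq> ?D" "\<And>u v. u \<in> verts G \<Longrightarrow> v \<in> verts G \<Longrightarrow> (k u, k v) \<in> conn ?E \<Longrightarrow> u = v"
      "\<And>u v. {u, v} \<in> edges G \<Longrightarrow> \<exists>a\<in>?D. (k u, a) \<in> conn ?E \<and> (k v, opp S a) \<in> conn ?E"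
      unfolding drawn_def by blast
    show "embeds_in G S"
      unfolding embeds_in_def sv
    proof (intro exI[of _ "\<lambda>u. conn ?E `` {k u}"] conjI allI impI)
      show "inj_on (\<lambda>u. conn ?E `` {k u}) (verts G)"
        by (rule inj_onI) (simp add: class_eq_iff k(2))
      show "(\<lambda>u. conn ?E `` {k u}) ` verts G \<subseteq> ?D // conn ?E"
        using k(1) by (auto simp: quotient_def)
      show "\<exists>a\<in>?D. a \<in> conn ?E `` {k u} \<and> opp S a \<in> conn ?E `` {k v}" if "{u, v} \<in> edges G" for u v
        using k(3)[OF that] by simp
    qed
  qed
qed

lemma conn_image_iff:
  assumes "inj_on g D" "E \<subseteq> D \<times> D" "a \<in> D" "b \<in> D"
  shows "(g a, g b) \<in> conn (map_prod g g ` E) \<longleftrightarrow> (a, b) \<in> conn E"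
proof
  assume "(a, b) \<in> conn E"
  then show "(g a, g b) \<in> conn (map_prod g g ` E)"
    by (rule conn_map) (auto intro!: conn_base)
next
  assume "(g a, g b) \<in> conn (map_prod g g ` E)"
  then have "(inv_into D g (g a), inv_into D g (g b)) \<in> conn E"
  proof (rule conn_map)
    fix p q assume "(p, q) \<in> map_prod g g ` E"
    then obtain c d where "(c, d) \<in> E" "p = g c" "q = g d" by auto
    moreover from this have "c \<in> D" "d \<in> D" using assms(2) by auto
    ultimately show "(inv_into D g p, inv_into D g q) \<in> conn E"
      using assms(1) by (simp add: conn_base)
  qed
  then show "(a, b) \<in> conn E" using assms by simp
qed

lemma ncomp_image_eq:
  assumes "finite D" "inj_on g D" "E \<subseteq> D \<times> D"
  shows "ncomp (g ` D) (map_prod g g ` E) = ncomp D E"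
  by (rule ncomp_transfer[symmetric, where g = g]) (use assms in \<open>auto simp: conn_image_iff\<close>)

text \<open>Surfaces have natural numbers as flags, whereas the constructions use sums and triples;
  a finite flag set can be renumbered.\<close>

lemma transfer_to_nat:
  fixes D :: "'f set"
  assumes fm: "flag_map D s0 s1 s2" and dr: "drawn G D s0 s1 s2" and simple: "simple_graph G"
  obtains D' :: "nat set" and t0 t1 t2 where "flag_map D' t0 t1 t2" "drawn G D' t0 t1 t2"
    "defect D' t0 t1 t2 = defect D s0 s1 s2" "components D' t0 t1 t2 = components D s0 s1 s2"
proof -
  note f = flag_mapD[OF fm]
  obtain g :: "'f \<Rightarrow> nat" where g: "inj_on g D" using finite_imp_inj_to_nat_seg[OF f(1)] by blast
  define i where "i = inv_into D g"
  define D' where "D' = g ` D"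
  define t where "t s = (\<lambda>n. g (s (i n)))" for s :: "'f \<Rightarrow> 'f"
  have ig: "i (g a) = a" if "a \<in> D" for a using that g by (simp add: i_def)
  have tg: "t s (g a) = g (s a)" if "a \<in> D" for s a using that by (simp add: t_def ig)
  have gi: "g a = g b \<longleftrightarrow> a = b" if "a \<in> D" "b \<in> D" for a b using g that by (simp add: inj_on_eq_iff)
  have ft: "matching D' (t s)" if "matching D s" for s
    unfolding matching_def D'_def using that by (auto simp: tg gi matchingD)
  have gt: "gr D' (t s) = map_prod g g ` gr D s" for s
  proof (intro equalityI subrelI)
    fix p q assume "(p, q) \<in> gr D' (t s)"
    then obtain a where a: "a \<in> D" "p = g a" "q = g (s a)" by (auto simp: D'_def tg)
    then show "(p, q) \<in> map_prod g g ` gr D s" by force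
  next
    fix p q assume "(p, q) \<in> map_prod g g ` gr D s"
    then show "(p, q) \<in> gr D' (t s)" by (auto simp: D'_def tg)
  qed
  have sub: "gr D s \<subseteq> D \<times> D" if "matching D s" for s using that by (auto dest: matchingD)
  have nc: "ncomp D' (map_prod g g ` E) = ncomp D E" if "E \<subseteq> D \<times> D" for E
    unfolding D'_def by (rule ncomp_image_eq[OF f(1) g that])
  have "flag_map D' (t s0) (t s1) (t s2)"
    unfolding flag_map_def
  proof (intro conjI ft f)
    show "finite D'" using f(1) by (simp add: D'_def)
    show "\<forall>a\<in>D'. t s0 (t s2 a) = t s2 (t s0 a)"
      using f(5) matchingD(1)[OF f(2)] matchingD(1)[OF f(4)] by (auto simp: D'_def tg)
    show "\<forall>a\<in>D'. t s2 a \<noteq> t s0 a"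
      using f(6) matchingD(1)[OF f(2)] matchingD(1)[OF f(4)] by (auto simp: D'_def tg gi)
  qed
  moreover have V: "orbs D' (t s1) (t s2) = orbs D s1 s2"
    using nc[of "gr D s1 \<union> gr D s2"] sub f(3,4) by (simp add: gt image_Un)
  moreover have F: "orbs D' (t s1) (t s0) = orbs D s1 s0"
    using nc[of "gr D s1 \<union> gr D s0"] sub f(3,2) by (simp add: gt image_Un)
  moreover have K: "components D' (t s0) (t s1) (t s2) = components D s0 s1 s2"
    using nc[of "gr D s1 \<union> (gr D s2 \<union> gr D s0)"] sub f(2-4) by (simp add: gt image_Un components_def)
  moreover have "card D' = card D" unfolding D'_def by (rule card_image[OF g])
  moreover have "drawn G D' (t s0) (t s1) (t s2)"
  proof -
    let ?E = "gr D s1 \<union> gr D s2" and ?E' = "gr D' (t s1) \<union> gr D' (t s2)"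
    obtain k where k: "k ` verts G \<subseteq> D" "\<And>u v. u \<in> verts G \<Longrightarrow> v \<in> verts G \<Longrightarrow> (k u, k v) \<in> conn ?E \<Longrightarrow> u = v"
      "\<And>u v. {u, v} \<in> edges G \<Longrightarrow> \<exists>a\<in>D. (k u, a) \<in> conn ?E \<and> (k v, s0 a) \<in> conn ?E"
      using dr unfolding drawn_def by blast
    have E': "(g a, g b) \<in> conn ?E' \<longleftrightarrow> (a, b) \<in> conn ?E" if "a \<in> D" "b \<in> D" for a b
      using conn_image_iff[OF g _ that, of ?E] sub f(3,4) by (simp add: gt image_Un)
    show ?thesis
      unfolding drawn_def
    proof (intro exI[of _ "\<lambda>u. g (k u)"] conjI ballI allI impI)
      show "(\<lambda>u. g (k u)) ` verts G \<subseteq> D'" using k(1) by (auto simp: D'_def)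
    next
      fix u v assume uv: "u \<in> verts G" "v \<in> verts G" "(g (k u), g (k v)) \<in> conn ?E'"
      then have "(k u, k v) \<in> conn ?E" using E' k(1) by blast
      then show "u = v" by (rule k(2)[OF uv(1,2)])
    next
      fix u v assume e: "{u, v} \<in> edges G"
      obtain a where a: "a \<in> D" "(k u, a) \<in> conn ?E" "(k v, s0 a) \<in> conn ?E" using k(3)[OF e] by blast
      have "k u \<in> D" "k v \<in> D" using k(1) simple_graph_edge[OF simple e] by auto
      then have "(g (k u), g a) \<in> conn ?E'" "(g (k v), t s0 (g a)) \<in> conn ?E'"
        using a E' matchingD(1)[OF f(2) a(1)] by (simp_all add: tg)
      then show "\<exists>a\<in>D'. (g (k u), a) \<in> conn ?E' \<and> (g (k v), t s0 a) \<in> conn ?E'"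
        using a(1) by (auto simp: D'_def)
    qed
  qed
  ultimately show ?thesis using that[of D' "t s0" "t s1" "t s2"] by (simp add: defect_def)
qed

text \<open>Nonnegativity turns the integer genus into one of the natural numbers over which
  \<open>euler_genus\<close> minimises.\<close>

lemma defect_multiple:
  assumes "flag_map D s0 s1 s2"
  obtains k where "defect D s0 s1 s2 = 4 * int k"
proof -
  define z where "z = 2 * int (components D s0 s1 s2) - int (orbs D s1 s2) - int (orbs D s1 s0) + int (ncomp D (gr D s0 \<union> gr D s2))"
  have z: "defect D s0 s1 s2 = 4 * z"
    unfolding defect_def card_flags[OF assms, symmetric] z_def by simp
  then have "z \<ge> 0" using defect_nonneg[OF assms] by simp
  then have "defect D s0 s1 s2 = 4 * int (nat z)" using z by simp
  then show ?thesis by (rule that)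
qed

text \<open>The second claim supplies the witness that gives meaning to the \<open>LEAST\<close> in
  \<open>euler_genus\<close>.\<close>

lemma euler_genus_le:
  fixes D :: "'f set"
  assumes fm: "flag_map D s0 s1 s2" and c: "components D s0 s1 s2 = 1" and dr: "drawn G D s0 s1 s2" and s: "simple_graph G"
  shows "4 * int (euler_genus G) \<le> defect D s0 s1 s2"
    and "\<exists>k. \<exists>S. closed_surface S \<and> embeds_in G S \<and> surface_euler_genus S = int k"
proof -
  obtain D' :: "nat set" and t0 t1 t2 where t: "flag_map D' t0 t1 t2" "drawn G D' t0 t1 t2"
    "defect D' t0 t1 t2 = defect D s0 s1 s2" "components D' t0 t1 t2 = components D s0 s1 s2"
    using transfer_to_nat[OF fm dr s] by metis
  define S where "S = \<lparr>flags = D', opp = t0, turn = t1, glue = t2\<rparr>"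
  have S: "closed_surface S" using t(1,4) c by (simp add: closed_surface_iff S_def)
  have em: "embeds_in G S" using embeds_in_iff[OF S s] t(2) by (simp add: S_def)
  obtain k where k: "defect D s0 s1 s2 = 4 * int k" using defect_multiple[OF fm] by blast
  then have g: "surface_euler_genus S = int k" using defect_surface[OF S] t(3) by (simp add: S_def)
  then show "\<exists>k. \<exists>S. closed_surface S \<and> embeds_in G S \<and> surface_euler_genus S = int k" using S em by blast
  have "euler_genus G \<le> k" unfolding euler_genus_def by (rule Least_le) (use S em g in blast)
  then show "4 * int (euler_genus G) \<le> defect D s0 s1 s2" using k by simp
qed

text \<open>The complete graph on \<open>V\<close>, with flags \<open>(u, v, side)\<close>: starting from any corners that respect
  the vertices, merge all orbits belonging to the same vertex.\<close>

lemma complete_graph_drawn: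
  fixes V :: "'a set"
  assumes fin: "finite V" and x: "x \<in> V" and y: "y \<in> V" and xy: "x \<noteq> y"
  obtains D :: "('a \<times> 'a \<times> bool) set" and s0 s1 s2 where "flag_map D s0 s1 s2" "components D s0 s1 s2 = 1"
    "\<And>G. simple_graph G \<Longrightarrow> verts G = V \<Longrightarrow> drawn G D s0 s1 s2"
proof -
  define D where "D = {(u, v, b :: bool). u \<in> V \<and> v \<in> V \<and> u \<noteq> v}"
  define s0 where "s0 = (\<lambda>(u :: 'a, v :: 'a, b :: bool). (v, u, b))"
  define s2 where "s2 = (\<lambda>(u :: 'a, v :: 'a, b). (u, v, \<not> b))"
  have finD: "finite D" by (rule finite_subset[of _ "V \<times> V \<times> UNIV"]) (auto simp: D_def fin)
  have f0: "matching D s0" and f2: "matching D s2" by (auto simp: matching_def D_def s0_def s2_def)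
  have k: "\<And>d. d \<in> D \<Longrightarrow> fst (s2 d) = fst d" by (auto simp: s2_def)
  obtain s1 where s1: "matching D s1" "\<forall>a\<in>D. \<forall>b\<in>D. (a, b) \<in> conn (gr D s1 \<union> gr D s2) \<longleftrightarrow> fst a = fst b"
    using merge_orbits[OF finD f0 f2, of fst s2] k f2 by blast
  have fm: "flag_map D s0 s1 s2"
    unfolding flag_map_def by (intro conjI finD f0 f2 s1(1)) (auto simp: D_def s0_def s2_def)
  have V: "(p, q) \<in> conn (gr D s1 \<union> (gr D s2 \<union> gr D s0))" if "p \<in> D" "q \<in> D" "fst p = fst q" for p q
  proof -
    have "(p, q) \<in> conn (gr D s1 \<union> gr D s2)" using s1(2) that by blast
    then show ?thesis by (rule conn_mono) auto
  qed
  have "components D s0 s1 s2 = 1"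
    unfolding components_def
  proof (rule ncomp_1[OF finD])
    show o: "(x, y, True) \<in> D" using assms by (simp add: D_def)
    fix d assume d: "d \<in> D"
    then obtain u v b where uvb: "d = (u, v, b)" "u \<in> V" "v \<in> V" "u \<noteq> v" by (auto simp: D_def)
    show "((x, y, True), d) \<in> conn (gr D s1 \<union> (gr D s2 \<union> gr D s0))"
    proof (cases "u = x")
      case True then show ?thesis using V[OF o d] uvb by simp
    next
      case False
      have e: "(x, u, True) \<in> D" "(u, x, True) \<in> D" using False uvb assms by (auto simp: D_def)
      have "((x, y, True), (x, u, True)) \<in> conn (gr D s1 \<union> (gr D s2 \<union> gr D s0))" using V[OF o e(1)] by simp
      also have "((x, u, True), (u, x, True)) \<in> conn (gr D s1 \<union> (gr D s2 \<union> gr D s0))"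
        by (rule conn_base) (use e in \<open>simp add: s0_def\<close>)
      also have "((u, x, True), d) \<in> conn (gr D s1 \<union> (gr D s2 \<union> gr D s0))" using V[OF e(2) d] uvb by simp
      finally show ?thesis .
    qed
  qed
  moreover have "drawn G D s0 s1 s2" if G: "simple_graph G" "verts G = V" for G
  proof -
    have "\<exists>w\<in>V. w \<noteq> u" if "u \<in> V" for u using x y xy by metis
    then obtain w where w: "\<And>u. u \<in> V \<Longrightarrow> w u \<in> V \<and> w u \<noteq> u" by metis
    have wD: "(u, w u, True) \<in> D" if "u \<in> V" for u using w[OF that] that by (auto simp: D_def)
    show ?thesis
      unfolding drawn_def
    proof (intro exI[of _ "\<lambda>u. (u, w u, True)"] conjI ballI allI impI)
      show "(\<lambda>u. (u, w u, True)) ` verts G \<subseteq> D" using wD G(2) by auto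
    next
      fix u v assume "u \<in> verts G" "v \<in> verts G" "((u, w u, True), (v, w v, True)) \<in> conn (gr D s1 \<union> gr D s2)"
      then show "u = v" using s1(2) wD G(2) by fastforce
    next
      fix u v assume "{u, v} \<in> edges G"
      then have uv: "u \<in> V" "v \<in> V" "u \<noteq> v" using simple_graph_edge[OF G(1)] G(2) by auto
      then have e: "(u, v, True) \<in> D" "(v, u, True) \<in> D" by (auto simp: D_def)
      have "((u, w u, True), (u, v, True)) \<in> conn (gr D s1 \<union> gr D s2)" using s1(2) wD[OF uv(1)] e(1) by simp
      moreover have "((v, w v, True), s0 (u, v, True)) \<in> conn (gr D s1 \<union> gr D s2)"
        using s1(2) wD[OF uv(2)] e(2) by (simp add: s0_def)
      ultimately show "\<exists>a\<in>D. ((u, w u, True), a) \<in> conn (gr D s1 \<union> gr D s2) \<and>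
          ((v, w v, True), s0 a) \<in> conn (gr D s1 \<union> gr D s2)" using e(1) by blast
    qed
  qed
  ultimately show ?thesis using that fm by blast
qed

text \<open>A drawing of the complete graph on the same vertices shows that the minimum is over a
  nonempty set. The two distinct vertices provide that drawing with a flag.\<close>

lemma euler_genus_attained:
  assumes s: "simple_graph G" and x: "x \<in> verts G" and y: "y \<in> verts G" and xy: "x \<noteq> y"
  obtains D :: "nat set" and s0 s1 s2 where "flag_map D s0 s1 s2" "components D s0 s1 s2 = 1"
    "drawn G D s0 s1 s2" "defect D s0 s1 s2 = 4 * int (euler_genus G)"
proof -
  have "finite (verts G)" using s by (simp add: simple_graph_def)
  from complete_graph_drawn[OF this x y xy]
  obtain D :: "('a \<times> 'a \<times> bool) set" and s0 s1 s2 where D: "flag_map D s0 s1 s2" "components D s0 s1 s2 = 1"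
    "drawn G D s0 s1 s2" using s by metis
  have "\<exists>S. closed_surface S \<and> embeds_in G S \<and> surface_euler_genus S = int (euler_genus G)"
    unfolding euler_genus_def by (rule LeastI_ex[OF euler_genus_le(2)[OF D s]])
  then obtain S where S: "closed_surface S" "embeds_in G S" "surface_euler_genus S = int (euler_genus G)" by blast
  show ?thesis
    by (rule that[of "flags S" "opp S" "turn S" "glue S"])
      (use S embeds_in_iff[OF S(1) s] defect_surface[OF S(1)] in \<open>auto simp: closed_surface_iff\<close>)
qed

section \<open>Additivity over an edge\<close>

text \<open>Intended for the three graphs of an \<open>xy\<close>-sum after the edge
  \<open>xy\<close> has been added to each.\<close>

locale edge_amalgam =
  fixes G G1 G2 :: "'a graph" and x y :: 'a
  assumes simple: "simple_graph G1" "simple_graph G2"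
    and xy: "x \<noteq> y" "{x, y} \<in> edges G1" "{x, y} \<in> edges G2"
    and meet: "verts G1 \<inter> verts G2 = {x, y}"
    and G: "verts G = verts G1 \<union> verts G2" "edges G = edges G1 \<union> edges G2"
begin

lemma simple_G: "simple_graph G"
  unfolding simple_graph_def
proof (intro conjI ballI)
  show "finite (verts G)" using simple by (simp add: simple_graph_def G)
  fix e assume "e \<in> edges G"
  then consider "e \<in> edges G1" | "e \<in> edges G2" unfolding G by blast
  then obtain u v where "e = {u, v}" "u \<noteq> v" "u \<in> verts G" "v \<in> verts G"
    using simple unfolding simple_graph_def G by cases (meson UnI1 UnI2)+
  then show "\<exists>u v. e = {u, v} \<and> u \<noteq> v \<and> u \<in> verts G \<and> v \<in> verts G" by blast
qed

lemma xy_verts: "x \<in> verts G1" "y \<in> verts G1" "x \<in> verts G2" "y \<in> verts G2"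
  using meet by auto

lemma euler_genus_amalgam_le: "euler_genus G \<le> euler_genus G1 + euler_genus G2"
proof -
  obtain A :: "nat set" and s0 s1 s2 where A: "flag_map A s0 s1 s2" "components A s0 s1 s2 = 1"
    "drawn G1 A s0 s1 s2" "defect A s0 s1 s2 = 4 * int (euler_genus G1)"
    using euler_genus_attained[OF simple(1) xy_verts(1,2) xy(1)] by metis
  obtain B :: "nat set" and t0 t1 t2 where B: "flag_map B t0 t1 t2" "components B t0 t1 t2 = 1"
    "drawn G2 B t0 t1 t2" "defect B t0 t1 t2 = 4 * int (euler_genus G2)"
    using euler_genus_attained[OF simple(2) xy_verts(3,4) xy(1)] by metis
  let ?A = "gr A s1 \<union> gr A s2" and ?B = "gr B t1 \<union> gr B t2"
  obtain f1 where f1: "f1 ` verts G1 \<subseteq> A"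
    "\<And>u v. u \<in> verts G1 \<Longrightarrow> v \<in> verts G1 \<Longrightarrow> (f1 u, f1 v) \<in> conn ?A \<Longrightarrow> u = v"
    "\<And>u v. {u, v} \<in> edges G1 \<Longrightarrow> \<exists>a\<in>A. (f1 u, a) \<in> conn ?A \<and> (f1 v, s0 a) \<in> conn ?A"
    using A(3) unfolding drawn_def by blast
  obtain f2 where f2: "f2 ` verts G2 \<subseteq> B"
    "\<And>u v. u \<in> verts G2 \<Longrightarrow> v \<in> verts G2 \<Longrightarrow> (f2 u, f2 v) \<in> conn ?B \<Longrightarrow> u = v"
    "\<And>u v. {u, v} \<in> edges G2 \<Longrightarrow> \<exists>a\<in>B. (f2 u, a) \<in> conn ?B \<and> (f2 v, t0 a) \<in> conn ?B"
    using B(3) unfolding drawn_def by blast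
  obtain a where a: "a \<in> A" "(f1 x, a) \<in> conn ?A" "(f1 y, s0 a) \<in> conn ?A" using f1(3)[OF xy(2)] by blast
  obtain b where b: "b \<in> B" "(f2 x, b) \<in> conn ?B" "(f2 y, t0 b) \<in> conn ?B" using f2(3)[OF xy(3)] by blast
  have l1: "{v \<in> verts G1. (f1 v, d) \<in> conn ?A} = {u}" if "u \<in> verts G1" "(f1 u, d) \<in> conn ?A" for u d
    using that f1(2)[of _ u] conn_trans[of "f1 _" d ?A "f1 u"] conn_sym[OF that(2)] by blast
  have l2: "{v \<in> verts G2. (f2 v, d) \<in> conn ?B} = {u}" if "u \<in> verts G2" "(f2 u, d) \<in> conn ?B" for u d
    using that f2(2)[of _ u] conn_trans[of "f2 _" d ?B "f2 u"] conn_sym[OF that(2)] by blast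
  have na: "(a, s0 a) \<notin> conn ?A"
    using l1[OF xy_verts(1), of "s0 a"] l1[OF xy_verts(2) a(3)] conn_trans[OF a(2)] xy(1) by blast
  have nb: "(b, t0 b) \<notin> conn ?B"
    using l2[OF xy_verts(3), of "t0 b"] l2[OF xy_verts(4) b(3)] conn_trans[OF b(2)] xy(1) by blast
  define D where "D = A <+> B"
  define u0 where "u0 = map_sum s0 t0"
  define u1 where "u1 = map_sum s1 t1"
  define u2 where "u2 = glue_sides s0 s2 t0 t2 a b"
  note glue = glue_along_edge[OF A(1) B(1) a(1) b(1) na nb, folded D_def u0_def u1_def u2_def]
  let ?C = "conn (gr D u1 \<union> gr D u2)"
  have CA: "(Inl p, Inl q) \<in> ?C" if "(p, q) \<in> conn ?A" for p q
  proof -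
    have "(Inl p, Inl q) \<in> conn (gr D u1 \<union> gr D (map_sum s2 t2))"
      unfolding D_def u1_def conn_Inl_iff by (rule that)
    then show ?thesis unfolding glue(4) conn_insert by blast
  qed
  have CB: "(Inr p, Inr q) \<in> ?C" if "(p, q) \<in> conn ?B" for p q
  proof -
    have "(Inr p, Inr q) \<in> conn (gr D u1 \<union> gr D (map_sum s2 t2))"
      unfolding D_def u1_def conn_Inr_iff by (rule that)
    then show ?thesis unfolding glue(4) conn_insert by blast
  qed
  have Cx: "(Inl a, Inr b) \<in> ?C" "(Inl (s0 a), Inr (t0 b)) \<in> ?C"
    unfolding glue(4) by (auto intro: conn_base)
  \<comment> \<open>The shared vertices \<open>x\<close> and \<open>y\<close> take their flags from
    the first drawing.\<close>
  define f where "f v = (if v \<in> verts G1 then Inl (f1 v) else Inr (f2 v))" for v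
  have fl: "(f v, Inl d) \<in> ?C" if "v \<in> verts G1" "(f1 v, d) \<in> conn ?A" for v d
    using that CA by (simp add: f_def)
  have fr: "(f v, Inr d) \<in> ?C" if v: "v \<in> verts G2" "(f2 v, d) \<in> conn ?B" for v d
  proof (cases "v \<in> verts G1")
    case True
    then have "v = x \<or> v = y" using v meet by blast
    then have "(f v, Inr (f2 v)) \<in> ?C"
    proof
      assume "v = x"
      then show ?thesis
        using conn_trans[OF CA[OF a(2)] conn_trans[OF Cx(1) CB[OF conn_sym[OF b(2)]]]] True by (simp add: f_def)
    next
      assume "v = y"
      then show ?thesis
        using conn_trans[OF CA[OF a(3)] conn_trans[OF Cx(2) CB[OF conn_sym[OF b(3)]]]] True by (simp add: f_def)
    qed
    then show ?thesis using CB[OF v(2)] conn_trans by metis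
  next
    case False then show ?thesis using CB[OF v(2)] by (simp add: f_def)
  qed
  \<comment> \<open>The set of graph vertices drawn at the orbit of a flag. The orbits that are
    glued together both carry \<open>{x}\<close> or both carry \<open>{y}\<close>, so this is an
    invariant of the new orbits, and it separates the vertices of \<open>G\<close>.\<close>
  define key where "key = case_sum (\<lambda>d. {v \<in> verts G1. (f1 v, d) \<in> conn ?A}) (\<lambda>d. {v \<in> verts G2. (f2 v, d) \<in> conn ?B})"
  have keyC: "key p = key q" if "(p, q) \<in> ?C" for p q
    using that unfolding glue(4)
  proof (rule conn_key)
    fix p q assume "(p, q) \<in> insert (Inl (s0 a), Inr (t0 b)) (insert (Inl a, Inr b) (gr D u1 \<union> gr D (map_sum s2 t2)))"
    then consider "p = Inl (s0 a)" "q = Inr (t0 b)" | "p = Inl a" "q = Inr b"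
      | d e where "p = Inl d" "q = Inl e" "(d, e) \<in> ?A" | d e where "p = Inr d" "q = Inr e" "(d, e) \<in> ?B"
      by (auto simp: D_def u1_def)
    then show "key p = key q"
    proof cases
      case 1 then show ?thesis using l1[OF xy_verts(2) a(3)] l2[OF xy_verts(4) b(3)] by (simp add: key_def)
    next
      case 2 then show ?thesis using l1[OF xy_verts(1) a(2)] l2[OF xy_verts(3) b(2)] by (simp add: key_def)
    next
      case (3 d e)
      then have "(d, e) \<in> conn ?A" by (intro conn_base)
      then have "(f1 v, d) \<in> conn ?A \<longleftrightarrow> (f1 v, e) \<in> conn ?A" for v using conn_trans conn_sym by metis
      then show ?thesis using 3 by (simp add: key_def)
    next
      case (4 d e)
      then have "(d, e) \<in> conn ?B" by (intro conn_base)
      then have "(f2 v, d) \<in> conn ?B \<longleftrightarrow> (f2 v, e) \<in> conn ?B" for v using conn_trans conn_sym by metis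
      then show ?thesis using 4 by (simp add: key_def)
    qed
  qed
  have keyf: "key (f v) = {v}" if "v \<in> verts G" for v
  proof (cases "v \<in> verts G1")
    case True then show ?thesis using l1[of v "f1 v"] by (simp add: key_def f_def)
  next
    case False then show ?thesis using l2[of v "f2 v"] that G(1) by (simp add: key_def f_def)
  qed
  have "drawn G D u0 u1 u2"
    unfolding drawn_def
  proof (intro exI[of _ f] conjI ballI allI impI)
    show "f ` verts G \<subseteq> D" using f1(1) f2(1) G(1) by (auto simp: f_def D_def)
  next
    fix u v assume "u \<in> verts G" "v \<in> verts G" "(f u, f v) \<in> ?C"
    then show "u = v" using keyC keyf by blast
  next
    fix u v assume "{u, v} \<in> edges G"
    then have "{u, v} \<in> edges G1 \<or> {u, v} \<in> edges G2" using G(2) by auto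
    then show "\<exists>d\<in>D. (f u, d) \<in> ?C \<and> (f v, u0 d) \<in> ?C"
    proof
      assume e: "{u, v} \<in> edges G1"
      obtain d where "d \<in> A" "(f1 u, d) \<in> conn ?A" "(f1 v, s0 d) \<in> conn ?A" using f1(3)[OF e] by blast
      then have "Inl d \<in> D" "(f u, Inl d) \<in> ?C" "(f v, u0 (Inl d)) \<in> ?C"
        using fl simple_graph_edge[OF simple(1) e] by (auto simp: D_def u0_def)
      then show ?thesis by blast
    next
      assume e: "{u, v} \<in> edges G2"
      obtain d where "d \<in> B" "(f2 u, d) \<in> conn ?B" "(f2 v, t0 d) \<in> conn ?B" using f2(3)[OF e] by blast
      then have "Inr d \<in> D" "(f u, Inr d) \<in> ?C" "(f v, u0 (Inr d)) \<in> ?C"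
        using fr simple_graph_edge[OF simple(2) e] by (auto simp: D_def u0_def)
      then show ?thesis by blast
    qed
  qed
  moreover have c1: "components D u0 u1 u2 = 1"
    unfolding components_def
  proof (rule ncomp_1)
    let ?K = "gr D u1 \<union> (gr D u2 \<union> gr D u0)"
    have CK: "(p, q) \<in> conn ?K" if "(p, q) \<in> ?C" for p q using that by (rule conn_mono) auto
    have KA: "(Inl p, Inl q) \<in> conn ?K" if "(p, q) \<in> conn (gr A s1 \<union> (gr A s2 \<union> gr A s0))" for p q
      using that
    proof (rule conn_map)
      fix p q assume "(p, q) \<in> gr A s1 \<union> (gr A s2 \<union> gr A s0)"
      then consider "(p, q) \<in> ?A" | "p \<in> A" "q = s0 p" by auto
      then show "(Inl p, Inl q) \<in> conn ?K"
      proof cases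
        case 1 then show ?thesis by (intro CK CA conn_base)
      next
        case 2 then show ?thesis by (intro conn_base) (auto simp: D_def u0_def)
      qed
    qed
    have KB: "(Inr p, Inr q) \<in> conn ?K" if "(p, q) \<in> conn (gr B t1 \<union> (gr B t2 \<union> gr B t0))" for p q
      using that
    proof (rule conn_map)
      fix p q assume "(p, q) \<in> gr B t1 \<union> (gr B t2 \<union> gr B t0)"
      then consider "(p, q) \<in> ?B" | "p \<in> B" "q = t0 p" by auto
      then show "(Inr p, Inr q) \<in> conn ?K"
      proof cases
        case 1 then show ?thesis by (intro CK CB conn_base)
      next
        case 2 then show ?thesis by (intro conn_base) (auto simp: D_def u0_def)
      qed
    qed
    show "finite D" using flag_mapD(1)[OF glue(1)] .
    show "Inl a \<in> D" using a(1) by (auto simp: D_def)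
    fix d assume "d \<in> D"
    then consider p where "d = Inl p" "p \<in> A" | p where "d = Inr p" "p \<in> B" by (auto simp: D_def)
    then show "(Inl a, d) \<in> conn ?K"
    proof cases
      case (1 p)
      then show ?thesis using KA[OF ncomp_1_conn[OF A(2)[unfolded components_def] a(1)]] by simp
    next
      case (2 p)
      then show ?thesis
        using conn_trans[OF CK[OF Cx(1)] KB[OF ncomp_1_conn[OF B(2)[unfolded components_def] b(1)]]] by simp
    qed
  qed
  ultimately have "4 * int (euler_genus G) \<le> defect D u0 u1 u2"
    using euler_genus_le(1)[OF glue(1) _ _ simple_G] by blast
  \<comment> \<open>Compared with the two maps together, the glued map has two vertices and one
    component fewer; in twice the components minus the vertices these changes cancel.\<close>
  also have "\<dots> = defect A s0 s1 s2 + defect B t0 t1 t2"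
  proof -
    have "card D = card A + card B"
      unfolding D_def using flag_mapD(1)[OF A(1)] flag_mapD(1)[OF B(1)] by (rule card_Plus)
    moreover have "int (orbs D u1 u2) = int (orbs A s1 s2) + int (orbs B t1 t2) - 2" using glue(2) by simp
    ultimately show ?thesis unfolding defect_def c1 A(2) B(2) glue(3) by simp
  qed
  finally show ?thesis using A(4) B(4) by simp
qed

end

section \<open>Lower bound for the genus of an amalgam\<close>

lemma conn_closed_subset:
  assumes "C \<subseteq> D" "\<And>d. d \<in> D \<Longrightarrow> f d \<in> C \<longleftrightarrow> d \<in> C" "\<And>d. d \<in> D \<Longrightarrow> g d \<in> C \<longleftrightarrow> d \<in> C" "a \<in> C"
  shows "(a, b) \<in> conn (gr C f \<union> gr C g) \<longleftrightarrow> (a, b) \<in> conn (gr D f \<union> gr D g)"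
proof
  assume "(a, b) \<in> conn (gr C f \<union> gr C g)"
  then show "(a, b) \<in> conn (gr D f \<union> gr D g)" by (rule conn_mono) (use assms(1) in auto)
next
  assume "(a, b) \<in> conn (gr D f \<union> gr D g)"
  then show "(a, b) \<in> conn (gr C f \<union> gr C g)"
  proof (rule conn_restrict[where C = C])
    show "p \<in> C \<longleftrightarrow> q \<in> C" if "(p, q) \<in> gr D f \<union> gr D g" for p q
      using that assms(2)[of p] assms(3)[of p] by auto
    show "(p, q) \<in> conn (gr C f \<union> gr C g)" if "(p, q) \<in> gr D f \<union> gr D g" "p \<in> C" for p q
      by (rule conn_base) (use that in auto)
  qed (rule assms(4))
qed

lemma orbs_split:
  assumes "finite D" "\<And>d. d \<in> D \<Longrightarrow> P (f d) \<longleftrightarrow> P d" "\<And>d. d \<in> D \<Longrightarrow> P (g d) \<longleftrightarrow> P d"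
    "matching D f" "matching D g"
  shows "orbs D f g = orbs {d \<in> D. P d} f g + orbs {d \<in> D. \<not> P d} f g"
proof -
  let ?E = "gr D f \<union> gr D g" and ?T = "{d \<in> D. P d}" and ?F = "{d \<in> D. \<not> P d}"
  have T: "f d \<in> ?T \<longleftrightarrow> d \<in> ?T" "g d \<in> ?T \<longleftrightarrow> d \<in> ?T" if "d \<in> D" for d
    using that assms(2,3) matchingD(1)[OF assms(4)] matchingD(1)[OF assms(5)] by auto
  have F: "f d \<in> ?F \<longleftrightarrow> d \<in> ?F" "g d \<in> ?F \<longleftrightarrow> d \<in> ?F" if "d \<in> D" for d
    using that assms(2,3) matchingD(1)[OF assms(4)] matchingD(1)[OF assms(5)] by auto
  have D: "?T \<union> ?F = D" by auto
  have "ncomp (?T \<union> ?F) ?E = ncomp ?T ?E + ncomp ?F ?E"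
  proof (rule ncomp_disjoint_union)
    show "(a, b) \<notin> conn ?E" if "a \<in> ?T" "b \<in> ?F" for a b
    proof
      assume "(a, b) \<in> conn ?E"
      then have "P a = P b" by (rule conn_key) (use assms(2,3) in auto)
      then show False using that by simp
    qed
  qed (use assms(1) in auto)
  moreover have "ncomp ?T ?E = orbs ?T f g"
    by (rule ncomp_cong) (use conn_closed_subset[of ?T D f g, OF _ T] assms(1) in auto)
  moreover have "ncomp ?F ?E = orbs ?F f g"
    by (rule ncomp_cong) (use conn_closed_subset[of ?F D f g, OF _ F] assms(1) in auto)
  ultimately show ?thesis unfolding D by simp
qed

text \<open>Every vertex orbit is a vertex of \<open>H\<close>, which fixes the number of vertices,
  and connectedness of \<open>H\<close> makes the map connected. Only the number of faces remains
  free in the defect.\<close>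

lemma euler_genus_le_labelled:
  fixes D :: "'f set"
  assumes fm: "flag_map D s0 s1 s2" and simple: "simple_graph H" and conH: "connected_graph H"
    and lab: "\<And>a b. a \<in> D \<Longrightarrow> b \<in> D \<Longrightarrow> (a, b) \<in> conn (gr D s1 \<union> gr D s2) \<longleftrightarrow> lab a = lab b"
    and labD: "lab ` D = verts H"
    and edge: "\<And>u v. {u, v} \<in> edges H \<Longrightarrow> \<exists>a\<in>D. lab a = u \<and> lab (s0 a) = v"
  shows "4 * int (euler_genus H) \<le> 4 * (2 - int (card (verts H)) - int (orbs D s1 s0)) + int (card D)"
proof -
  note f = flag_mapD[OF fm]
  let ?K = "gr D s1 \<union> (gr D s2 \<union> gr D s0)"
  have K: "(a, b) \<in> conn ?K" if "a \<in> D" "b \<in> D" "lab a = lab b" for a b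
    using lab[OF that(1,2)] that(3) conn_mono[of a b "gr D s1 \<union> gr D s2" ?K] by blast
  have "verts H \<noteq> {}" using conH by (simp add: connected_graph_def)
  then obtain d0 where d0: "d0 \<in> D" using labD by blast
  have c: "components D s0 s1 s2 = 1"
    unfolding components_def
  proof (rule ncomp_1[OF f(1) d0])
    have reach: "\<forall>d\<in>D. lab d = v \<longrightarrow> (d0, d) \<in> conn ?K" if "(lab d0, v) \<in> {(a, b). {a, b} \<in> edges H}\<^sup>*" for v
      using that
    proof (induction rule: rtrancl_induct)
      case base then show ?case using K[OF d0] by auto
    next
      case (step u v)
      then obtain a where a: "a \<in> D" "lab a = u" "lab (s0 a) = v" using edge by blast
      have "(d0, a) \<in> conn ?K" using step(3) a by blast
      also have "(a, s0 a) \<in> conn ?K" by (rule conn_base) (simp add: a(1))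
      finally have 1: "(d0, s0 a) \<in> conn ?K" .
      show ?case
      proof (intro ballI impI)
        fix d assume "d \<in> D" "lab d = v"
        then have "(s0 a, d) \<in> conn ?K" using K[OF matchingD(1)[OF f(2) a(1)]] a(3) by simp
        with 1 show "(d0, d) \<in> conn ?K" by (rule conn_trans)
      qed
    qed
    fix d assume d: "d \<in> D"
    then have "(lab d0, lab d) \<in> {(a, b). {a, b} \<in> edges H}\<^sup>*"
      using conH d0 labD unfolding connected_graph_def by blast
    then show "(d0, d) \<in> conn ?K" using reach d by blast
  qed
  have "\<exists>d\<in>D. lab d = u" if "u \<in> verts H" for u using that labD by (metis imageE)
  then obtain k where k: "\<And>u. u \<in> verts H \<Longrightarrow> k u \<in> D \<and> lab (k u) = u" by metis
  have "drawn H D s0 s1 s2"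
    unfolding drawn_def
  proof (intro exI[of _ k] conjI ballI allI impI)
    show "k ` verts H \<subseteq> D" using k by blast
  next
    fix u v assume "u \<in> verts H" "v \<in> verts H" "(k u, k v) \<in> conn (gr D s1 \<union> gr D s2)"
    then show "u = v" using k lab by metis
  next
    fix u v assume e: "{u, v} \<in> edges H"
    obtain a where a: "a \<in> D" "lab a = u" "lab (s0 a) = v" using edge[OF e] by blast
    then show "\<exists>a\<in>D. (k u, a) \<in> conn (gr D s1 \<union> gr D s2) \<and> (k v, s0 a) \<in> conn (gr D s1 \<union> gr D s2)"
      using lab k simple_graph_edge[OF simple e] matchingD(1)[OF f(2) a(1)] by (intro bexI[of _ a]) auto
  qed
  then have "4 * int (euler_genus H) \<le> defect D s0 s1 s2" by (rule euler_genus_le(1)[OF fm c _ simple])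
  moreover have "orbs D s1 s2 = card (lab ` D)" by (rule ncomp_key[OF f(1)]) (rule lab)
  ultimately show ?thesis by (simp add: defect_def c labD)
qed

lemma simple_graph_edgeE:
  assumes "simple_graph G" "e \<in> edges G"
  obtains u v where "e = {u, v}" "u \<noteq> v" "u \<in> verts G" "v \<in> verts G"
  using assms unfolding simple_graph_def by blast

lemma connected_has_edge:
  assumes "connected_graph H" "v \<in> verts H" "w \<in> verts H" "w \<noteq> v"
  shows "\<exists>u. {v, u} \<in> edges H"
proof -
  have "(v, w) \<in> {(a, b). {a, b} \<in> edges H}\<^sup>*" using assms unfolding connected_graph_def by blast
  then show ?thesis using assms(4) by (cases rule: converse_rtranclE) auto
qed

text \<open>Obtained by deleting all edges outside the graph; as the graph is connected and has an edge,
  none of its vertices is lost.\<close>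

lemma exact_drawing:
  assumes simple: "simple_graph G" and x: "x \<in> verts G" and y: "y \<in> verts G" and xy: "x \<noteq> y"
    and conG: "connected_graph G"
  obtains U :: "nat set" and s0 s1 s2 lab where "flag_map U s0 s1 s2"
    "\<And>p q. p \<in> U \<Longrightarrow> q \<in> U \<Longrightarrow> (p, q) \<in> conn (gr U s1 \<union> gr U s2) \<longleftrightarrow> lab p = lab q"
    "lab ` U = verts G"
    "\<And>d. d \<in> U \<Longrightarrow> {lab d, lab (s0 d)} \<in> edges G"
    "\<And>u v. {u, v} \<in> edges G \<Longrightarrow> \<exists>d\<in>U. lab d = u \<and> lab (s0 d) = v"
    "\<And>p q. p \<in> U \<Longrightarrow> q \<in> U \<Longrightarrow> {lab p, lab (s0 p)} = {lab q, lab (s0 q)} \<Longrightarrow> q \<in> {p, s0 p, s2 p, s0 (s2 p)}"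
    "4 * (2 - int (card (verts G)) - int (orbs U s1 s0)) + int (card U) \<le> 4 * int (euler_genus G)"
proof -
  obtain D :: "nat set" and s0 s1 s2 where D: "flag_map D s0 s1 s2" "drawn G D s0 s1 s2"
    "defect D s0 s1 s2 = 4 * int (euler_genus G)"
    using euler_genus_attained[OF simple x y xy] by metis
  note f = flag_mapD[OF D(1)]
  let ?C = "conn (gr D s1 \<union> gr D s2)"
  obtain k where k: "k ` verts G \<subseteq> D" "\<And>u v. u \<in> verts G \<Longrightarrow> v \<in> verts G \<Longrightarrow> (k u, k v) \<in> ?C \<Longrightarrow> u = v"
    "\<And>u v. {u, v} \<in> edges G \<Longrightarrow> \<exists>a\<in>D. (k u, a) \<in> ?C \<and> (k v, s0 a) \<in> ?C"
    using D(2) unfolding drawn_def by blast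
  \<comment> \<open>Unspecified on orbits that carry no vertex of \<open>G\<close>; no flag of the
    set \<open>U\<close> below lies on such an orbit.\<close>
  define lab where "lab d = (THE v. v \<in> verts G \<and> (k v, d) \<in> ?C)" for d
  have labI: "lab d = v" if "v \<in> verts G" "(k v, d) \<in> ?C" for v d
    unfolding lab_def
  proof (rule the_equality)
    show "u = v" if "u \<in> verts G \<and> (k u, d) \<in> ?C" for u
      using that k(2)[of u v] \<open>v \<in> verts G\<close> conn_trans[of "k u" d _ "k v"] conn_sym[OF \<open>(k v, d) \<in> ?C\<close>] by blast
  qed (use that in blast)
  have "\<exists>a\<in>D. \<exists>u v. e = {u, v} \<and> (k u, a) \<in> ?C \<and> (k v, s0 a) \<in> ?C" if "e \<in> edges G" for e
  proof -
    obtain u v where e: "e = {u, v}" using simple_graph_edgeE[OF simple \<open>e \<in> edges G\<close>] by metis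
    then have "{u, v} \<in> edges G" using \<open>e \<in> edges G\<close> by simp
    from k(3)[OF this] show ?thesis unfolding e by blast
  qed
  then obtain h where h: "\<And>e. e \<in> edges G \<Longrightarrow> h e \<in> D \<and> (\<exists>u v. e = {u, v} \<and> (k u, h e) \<in> ?C \<and> (k v, s0 (h e)) \<in> ?C)"
    by metis
  define quad where "quad a = {a, s0 a, s2 a, s0 (s2 a)}" for a
  have quad: "s0 p \<in> quad a \<and> s2 p \<in> quad a \<and> quad p = quad a" if aD: "a \<in> D" and pq: "p \<in> quad a" for a p
  proof -
    have m: "s0 a \<in> D" "s2 a \<in> D" using matchingD(1)[OF f(2)] matchingD(1)[OF f(4)] aD by auto
    have c: "s0 (s0 a) = a" "s2 (s2 a) = a" "s0 (s0 (s2 a)) = s2 a" "s2 (s0 a) = s0 (s2 a)" "s2 (s0 (s2 a)) = s0 a"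
      using matchingD(3)[OF f(2) aD] matchingD(3)[OF f(4) aD] matchingD(3)[OF f(2) m(2)]
        f(5)[OF aD] matchingD(3)[OF f(4) m(1)] by simp_all
    consider "p = a" | "p = s0 a" | "p = s2 a" | "p = s0 (s2 a)" using pq by (auto simp: quad_def)
    then show ?thesis by cases (auto simp: quad_def c)
  qed
  define U where "U = (\<Union>e\<in>edges G. quad (h e))"
  have U0: "s0 a \<in> U" and U2: "s2 a \<in> U" and UD: "a \<in> D" if "a \<in> U" for a
  proof -
    obtain e where e: "e \<in> edges G" "a \<in> quad (h e)" using \<open>a \<in> U\<close> by (auto simp: U_def)
    then show "s0 a \<in> U" "s2 a \<in> U" using quad[of "h e" a] h[OF e(1)] by (auto simp: U_def)
    show "a \<in> D" using e edge_class(3)[OF D(1), of "h e"] h[OF e(1)] by (auto simp: quad_def)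
  qed
  obtain s where s: "flag_map U s0 s s2" "\<forall>p\<in>U. \<forall>q\<in>U. (p, q) \<in> conn (gr U s \<union> gr U s2) \<longleftrightarrow> (p, q) \<in> ?C"
    "defect U s0 s s2 \<le> defect D s0 s1 s2"
    using restrict_flags[OF D(1), of U] U0 U2 UD by blast
  have he: "{lab p, lab (s0 p)} = e \<and> lab p \<in> verts G \<and> (k (lab p), p) \<in> ?C"
    if e: "e \<in> edges G" and p: "p \<in> quad (h e)" for e p
  proof -
    obtain u v where uv: "e = {u, v}" "(k u, h e) \<in> ?C" "(k v, s0 (h e)) \<in> ?C" "h e \<in> D" using h[OF e] by blast
    have V: "u \<in> verts G" "v \<in> verts G" using simple_graph_edge[OF simple] e uv(1) by blast+
    have m: "s0 (h e) \<in> D" "s2 (h e) \<in> D" using matchingD(1)[OF f(2)] matchingD(1)[OF f(4)] uv(4) by auto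
    have c: "s0 (s0 (h e)) = h e" "s0 (s2 (h e)) = s2 (s0 (h e))" "s0 (s0 (s2 (h e))) = s2 (h e)"
      using matchingD(3)[OF f(2) uv(4)] matchingD(3)[OF f(2) m(2)] f(5)[OF uv(4)] by simp_all
    have "(h e, s2 (h e)) \<in> ?C" by (rule conn_base) (use uv(4) in simp)
    then have u2: "(k u, s2 (h e)) \<in> ?C" using conn_trans[OF uv(2)] by blast
    have "(s0 (h e), s2 (s0 (h e))) \<in> ?C" by (rule conn_base) (use m in simp)
    then have v2: "(k v, s0 (s2 (h e))) \<in> ?C" using conn_trans[OF uv(3)] c(2) by metis
    have L: "lab (h e) = u" "lab (s2 (h e)) = u" "lab (s0 (h e)) = v" "lab (s0 (s2 (h e))) = v"
      using labI[OF V(1) uv(2)] labI[OF V(1) u2] labI[OF V(2) uv(3)] labI[OF V(2) v2] by simp_all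
    consider "p = h e" | "p = s0 (h e)" | "p = s2 (h e)" | "p = s0 (s2 (h e))" using p by (auto simp: quad_def)
    then show ?thesis
      using c(1,3) L uv V u2 v2 by cases (simp_all add: insert_commute)
  qed
  have lam: "{lab d, lab (s0 d)} \<in> edges G \<and> d \<in> quad (h {lab d, lab (s0 d)}) \<and> lab d \<in> verts G \<and> (k (lab d), d) \<in> ?C"
    if d: "d \<in> U" for d
  proof -
    obtain e where e: "e \<in> edges G" "d \<in> quad (h e)" using d by (auto simp: U_def)
    show ?thesis using he[OF e] e by simp
  qed
  have C_iff: "(p, q) \<in> conn (gr U s \<union> gr U s2) \<longleftrightarrow> lab p = lab q" if pq: "p \<in> U" "q \<in> U" for p q
  proof -
    note lp = lam[OF pq(1)] and lq = lam[OF pq(2)]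
    have "(p, q) \<in> ?C \<longleftrightarrow> lab p = lab q"
    proof
      assume "(p, q) \<in> ?C"
      then have "(k (lab p), q) \<in> ?C" using lp conn_trans by metis
      then show "lab p = lab q" using labI[of "lab p" q] lp by simp
    next
      assume "lab p = lab q"
      then have "(k (lab p), q) \<in> ?C" "(p, k (lab p)) \<in> ?C" using lp lq conn_sym by metis+
      then show "(p, q) \<in> ?C" using conn_trans by metis
    qed
    then show ?thesis using s(2) pq by simp
  qed
  have E: "\<exists>d\<in>U. lab d = u \<and> lab (s0 d) = v" if e: "{u, v} \<in> edges G" for u v
  proof -
    let ?d = "h {u, v}"
    have dq: "?d \<in> quad ?d" "s0 ?d \<in> quad ?d" by (auto simp: quad_def)
    then have dU: "?d \<in> U" "s0 ?d \<in> U" using e by (auto simp: U_def)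
    have s00: "s0 (s0 ?d) = ?d" using matchingD(3)[OF f(2)] UD[OF dU(1)] by blast
    have "{lab ?d, lab (s0 ?d)} = {u, v}" using he[OF e dq(1)] by simp
    then have "lab ?d = u \<and> lab (s0 ?d) = v \<or> lab (s0 ?d) = u \<and> lab ?d = v" by (auto simp: doubleton_eq_iff)
    then show ?thesis
    proof
      assume "lab ?d = u \<and> lab (s0 ?d) = v"
      then show ?thesis by (intro bexI[of _ ?d] dU)
    next
      assume "lab (s0 ?d) = u \<and> lab ?d = v"
      then show ?thesis by (intro bexI[of _ "s0 ?d"] dU) (simp add: s00)
    qed
  qed
  have labU: "lab ` U = verts G"
  proof (intro equalityI subsetI)
    fix v assume v: "v \<in> verts G"
    obtain w where "w \<in> verts G" "w \<noteq> v" using x y xy by metis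
    then obtain u where "{v, u} \<in> edges G" using connected_has_edge[OF conG v] by blast
    then show "v \<in> lab ` U" using E by blast
  qed (use lam in auto)
  show ?thesis
  proof (rule that[OF s(1) C_iff labU _ E])
    show "{lab d, lab (s0 d)} \<in> edges G" if "d \<in> U" for d using lam[OF that] by blast
    show "q \<in> {p, s0 p, s2 p, s0 (s2 p)}" if pq: "p \<in> U" "q \<in> U" "{lab p, lab (s0 p)} = {lab q, lab (s0 q)}" for p q
    proof -
      let ?e = "{lab p, lab (s0 p)}"
      have "p \<in> quad (h ?e)" "q \<in> quad (h ?e)" using lam[OF pq(1)] lam[OF pq(2)] pq(3) by simp_all
      moreover have "h ?e \<in> D" using h lam[OF pq(1)] by blast
      ultimately show ?thesis using quad by (metis quad_def)
    qed
    have "orbs U s s2 = card (lab ` U)" by (rule ncomp_key[OF flag_mapD(1)[OF s(1)]]) (rule C_iff)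
    \<comment> \<open>The bound to be shown has 2 in place of twice the number of components, so it
      is enough that \<open>U\<close> is nonempty.\<close>
    moreover have "components U s0 s s2 \<ge> 1"
    proof -
      have "finite U" using flag_mapD(1)[OF s(1)] .
      moreover have "U \<noteq> {}" using labU x by auto
      ultimately have "(\<lambda>a. conn (gr U s \<union> (gr U s2 \<union> gr U s0)) `` {a}) ` U \<noteq> {}" "finite ((\<lambda>a. conn (gr U s \<union> (gr U s2 \<union> gr U s0)) `` {a}) ` U)" by auto
      then show ?thesis unfolding components_def ncomp_image by (metis One_nat_def Suc_leI card_gt_0_iff)
    qed
    ultimately show "4 * (2 - int (card (verts G)) - int (orbs U s s0)) + int (card U) \<le> 4 * int (euler_genus G)"
      using s(3)[unfolded D(3)] unfolding defect_def labU by simp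
  qed auto
qed

text \<open>In a flag of the sphere, the first bit is the end of its edge and the second the side.
  Both ends have degree one, so \<open>bar2\<close> serves as corner matching and as side
  gluing.\<close>

definition bar0 :: "bool \<times> bool \<Rightarrow> bool \<times> bool" where
  "bar0 = (\<lambda>(p, q). (\<not> p, q))"

definition bar2 :: "bool \<times> bool \<Rightarrow> bool \<times> bool" where
  "bar2 = (\<lambda>(p, q). (p, \<not> q))"

text \<open>The sphere with a single edge; gluing it in doubles an edge.\<close>

lemma single_edge_sphere:
  "flag_map UNIV bar0 bar2 bar2" "orbs UNIV bar2 bar2 = 2" "orbs UNIV bar2 bar0 = 1"
  "((True, True), bar0 (True, True)) \<notin> conn (gr UNIV bar2 \<union> gr UNIV bar2)"
proof -
  show "flag_map UNIV bar0 bar2 bar2" by (auto simp: flag_map_def matching_def bar0_def bar2_def)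
  have k: "fst p = fst q" if "(p, q) \<in> conn (gr UNIV bar2 \<union> gr UNIV bar2)" for p q
    using that by (rule conn_key) (auto simp: bar2_def)
  show "((True, True), bar0 (True, True)) \<notin> conn (gr UNIV bar2 \<union> gr UNIV bar2)"
    using k by (fastforce simp: bar0_def)
  have b2: "(p, bar2 p) \<in> conn (gr UNIV bar2 \<union> E)" for p E by (rule conn_base) simp
  have "orbs UNIV bar2 bar2 = card (fst ` (UNIV :: (bool \<times> bool) set))"
  proof (rule ncomp_key)
    fix p q :: "bool \<times> bool"
    show "(p, q) \<in> conn (gr UNIV bar2 \<union> gr UNIV bar2) \<longleftrightarrow> fst p = fst q"
    proof
      assume "fst p = fst q"
      then have "q = p \<or> q = bar2 p" by (cases p; cases q) (auto simp: bar2_def)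
      then show "(p, q) \<in> conn (gr UNIV bar2 \<union> gr UNIV bar2)"
        by (elim disjE) (simp_all only: conn_refl b2)
    qed (rule k)
  qed simp
  then show "orbs UNIV bar2 bar2 = 2" by simp
  show "orbs UNIV bar2 bar0 = 1"
  proof (rule ncomp_1)
    let ?E = "gr UNIV bar2 \<union> gr UNIV bar0"
    fix q :: "bool \<times> bool"
    have b0: "(p, bar0 p) \<in> conn ?E" for p by (rule conn_base) simp
    let ?o = "(True, True)"
    have "q = ?o \<or> q = bar2 ?o \<or> q = bar0 ?o \<or> q = bar0 (bar2 ?o)"
      by (cases q) (auto simp: bar0_def bar2_def)
    moreover have "(?o, bar0 (bar2 ?o)) \<in> conn ?E" using b2 b0 conn_trans by metis
    ultimately show "(?o, q) \<in> conn ?E" using b2 b0 by auto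
  qed auto
qed

context edge_amalgam
begin

lemma euler_genus_amalgam_ge:
  assumes con: "connected_graph G1" "connected_graph G2" and conG: "connected_graph G"
  shows "euler_genus G1 + euler_genus G2 \<le> euler_genus G"
proof -
  have xyG: "x \<in> verts G" "y \<in> verts G" "{x, y} \<in> edges G" using xy_verts xy G by auto
  obtain U :: "nat set" and s0 s1 s2 lab where U: "flag_map U s0 s1 s2"
    "\<And>p q. p \<in> U \<Longrightarrow> q \<in> U \<Longrightarrow> (p, q) \<in> conn (gr U s1 \<union> gr U s2) \<longleftrightarrow> lab p = lab q"
    "lab ` U = verts G"
    "\<And>d. d \<in> U \<Longrightarrow> {lab d, lab (s0 d)} \<in> edges G"
    "\<And>u v. {u, v} \<in> edges G \<Longrightarrow> \<exists>d\<in>U. lab d = u \<and> lab (s0 d) = v"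
    "\<And>p q. p \<in> U \<Longrightarrow> q \<in> U \<Longrightarrow> {lab p, lab (s0 p)} = {lab q, lab (s0 q)} \<Longrightarrow> q \<in> {p, s0 p, s2 p, s0 (s2 p)}"
    "4 * (2 - int (card (verts G)) - int (orbs U s1 s0)) + int (card U) \<le> 4 * int (euler_genus G)"
    using exact_drawing[OF simple_G xyG(1,2) xy(1) conG] by blast
  note fU = flag_mapD[OF U(1)]
  obtain a where a: "a \<in> U" "lab a = x" "lab (s0 a) = y" using U(5)[OF xyG(3)] by blast
  let ?S = "UNIV :: (bool \<times> bool) set" and ?b = "(True, True)"
  have na: "(a, s0 a) \<notin> conn (gr U s1 \<union> gr U s2)"
    using U(2)[OF a(1) matchingD(1)[OF fU(2) a(1)]] a xy(1) by simp
  define D where "D = U <+> ?S"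
  define u0 where "u0 = map_sum s0 bar0"
  define u1 where "u1 = map_sum s1 bar2"
  define u2 where "u2 = glue_sides s0 s2 bar0 bar2 a ?b"
  note glue = glue_along_edge[OF U(1) single_edge_sphere(1) a(1) UNIV_I na single_edge_sphere(4),
    folded D_def u0_def u1_def u2_def]
  note fD = flag_mapD[OF glue(1)]
  have inU: "s0 d \<in> U" "s1 d \<in> U" "s2 d \<in> U" "s0 (s0 d) = d" "s0 (s2 d) = s2 (s0 d)" if "d \<in> U" for d
    using matchingD[OF fU(2) that] matchingD[OF fU(3) that] matchingD[OF fU(4) that] fU(5)[OF that] by auto
  have l12: "lab (s1 d) = lab d" "lab (s2 d) = lab d" if d: "d \<in> U" for d
    using U(2)[OF d inU(2)[OF d]] U(2)[OF d inU(3)[OF d]] conn_base[of d "s1 d" "gr U s1 \<union> gr U s2"]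
      conn_base[of d "s2 d" "gr U s1 \<union> gr U s2"] d by auto
  define ed where "ed d = {lab d, lab (s0 d)}" for d
  have ed0: "ed (s0 d) = ed d" and ed2: "ed (s2 d) = ed d" if d: "d \<in> U" for d
    using inU[OF d] l12(2)[OF d] l12(2)[OF inU(1)[OF d]] by (auto simp: ed_def)
  have eda: "ed d = {x, y} \<longleftrightarrow> d \<in> {a, s0 a, s2 a, s0 (s2 a)}" if d: "d \<in> U" for d
  proof
    assume "ed d = {x, y}"
    then show "d \<in> {a, s0 a, s2 a, s0 (s2 a)}" using U(6)[OF a(1) d] a by (simp add: ed_def)
  next
    have e: "ed a = {x, y}" using a by (simp add: ed_def)
    assume "d \<in> {a, s0 a, s2 a, s0 (s2 a)}"
    then show "ed d = {x, y}" using e ed0 ed2 a(1) inU[OF a(1)] by auto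
  qed
  define lab' where "lab' = case_sum lab (\<lambda>(p, q :: bool). if p then x else y)"
  \<comment> \<open>Gluing in the sphere turns \<open>xy\<close> into two parallel edges:
    \<open>a\<close> and \<open>s0 a\<close> are joined to the sphere flags of side
    \<open>True\<close>, the other two flags of the old edge to those of side \<open>False\<close>.
    Each colour thus owns one copy of \<open>xy\<close>.\<close>
  define col where "col = case_sum (\<lambda>d. if ed d = {x, y} then d \<in> {a, s0 a} else ed d \<in> edges G1) (snd :: bool \<times> bool \<Rightarrow> bool)"
  have lab_u1: "lab' (u1 d) = lab' d" if "d \<in> D" for d
    using that l12(1) by (auto simp: D_def u1_def lab'_def bar2_def)
  have lab_conn: "lab' p = lab' q" if "(p, q) \<in> conn (gr D u1 \<union> gr D u2)" for p q
    using that unfolding glue(4)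
  proof (rule conn_key)
    fix p q assume "(p, q) \<in> insert (Inl (s0 a), Inr (bar0 ?b)) (insert (Inl a, Inr ?b) (gr D u1 \<union> gr D (map_sum s2 bar2)))"
    then consider "p = Inl (s0 a)" "q = Inr (bar0 ?b)" | "p = Inl a" "q = Inr ?b"
      | "p \<in> D" "q = u1 p" | "p \<in> D" "q = map_sum s2 bar2 p" by auto
    then show "lab' p = lab' q"
    proof cases
      case 3 then show ?thesis using lab_u1 by simp
    next
      case 4 then show ?thesis using l12(2) by (auto simp: D_def lab'_def bar2_def)
    qed (use a in \<open>auto simp: lab'_def bar0_def\<close>)
  qed
  have lab_u2: "lab' (u2 d) = lab' d" if "d \<in> D" for d
  proof -
    have "(d, u2 d) \<in> conn (gr D u1 \<union> gr D u2)" by (rule conn_base) (simp add: that)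
    then show ?thesis using lab_conn by simp
  qed
  have col_u0: "col (u0 d) = col d" if dD: "d \<in> D" for d
  proof -
    consider p where "d = Inl p" "p \<in> U" | p where "d = Inr p" using dD by (auto simp: D_def)
    then show ?thesis
    proof cases
      case (1 p)
      have "s0 p = s0 a \<longleftrightarrow> p = a" by (rule matching_inj[OF fU(2) 1(2) a(1)])
      moreover have "s0 p = a \<longleftrightarrow> p = s0 a" using inU(4)[OF 1(2)] inU(4)[OF a(1)] by metis
      ultimately have "s0 p \<in> {a, s0 a} \<longleftrightarrow> p \<in> {a, s0 a}" by blast
      then show ?thesis using 1 ed0[OF 1(2)] by (simp add: u0_def col_def)
    next
      case (2 p) then show ?thesis by (cases p) (simp add: u0_def col_def bar0_def)
    qed
  qed
  have ne: "s2 a \<notin> {a, s0 a}" "s0 (s2 a) \<notin> {a, s0 a}"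
    using matchingD(2)[OF fU(4) a(1)] fU(6)[OF a(1)] fU(6)[OF inU(1)[OF a(1)]] matchingD(2)[OF fU(4) inU(1)[OF a(1)]]
      inU[OF a(1)] by auto
  have edq: "ed a = {x, y}" "ed (s0 a) = {x, y}" "ed (s2 a) = {x, y}" "ed (s0 (s2 a)) = {x, y}"
    using eda a(1) inU[OF a(1)] inU[OF inU(3)[OF a(1)]] by auto
  have col_u2: "col (u2 d) = col d" if dD: "d \<in> D" for d
  proof -
    consider p where "d = Inl p" "p \<in> U" "p \<notin> {a, s2 a, s0 a, s0 (s2 a)}" | "d = Inl a" | "d = Inl (s0 a)"
      | "d = Inl (s2 a)" | "d = Inl (s0 (s2 a))" | "d = Inr (True, True)" | "d = Inr (True, False)"
      | "d = Inr (False, True)" | "d = Inr (False, False)" using dD unfolding D_def by fastforce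
    then show ?thesis
    proof cases
      case (1 p)
      then have "ed p \<noteq> {x, y}" using eda by auto
      then show ?thesis using 1 glue(13)[of p] ed2[OF 1(2)] by (simp add: col_def)
    qed (use glue(5-12) ne edq in \<open>auto simp: col_def bar0_def bar2_def\<close>)
  qed
  have colV: "lab' d \<in> (if col d then verts G1 else verts G2)" if dD: "d \<in> D" for d
  proof -
    consider p where "d = Inl p" "p \<in> U" | p where "d = Inr p" using dD by (auto simp: D_def)
    then show ?thesis
    proof cases
      case (1 p)
      show ?thesis
      proof (cases "ed p = {x, y}")
        case True
        then have "lab p \<in> {x, y}" by (auto simp: ed_def)
        then show ?thesis using 1 xy_verts by (auto simp: lab'_def)
      next
        case False
        have "ed p \<in> edges G1 \<or> ed p \<in> edges G2" using U(4)[OF 1(2)] G(2) by (simp add: ed_def)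
        then show ?thesis
          using 1 False simple_graph_edge(1)[OF simple(1), of "lab p" "lab (s0 p)"]
            simple_graph_edge(1)[OF simple(2), of "lab p" "lab (s0 p)"]
          by (auto simp: lab'_def col_def ed_def)
      qed
    next
      case (2 p) then show ?thesis using xy_verts by (cases p) (auto simp: lab'_def)
    qed
  qed
  have mixed: "lab' p \<in> {x, y}" if "p \<in> D" "q \<in> D" "lab' p = lab' q" "col p \<noteq> col q" for p q
  proof -
    have "lab' p \<in> verts G1 \<inter> verts G2" using colV[OF that(1)] colV[OF that(2)] that(3,4) by (auto split: if_splits)
    then show ?thesis using meet by simp
  qed
  obtain s where s: "matching D s" "\<And>d. d \<in> D \<Longrightarrow> lab' (s d) = lab' d" "\<And>d. d \<in> D \<Longrightarrow> col (s d) = col d"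
    "\<And>p q. p \<in> D \<Longrightarrow> q \<in> D \<Longrightarrow> (p, q) \<in> conn (gr D s \<union> gr D u2) \<longleftrightarrow> lab' p = lab' q \<and> col p = col q"
    "int (orbs D u1 u0) - int (orbs D u1 u2) - 2 \<le> int (orbs D s u0) - int (orbs D s u2)"
    using separate_colours[OF fD(1,2,4,3), of col lab' x y] col_u0 col_u2 lab_u1 lab_u2 mixed by blast
  define Dc where "Dc c = {d \<in> D. col d = c}" for c
  have part: "4 * int (euler_genus H) \<le> 4 * (2 - int (card (verts H)) - int (orbs (Dc c) s u0)) + int (card (Dc c))"
    "lab' ` Dc c = verts H"
    if H: "simple_graph H" "connected_graph H" "{x, y} \<in> edges H" "x \<in> verts H" "y \<in> verts H"
      and Hc: "\<And>d. d \<in> Dc c \<Longrightarrow> lab' d \<in> verts H"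
      and He: "edges H \<subseteq> edges G" "\<And>d. d \<in> U \<Longrightarrow> ed d \<in> edges H \<Longrightarrow> ed d \<noteq> {x, y} \<Longrightarrow> col (Inl d) = c" for H c
  proof -
    have cl: "f d \<in> Dc c \<longleftrightarrow> d \<in> Dc c" if "d \<in> D" "f = s \<or> f = u0 \<or> f = u2" for f d
      using that s(3)[OF that(1)] col_u0[OF that(1)] col_u2[OF that(1)]
        matchingD(1)[OF s(1) that(1)] matchingD(1)[OF fD(2) that(1)] matchingD(1)[OF fD(4) that(1)] by (auto simp: Dc_def)
    have sub: "Dc c \<subseteq> D" by (auto simp: Dc_def)
    have "flag_map (Dc c) u0 s u2"
      unfolding flag_map_def
    proof (intro conjI)
      show "finite (Dc c)" using sub fD(1) finite_subset by blast
      show "matching (Dc c) u0" "matching (Dc c) s" "matching (Dc c) u2"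
        using matching_iff[OF fD(2) sub] matching_iff[OF s(1) sub] matching_iff[OF fD(4) sub] cl sub by blast+
    qed (use fD(5,6) sub in auto)
    moreover have "(p, q) \<in> conn (gr (Dc c) s \<union> gr (Dc c) u2) \<longleftrightarrow> lab' p = lab' q" if "p \<in> Dc c" "q \<in> Dc c" for p q
    proof -
      have "(p, q) \<in> conn (gr (Dc c) s \<union> gr (Dc c) u2) \<longleftrightarrow> (p, q) \<in> conn (gr D s \<union> gr D u2)"
        by (rule conn_closed_subset[OF sub]) (use cl that in auto)
      then show ?thesis using s(4)[of p q] that by (simp add: Dc_def)
    qed
    moreover have edge: "\<exists>d\<in>Dc c. lab' d = u \<and> lab' (u0 d) = v" if e: "{u, v} \<in> edges H" for u v
    proof (cases "{u, v} = {x, y}")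
      case True
      then have "u = x \<and> v = y \<or> u = y \<and> v = x" by (auto simp: doubleton_eq_iff)
      \<comment> \<open>The copy of \<open>xy\<close> in colour \<open>c\<close> contains sphere
        flags of side \<open>c\<close>; the first bit selects the end labelled
        \<open>u\<close>.\<close>
      then have "lab' (Inr (u = x, c)) = u \<and> lab' (u0 (Inr (u = x, c))) = v"
        using xy(1) by (auto simp: lab'_def u0_def bar0_def)
      moreover have "Inr (u = x, c) \<in> Dc c" by (auto simp: Dc_def D_def col_def)
      ultimately show ?thesis by blast
    next
      case False
      obtain d where d: "d \<in> U" "lab d = u" "lab (s0 d) = v" using U(5) e He(1) by blast
      then have "col (Inl d) = c" using He(2)[OF d(1)] False e by (simp add: ed_def)
      then have "Inl d \<in> Dc c" using d(1) by (auto simp: Dc_def D_def)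
      moreover have "lab' (Inl d) = u \<and> lab' (u0 (Inl d)) = v" using d by (simp add: lab'_def u0_def)
      ultimately show ?thesis by blast
    qed
    moreover show "lab' ` Dc c = verts H"
    proof (intro equalityI subsetI)
      fix v assume v: "v \<in> verts H"
      obtain w where "w \<in> verts H" "w \<noteq> v" using H(4,5) xy(1) by metis
      then obtain u where "{v, u} \<in> edges H" using connected_has_edge[OF H(2) v] by blast
      then show "v \<in> lab' ` Dc c" using edge by blast
    qed (use Hc in auto)
    ultimately show "4 * int (euler_genus H) \<le> 4 * (2 - int (card (verts H)) - int (orbs (Dc c) s u0)) + int (card (Dc c))"
      using euler_genus_le_labelled[of "Dc c" u0 s u2 H lab'] H(1,2) by blast
  qed
  \<comment> \<open>Ensures that an edge of \<open>G2\<close> other than \<open>xy\<close> is not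
    given the colour of \<open>G1\<close>.\<close>
  have both: "e = {x, y}" if e: "e \<in> edges G1" "e \<in> edges G2" for e
  proof -
    obtain u v where uv: "e = {u, v}" "u \<noteq> v" using simple_graph_edgeE[OF simple(1) e(1)] by metis
    have "u \<in> verts G1 \<inter> verts G2" "v \<in> verts G1 \<inter> verts G2"
      using simple_graph_edge[OF simple(1)] simple_graph_edge[OF simple(2)] e uv(1) by auto
    then show ?thesis using uv meet by auto
  qed
  have p1: "4 * int (euler_genus G1) \<le> 4 * (2 - int (card (verts G1)) - int (orbs (Dc True) s u0)) + int (card (Dc True))"
    "lab' ` Dc True = verts G1"
  proof (rule part[OF simple(1) con(1) xy(2) xy_verts(1,2)])
    show "lab' d \<in> verts G1" if "d \<in> Dc True" for d using colV[of d] that by (simp add: Dc_def)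
    show "edges G1 \<subseteq> edges G" by (simp add: G)
    show "col (Inl d) = True" if "ed d \<in> edges G1" "ed d \<noteq> {x, y}" for d using that by (simp add: col_def)
    show "lab' ` Dc True = verts G1"
    proof (rule part(2)[OF simple(1) con(1) xy(2) xy_verts(1,2)])
      show "lab' d \<in> verts G1" if "d \<in> Dc True" for d using colV[of d] that by (simp add: Dc_def)
      show "edges G1 \<subseteq> edges G" by (simp add: G)
      show "col (Inl d) = True" if "ed d \<in> edges G1" "ed d \<noteq> {x, y}" for d using that by (simp add: col_def)
    qed
  qed
  have p2: "4 * int (euler_genus G2) \<le> 4 * (2 - int (card (verts G2)) - int (orbs (Dc False) s u0)) + int (card (Dc False))"
    "lab' ` Dc False = verts G2"
  proof -
    have 1: "lab' d \<in> verts G2" if "d \<in> Dc False" for d using colV[of d] that by (simp add: Dc_def)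
    have 2: "edges G2 \<subseteq> edges G" by (simp add: G)
    have 3: "col (Inl d) = False" if "ed d \<in> edges G2" "ed d \<noteq> {x, y}" for d
      using that both[of "ed d"] by (auto simp: col_def)
    show "4 * int (euler_genus G2) \<le> 4 * (2 - int (card (verts G2)) - int (orbs (Dc False) s u0)) + int (card (Dc False))"
      by (rule part(1)[OF simple(2) con(2) xy(3) xy_verts(3,4) 1 2 3])
    show "lab' ` Dc False = verts G2"
      by (rule part(2)[OF simple(2) con(2) xy(3) xy_verts(3,4) 1 2 3])
  qed
  have fin: "finite (verts G1)" "finite (verts G2)" using simple by (auto simp: simple_graph_def)
  have cV: "card (verts G) + 2 = card (verts G1) + card (verts G2)"
    using card_Un_Int[OF fin] meet xy(1) G(1) by simp
  have "orbs D s u2 = card ((\<lambda>d. (lab' d, col d)) ` D)"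
    by (rule ncomp_key[OF fD(1)]) (use s(4) in auto)
  also have "(\<lambda>d. (lab' d, col d)) ` D = (lab' ` Dc True) \<times> {True} \<union> (lab' ` Dc False) \<times> {False}"
    by (auto simp: Dc_def)
  also have "card \<dots> = card (verts G1) + card (verts G2)"
    unfolding p1(2) p2(2) using fin by (subst card_Un_disjoint) (auto simp: card_cartesian_product)
  finally have V': "orbs D s u2 = card (verts G1) + card (verts G2)" .
  have V: "orbs U s1 s2 = card (verts G)"
    using ncomp_key[OF fU(1) U(2)] U(3) by simp
  have "card ?S = 4" using card_cartesian_product[of "UNIV :: bool set" "UNIV :: bool set"] by simp
  then have cD: "card D = card U + 4" unfolding D_def using card_Plus[OF fU(1), of ?S] by simp
  have Dsplit: "Dc True = {d \<in> D. col d}" "Dc False = {d \<in> D. \<not> col d}" by (auto simp: Dc_def)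
  have F: "orbs D s u0 = orbs (Dc True) s u0 + orbs (Dc False) s u0"
    unfolding Dsplit by (rule orbs_split[OF fD(1) _ _ s(1) fD(2)]) (use s(3) col_u0 in auto)
  have cc: "card D = card (Dc True) + card (Dc False)"
  proof -
    have "D = Dc True \<union> Dc False" by (auto simp: Dc_def)
    moreover have "card (Dc True \<union> Dc False) = card (Dc True) + card (Dc False)"
      by (rule card_Un_disjoint) (use fD(1) in \<open>auto simp: Dc_def\<close>)
    ultimately show ?thesis by simp
  qed
  have "int (orbs D u1 u2) = int (card (verts G))" "int (orbs D u1 u0) = int (orbs U s1 s0) + 1"
    using glue(2,3) V single_edge_sphere(2,3) by simp_all
  \<comment> \<open>The vertices increase by two, exactly the loss that
    \<open>separate_colours\<close> allows in the difference, so the two parts together have at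
    least as many faces as the doubled map. Its additional face cancels the four additional flags,
    and the two new vertices are paid for by counting 2 once for each part instead of once.\<close>
  then show ?thesis
    using U(7) p1(1) p2(1) s(5) V' cV cD F cc by (simp add: algebra_simps)
qed

end

section \<open>Minors of sums\<close>

definition adj :: "'a graph \<Rightarrow> 'a rel" where
  "adj H = {(a, b). {a, b} \<in> edges H}"

lemma connected_graph_conn:
  "connected_graph H \<longleftrightarrow> verts H \<noteq> {} \<and> (\<forall>u\<in>verts H. \<forall>v\<in>verts H. (u, v) \<in> conn (adj H))"
proof -
  have "conn (adj H) = {(a, b). {a, b} \<in> edges H}\<^sup>*"
    unfolding adj_def by (rule conn_symmetric) (simp add: insert_commute)
  then show ?thesis unfolding connected_graph_def by simp
qed

lemma connected_graphI:
  assumes "r \<in> verts H" "\<And>v. v \<in> verts H \<Longrightarrow> (v, r) \<in> conn (adj H)"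
  shows "connected_graph H"
  unfolding connected_graph_conn
proof (intro conjI ballI)
  fix u v assume "u \<in> verts H" "v \<in> verts H"
  then show "(u, v) \<in> conn (adj H)" using assms(2) conn_trans conn_sym by metis
qed (use assms(1) in auto)

lemma connected_mono:
  assumes "connected_graph H" "verts K = verts H" "\<And>u v. {u, v} \<in> edges H \<Longrightarrow> (u, v) \<in> conn (adj K)"
  shows "connected_graph K"
  using assms(1) unfolding connected_graph_conn assms(2)
proof (elim conjE, intro conjI ballI)
  fix u v assume "\<forall>u\<in>verts H. \<forall>v\<in>verts H. (u, v) \<in> conn (adj H)" "u \<in> verts H" "v \<in> verts H"
  then have "(u, v) \<in> conn (adj H)" by blast
  then show "(u, v) \<in> conn (adj K)" by (rule conn_least) (rule assms(3), simp add: adj_def[of H])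
qed

lemma add_xy_simps [simp]:
  "verts (add_xy x y G) = verts G" "edges (add_xy x y G) = insert {x, y} (edges G)"
  by (simp_all add: add_xy_def)

lemma connected_add_xy: "connected_graph H \<Longrightarrow> connected_graph (add_xy x y H)"
  by (rule connected_mono) (auto simp: adj_def intro: conn_base)

lemma simple_add_xy: "G \<in> G_xy x y \<Longrightarrow> simple_graph (add_xy x y G)"
  unfolding G_xy_def simple_graph_def by auto

lemma xy_sum_amalgam:
  assumes "is_xy_sum x y G G1 G2"
  shows "edge_amalgam (add_xy x y G) (add_xy x y G1) (add_xy x y G2) x y"
proof
  show "simple_graph (add_xy x y G1)" "simple_graph (add_xy x y G2)"
    using assms simple_add_xy by (auto simp: is_xy_sum_def)
  show "x \<noteq> y" using assms by (auto simp: is_xy_sum_def G_xy_def)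
qed (use assms in \<open>auto simp: is_xy_sum_def\<close>)

text \<open>The bound that also covers minors of the summands, which may be disconnected.\<close>

lemma euler_genus_plus_sum_le:
  "is_xy_sum x y G G1 G2 \<Longrightarrow> euler_genus_plus x y G \<le> euler_genus_plus x y G1 + euler_genus_plus x y G2"
  unfolding euler_genus_plus_def by (rule edge_amalgam.euler_genus_amalgam_le[OF xy_sum_amalgam])

text \<open>Connectedness is asked for after adding \<open>xy\<close>, a condition that the minors
  considered in \<open>connected_minor\<close> satisfy.\<close>

lemma euler_genus_plus_sum:
  assumes sum: "is_xy_sum x y G G1 G2" and con: "connected_graph (add_xy x y G1)" "connected_graph (add_xy x y G2)"
  shows "euler_genus_plus x y G = euler_genus_plus x y G1 + euler_genus_plus x y G2"
proof (rule antisym[OF euler_genus_plus_sum_le[OF sum]])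
  let ?K = "add_xy x y G"
  have v: "x \<in> verts G1" "x \<in> verts G2" "verts G = verts G1 \<union> verts G2" "edges G = edges G1 \<union> edges G2"
    using sum by (auto simp: is_xy_sum_def G_xy_def)
  have "connected_graph ?K"
  proof (rule connected_graphI[of x])
    fix u assume "u \<in> verts ?K"
    then have "u \<in> verts G1 \<or> u \<in> verts G2" using v by simp
    then have "(u, x) \<in> conn (adj (add_xy x y G1)) \<or> (u, x) \<in> conn (adj (add_xy x y G2))"
      using con v(1,2) unfolding connected_graph_conn by auto
    then show "(u, x) \<in> conn (adj ?K)"
      by (elim disjE conn_mono) (auto simp: adj_def v)
  qed (simp add: v)
  then show "euler_genus_plus x y G1 + euler_genus_plus x y G2 \<le> euler_genus_plus x y G"
    unfolding euler_genus_plus_def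
    by (rule edge_amalgam.euler_genus_amalgam_ge[OF xy_sum_amalgam[OF sum] con])
qed

lemma xy_sum_commute: "is_xy_sum x y G G1 G2 \<Longrightarrow> is_xy_sum x y G G2 G1"
  by (auto simp: is_xy_sum_def Un_commute)

lemma G_xy_edgeE:
  assumes "G \<in> G_xy x y" "e \<in> edges G"
  obtains u v where "e = {u, v}" "u \<noteq> v" "u \<in> verts G" "v \<in> verts G"
  using assms simple_graph_edgeE[of G e] by (auto simp: G_xy_def)

text \<open>A common edge would have both ends in \<open>{x, y}\<close> and hence be
  \<open>xy\<close> itself.\<close>

lemma xy_sum_edge_unique:
  assumes "is_xy_sum x y G G1 G2" "{x, y} \<notin> edges G1" "e \<in> edges G1"
  shows "e \<notin> edges G2"
proof
  assume e2: "e \<in> edges G2"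
  have G: "G1 \<in> G_xy x y" "G2 \<in> G_xy x y" "verts G1 \<inter> verts G2 = {x, y}" using assms(1) by (auto simp: is_xy_sum_def)
  obtain u v where uv: "e = {u, v}" "u \<noteq> v" "u \<in> verts G1" "v \<in> verts G1" using G_xy_edgeE[OF G(1) assms(3)] .
  obtain u' v' where "e = {u', v'}" "u' \<in> verts G2" "v' \<in> verts G2" using G_xy_edgeE[OF G(2) e2] .
  then have "u \<in> {x, y}" "v \<in> {x, y}" using uv G(3) by (auto simp: doubleton_eq_iff)
  then have "e = {x, y}" using uv by auto
  then show False using assms(2,3) by simp
qed

lemma delete_edge_G_xy: "G \<in> G_xy x y \<Longrightarrow> delete_edge e G \<in> G_xy x y"
  by (auto simp: G_xy_def simple_graph_def delete_edge_def)

lemma contract_edge_G_xy: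
  assumes "G \<in> G_xy x y" "{u, v} \<in> edges G" "v \<noteq> x" "v \<noteq> y"
  shows "contract_edge u v G \<in> G_xy x y"
proof -
  let ?h = "\<lambda>w. if w = v then u else w"
  have uv: "u \<in> verts G" "v \<in> verts G" "u \<noteq> v" using simple_graph_edge[of G u v] assms by (auto simp: G_xy_def)
  have "\<exists>p q. ?h ` e = {p, q} \<and> p \<noteq> q \<and> p \<in> verts G - {v} \<and> q \<in> verts G - {v}"
    if e: "e \<in> edges G - {{u, v}}" for e
  proof -
    have eG: "e \<in> edges G" "e \<noteq> {u, v}" using e by auto
    obtain p q where pq: "e = {p, q}" "p \<noteq> q" "p \<in> verts G" "q \<in> verts G" using G_xy_edgeE[OF assms(1) eG(1)] .
    have "?h ` e = {?h p, ?h q}" using pq(1) by simp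
    moreover have "?h p \<noteq> ?h q" using pq(1,2) eG(2) by (auto split: if_splits)
    moreover have "?h p \<in> verts G - {v}" "?h q \<in> verts G - {v}" using pq(3,4) uv by auto
    ultimately show ?thesis by blast
  qed
  then show ?thesis
    using assms unfolding G_xy_def simple_graph_def contract_edge_def by auto
qed

lemma xy_sum_delete:
  assumes sum: "is_xy_sum x y G G1 G2" and "{x, y} \<notin> edges G1" "e \<in> edges G1"
  shows "is_xy_sum x y (delete_edge e G) (delete_edge e G1) G2"
  using sum xy_sum_edge_unique[OF assms] delete_edge_G_xy[of G1 x y e]
  by (auto simp: is_xy_sum_def delete_edge_def)

text \<open>The vertex \<open>v\<close> that disappears is not a terminal, so it does not occur in
  \<open>G2\<close>, and the contraction leaves \<open>G2\<close> as it is.\<close>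

lemma xy_sum_contract:
  assumes sum: "is_xy_sum x y G G1 G2" and e: "{x, y} \<notin> edges G1" "{u, v} \<in> edges G1" and v: "v \<noteq> x" "v \<noteq> y"
  shows "is_xy_sum x y (contract_edge u v G) (contract_edge u v G1) G2"
proof -
  have G: "G1 \<in> G_xy x y" "G2 \<in> G_xy x y" "verts G1 \<inter> verts G2 = {x, y}"
    "verts G = verts G1 \<union> verts G2" "edges G = edges G1 \<union> edges G2"
    using sum by (auto simp: is_xy_sum_def)
  have "v \<in> verts G1" using G_xy_edgeE[OF G(1) e(2)] by (auto simp: doubleton_eq_iff)
  then have v2: "v \<notin> verts G2" using G(3) v by blast
  let ?h = "\<lambda>w. if w = v then u else w"
  have "?h ` f = f" if "f \<in> edges G2" for f
    using G_xy_edgeE[OF G(2) that] v2 by (smt (verit) image_cong image_ident insertE singletonD)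
  then have "(\<lambda>f. ?h ` f) ` edges G2 = edges G2" by simp
  moreover have "edges G - {{u, v}} = (edges G1 - {{u, v}}) \<union> edges G2"
    using xy_sum_edge_unique[OF sum e] G(5) by auto
  ultimately have E: "edges (contract_edge u v G) = edges (contract_edge u v G1) \<union> edges G2"
    by (simp add: contract_edge_def image_Un)
  have V: "verts (contract_edge u v G) = verts (contract_edge u v G1) \<union> verts G2"
    "verts (contract_edge u v G1) \<inter> verts G2 = {x, y}"
    using G(3,4) v v2 by (auto simp: contract_edge_def)
  show ?thesis
    unfolding is_xy_sum_def
    using contract_edge_G_xy[OF G(1) e(2) v] G(2) V E by (auto intro!: graph.equality)
qed

lemma minor_resultsE:
  assumes "H \<in> minor_results x y G"
  obtains (delete) e where "e \<in> edges G" "H = delete_edge e G"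
  | (contract) u v where "{u, v} \<in> edges G" "v \<noteq> x" "v \<noteq> y" "H = contract_edge u v G"
  using assms by (auto simp: minor_results_def)

lemma minor_resultsI:
  "e \<in> edges G \<Longrightarrow> delete_edge e G \<in> minor_results x y G"
  "{u, v} \<in> edges G \<Longrightarrow> v \<noteq> x \<Longrightarrow> v \<noteq> y \<Longrightarrow> contract_edge u v G \<in> minor_results x y G"
  by (auto simp: minor_results_def)

lemma minor_of_summand:
  assumes "is_xy_sum x y G G1 G2" "{x, y} \<notin> edges G1" "H \<in> minor_results x y G1"
  shows "\<exists>K\<in>minor_results x y G. is_xy_sum x y K H G2"
proof -
  have E: "edges G1 \<subseteq> edges G" using assms(1) by (auto simp: is_xy_sum_def)
  from assms(3) show ?thesis
  proof (cases rule: minor_resultsE)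
    case (delete e)
    then show ?thesis using xy_sum_delete[OF assms(1,2)] minor_resultsI(1)[of e G] E by blast
  next
    case (contract u v)
    then show ?thesis using xy_sum_contract[OF assms(1,2)] minor_resultsI(2)[of u v G] E by blast
  qed
qed

lemma minor_of_xy_sum:
  assumes "is_xy_sum x y G G1 G2" "{x, y} \<notin> edges G1" "{x, y} \<notin> edges G2" "H \<in> minor_results x y G"
  shows "(\<exists>K\<in>minor_results x y G1. is_xy_sum x y H K G2) \<or> (\<exists>K\<in>minor_results x y G2. is_xy_sum x y H G1 K)"
proof -
  note sum' = xy_sum_commute[OF assms(1)]
  have E: "edges G = edges G1 \<union> edges G2" using assms(1) by (auto simp: is_xy_sum_def)
  from assms(4) show ?thesis
  proof (cases rule: minor_resultsE)
    case (delete e)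
    then have "e \<in> edges G1 \<or> e \<in> edges G2" using E by auto
    then show ?thesis
      using xy_sum_delete[OF assms(1,2), of e] xy_sum_commute[OF xy_sum_delete[OF sum' assms(3), of e]]
        minor_resultsI(1)[of e] delete(2) by blast
  next
    case (contract u v)
    then have "{u, v} \<in> edges G1 \<or> {u, v} \<in> edges G2" using E by auto
    then show ?thesis
      using xy_sum_contract[OF assms(1,2), of u v] xy_sum_commute[OF xy_sum_contract[OF sum' assms(3), of u v]]
        minor_resultsI(2)[of u v] contract(2-4) by blast
  qed
qed

section \<open>Criticality of sums and of their summands\<close>

lemma critical_sum:
  assumes G1: "G1 \<in> C_nonadj x y 0" "connected_graph G1" and G2: "G2 \<in> C_nonadj x y 1" "connected_graph G2"
    and sum: "is_xy_sum x y G G1 G2"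
  shows "G \<in> C_nonadj x y 2"
proof -
  have n: "{x, y} \<notin> edges G1" "{x, y} \<notin> edges G2"
    and c: "plus_critical x y G1" "plus_critical x y G2"
    and g: "euler_genus_plus x y G1 = 1" "euler_genus_plus x y G2 = 2"
    using G1(1) G2(1) by (auto simp: C_nonadj_def G_xy_nonadj_def)
  have G: "euler_genus_plus x y G = 3"
    using euler_genus_plus_sum[OF sum connected_add_xy[OF G1(2)] connected_add_xy[OF G2(2)]] g by linarith
  have "plus_critical x y G"
    unfolding plus_critical_def
  proof
    fix H assume "H \<in> minor_results x y G"
    then consider K where "K \<in> minor_results x y G1" "is_xy_sum x y H K G2"
      | K where "K \<in> minor_results x y G2" "is_xy_sum x y H G1 K"
      using minor_of_xy_sum[OF sum n] by blast
    \<comment> \<open>The genus of one summand drops, so the upper bound for the minor suffices; the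
      exact formula is used only for \<open>G\<close>.\<close>
    then show "euler_genus_plus x y H < euler_genus_plus x y G"
    proof cases
      case (1 K)
      then have "euler_genus_plus x y K < 1" using c(1) g unfolding plus_critical_def by metis
      then show ?thesis using euler_genus_plus_sum_le[OF 1(2)] g G by linarith
    next
      case (2 K)
      then have "euler_genus_plus x y K < 2" using c(2) g unfolding plus_critical_def by metis
      then show ?thesis using euler_genus_plus_sum_le[OF 2(2)] g G by linarith
    qed
  qed
  moreover have "G \<in> G_xy_nonadj x y"
  proof -
    have S: "simple_graph G1" "simple_graph G2" "verts G = verts G1 \<union> verts G2" "edges G = edges G1 \<union> edges G2"
      "x \<in> verts G" "y \<in> verts G" "x \<noteq> y"
      using sum by (auto simp: is_xy_sum_def G_xy_def)
    have "\<exists>u v. e = {u, v} \<and> u \<noteq> v \<and> u \<in> verts G \<and> v \<in> verts G" if "e \<in> edges G" for e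
    proof -
      have "e \<in> edges G1 \<or> e \<in> edges G2" using that S(4) by simp
      then obtain u v where "e = {u, v}" "u \<noteq> v" "u \<in> verts G" "v \<in> verts G"
        using simple_graph_edgeE[OF S(1), of e] simple_graph_edgeE[OF S(2), of e] unfolding S(3) by (metis UnI1 UnI2)
      then show ?thesis by blast
    qed
    then have "simple_graph G" using S(1-3) by (simp add: simple_graph_def)
    then have "simple_graph G" "x \<in> verts G" "y \<in> verts G" "x \<noteq> y" "{x, y} \<notin> edges G"
      using S n by simp_all
    then show ?thesis by (simp add: G_xy_nonadj_def G_xy_def)
  qed
  ultimately show ?thesis using G by (simp add: C_nonadj_def)
qed

text \<open>\<open>W\<close> is a union of components of \<open>G - {x, y}\<close>, expressed by
  closure along edges; both sides of the cut are instances.\<close>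

locale two_connected_piece =
  fixes G :: "'a graph" and x y :: 'a and W :: "'a set"
  assumes G: "G \<in> G_xy_nonadj x y" and two: "two_connected G"
    and W: "W \<noteq> {}" "W \<subseteq> verts G - {x, y}"
    and closed: "\<And>a b. {a, b} \<in> edges G \<Longrightarrow> a \<in> W \<Longrightarrow> b \<in> W \<union> {x, y}"
begin

definition piece :: "'a graph" where
  "piece = \<lparr>verts = W \<union> {x, y}, edges = {e \<in> edges G. e \<subseteq> W \<union> {x, y}}\<rparr>"

lemma xyG: "simple_graph G" "x \<noteq> y" "x \<in> verts G" "y \<in> verts G" "{x, y} \<notin> edges G"
  using G by (auto simp: G_xy_nonadj_def G_xy_def)

lemma piece_nonadj: "piece \<in> G_xy_nonadj x y"
proof -
  have fin: "finite (W \<union> {x, y})"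
    using xyG(1) W(2) by (auto simp: simple_graph_def intro: finite_subset)
  have "\<exists>u v. e = {u, v} \<and> u \<noteq> v \<and> u \<in> W \<union> {x, y} \<and> v \<in> W \<union> {x, y}"
    if e: "e \<in> edges G" "e \<subseteq> W \<union> {x, y}" for e
  proof -
    obtain u v where "e = {u, v}" "u \<noteq> v" using simple_graph_edgeE[OF xyG(1) e(1)] by metis
    then show ?thesis using e(2) by blast
  qed
  then show ?thesis using fin xyG unfolding G_xy_nonadj_def G_xy_def simple_graph_def piece_def by auto
qed

text \<open>Since \<open>z\<close> is not a cut vertex, every other vertex of the piece can leave it without using \<open>z\<close>.\<close>

lemma reach_terminal:
  assumes z: "z \<in> verts G" and w: "w \<in> W \<union> {x, y}" "w \<noteq> z"
  obtains t where "t \<in> {x, y} - {z}" "(w, t) \<in> conn {(a, b). {a, b} \<in> edges piece \<and> z \<notin> {a, b}}"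
proof -
  let ?R = "{(a, b). {a, b} \<in> edges piece \<and> z \<notin> {a, b}}"
  obtain t0 where t0: "t0 \<in> {x, y} - {z}" using xyG(2) by blast
  have t0G: "t0 \<in> verts G" "w \<in> verts G" using t0 xyG(3,4) w W(2) by auto
  have "\<not> vertex_cut G {z}" using two z by (simp add: two_connected_def)
  then have "connected_graph (delete_verts {z} G)"
    using z t0 t0G unfolding vertex_cut_def by blast
  then have wt: "(w, t0) \<in> conn (adj (delete_verts {z} G))"
    using t0 t0G w(2) unfolding connected_graph_conn by (simp add: delete_verts_def)
  \<comment> \<open>The walk in \<open>G - z\<close> is followed only until it first meets a
    terminal; up to then \<open>closed\<close> keeps it inside \<open>W\<close>.\<close>
  have "(t0 \<in> W \<and> (w, t0) \<in> conn ?R) \<or> (\<exists>t\<in>{x, y} - {z}. (w, t) \<in> conn ?R)"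
    using wt
  proof (induction rule: conn_induct)
    case refl
    show ?case using w by auto
  next
    case (step c d)
    show ?case
    proof (cases "\<exists>t\<in>{x, y} - {z}. (w, t) \<in> conn ?R")
      case False
      then have c: "c \<in> W" "(w, c) \<in> conn ?R" using step(3) by auto
      have e: "{c, d} \<in> edges G" "z \<notin> {c, d}"
        using step(2) by (auto simp: adj_def delete_verts_def insert_commute)
      have d: "d \<in> W \<union> {x, y}" by (rule closed[OF e(1) c(1)])
      then have "(c, d) \<in> ?R" using e c by (simp add: piece_def)
      then have "(w, d) \<in> conn ?R" using conn_trans[OF c(2) conn_base] by blast
      then show ?thesis using d e(2) by auto
    qed simp
  qed
  then show ?thesis using that t0 W(2) by blast
qed

lemma piece_edge_mono: "{(a, b). {a, b} \<in> edges piece \<and> z \<notin> {a, b}} \<subseteq> adj piece"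
  by (auto simp: adj_def)

text \<open>With \<open>z = y\<close> and with \<open>z = x\<close>, \<open>reach_terminal\<close>
  leads from every vertex of \<open>W\<close> to both terminals, and through such a vertex the
  terminals are connected with each other.\<close>

lemma connected_piece: "connected_graph piece"
proof -
  have X: "(w, x) \<in> conn (adj piece)" "(w, y) \<in> conn (adj piece)" if w: "w \<in> W" for w
  proof -
    have ne: "w \<noteq> x" "w \<noteq> y" using w W(2) by auto
    obtain t where t: "t \<in> {x, y} - {y}" "(w, t) \<in> conn {(a, b). {a, b} \<in> edges piece \<and> y \<notin> {a, b}}"
      using reach_terminal[OF xyG(4), of w] w ne by blast
    then show "(w, x) \<in> conn (adj piece)" using conn_mono[OF t(2) piece_edge_mono] by auto
    obtain t where t: "t \<in> {x, y} - {x}" "(w, t) \<in> conn {(a, b). {a, b} \<in> edges piece \<and> x \<notin> {a, b}}"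
      using reach_terminal[OF xyG(3), of w] w ne by blast
    then show "(w, y) \<in> conn (adj piece)" using conn_mono[OF t(2) piece_edge_mono] by auto
  qed
  obtain w0 where "w0 \<in> W" using W(1) by blast
  then have "(y, x) \<in> conn (adj piece)" using X conn_sym conn_trans by metis
  then show ?thesis
    by (intro connected_graphI[of x]) (use X in \<open>auto simp: piece_def\<close>)
qed

text \<open>Makes the exact formula available for minors. After the deletion of an edge, each of its
  ends still reaches a terminal while avoiding the other end, and \<open>xy\<close> joins the
  terminals; a contraction preserves connectedness.\<close>

lemma connected_minor:
  assumes "H \<in> minor_results x y piece"
  shows "connected_graph (add_xy x y H)"
  using assms
proof (cases rule: minor_resultsE)
  case (contract u v)
  let ?h = "\<lambda>w. if w = v then u else w"
  have pG: "piece \<in> G_xy x y" using piece_nonadj by (simp add: G_xy_nonadj_def)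
  have v: "v \<in> verts piece" "u \<in> verts piece" "u \<noteq> v"
    using simple_graph_edge[of piece u v] pG contract(1) by (auto simp: G_xy_def)
  have "connected_graph H"
  proof (rule connected_graphI[of u])
    show "u \<in> verts H" using v by (simp add: contract(4) contract_edge_def)
    fix w assume "w \<in> verts H"
    then have w: "w \<in> verts piece" "w \<noteq> v" by (auto simp: contract(4) contract_edge_def)
    then have "(w, u) \<in> conn (adj piece)" using connected_piece v(2) unfolding connected_graph_conn by blast
    then have "(?h w, ?h u) \<in> conn (adj H)"
    proof (rule conn_map)
      fix p q assume pq: "(p, q) \<in> adj piece"
      show "(?h p, ?h q) \<in> conn (adj H)"
      proof (cases "{p, q} = {u, v}")
        case True then show ?thesis by (auto simp: doubleton_eq_iff)
      next
        case False
        have "?h ` {p, q} = {?h p, ?h q}" by simp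
        moreover have "{p, q} \<in> edges piece - {{u, v}}" using False pq by (simp add: adj_def)
        ultimately have "{?h p, ?h q} \<in> edges H"
          unfolding contract(4) contract_edge_def by (metis (no_types, lifting) graph.select_convs(2) imageI)
        then show ?thesis by (intro conn_base) (simp add: adj_def)
      qed
    qed
    then show "(w, u) \<in> conn (adj H)" using w(2) by simp
  qed
  then show ?thesis by (rule connected_add_xy)
next
  case (delete e)
  let ?K = "add_xy x y H"
  have pG: "piece \<in> G_xy x y" using piece_nonadj by (simp add: G_xy_nonadj_def)
  obtain p q where pq: "e = {p, q}" "p \<noteq> q" "p \<in> verts piece" "q \<in> verts piece"
    using G_xy_edgeE[OF pG delete(1)] .
  have EK: "edges ?K = insert {x, y} (edges piece - {e})" "verts ?K = verts piece"
    by (simp_all add: delete(2) delete_edge_def)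
  have EH: "edges H = edges piece - {e}" by (simp add: delete(2) delete_edge_def)
  have xyK: "(x, y) \<in> conn (adj ?K)" by (rule conn_base) (simp add: adj_def)
  have sub: "verts piece \<subseteq> verts G" using W(2) xyG by (auto simp: piece_def)
  have R: "(w, x) \<in> conn (adj ?K)" if w: "w \<in> verts piece" "w \<noteq> z" and z: "z \<in> verts piece" "z \<in> e" for w z
  proof -
    obtain t where t: "t \<in> {x, y} - {z}" "(w, t) \<in> conn {(a, b). {a, b} \<in> edges piece \<and> z \<notin> {a, b}}"
      using reach_terminal[of z w] w z sub by (auto simp: piece_def)
    have "(w, t) \<in> conn (adj ?K)"
      by (rule conn_mono[OF t(2)]) (use z(2) in \<open>auto simp: adj_def EH\<close>)
    then show ?thesis using t(1) conn_sym[OF xyK] conn_trans[of w t _ x] by auto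
  qed
  have "(p, x) \<in> conn (adj ?K)" "(q, x) \<in> conn (adj ?K)"
    using R[of p q] R[of q p] pq by auto
  then have pqK: "(p, q) \<in> conn (adj ?K)" using conn_sym conn_trans by metis
  show ?thesis
  proof (rule connected_mono[OF connected_piece EK(2)])
    fix u v assume uv: "{u, v} \<in> edges piece"
    show "(u, v) \<in> conn (adj ?K)"
    proof (cases "{u, v} = e")
      case True
      then show ?thesis using pqK conn_sym[OF pqK] pq(1) by (auto simp: doubleton_eq_iff)
    next
      case False
      then show ?thesis by (intro conn_base) (use uv EK in \<open>simp add: adj_def\<close>)
    qed
  qed
qed

text \<open>Turns criticality of the piece into positivity of its genus: some minor has a smaller
  one.\<close>

lemma piece_has_minor: "minor_results x y piece \<noteq> {}"
proof -
  obtain u where "{x, u} \<in> edges piece"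
    using connected_has_edge[OF connected_piece, of x y] xyG(2) by (auto simp: piece_def)
  then show ?thesis using minor_resultsI(1)[of "{x, u}" piece x y] by blast
qed

end

lemma split_critical:
  assumes two: "two_connected G" and C: "G \<in> C_nonadj x y 2" and cut: "vertex_cut G {x, y}"
  shows "\<exists>G1 G2. G1 \<in> G_xy_nonadj x y \<and> connected_graph G1 \<and> G2 \<in> G_xy_nonadj x y \<and> connected_graph G2 \<and>
    is_xy_sum x y G G1 G2 \<and> G1 \<in> C_nonadj x y 0 \<and> G2 \<in> C_nonadj x y 1"
proof -
  have G: "G \<in> G_xy_nonadj x y" "plus_critical x y G" "euler_genus_plus x y G = 3"
    using C by (auto simp: C_nonadj_def)
  have xy: "simple_graph G" "x \<noteq> y" "x \<in> verts G" "y \<in> verts G" "{x, y} \<notin> edges G"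
    using G(1) by (auto simp: G_xy_nonadj_def G_xy_def)
  let ?H = "delete_verts {x, y} G"
  obtain u v where uv: "u \<in> verts G - {x, y}" "v \<in> verts G - {x, y}" "(u, v) \<notin> conn (adj ?H)"
    using cut unfolding vertex_cut_def connected_graph_conn by (auto simp: delete_verts_def)
  \<comment> \<open>The component of \<open>u\<close> in \<open>G - {x, y}\<close>; the rest
    \<open>B\<close> is nonempty because it contains \<open>v\<close>.\<close>
  define A where "A = {w \<in> verts G - {x, y}. (u, w) \<in> conn (adj ?H)}"
  define B where "B = verts G - {x, y} - A"
  have step: "b \<in> verts G \<and> (b \<in> {x, y} \<or> (a, b) \<in> conn (adj ?H))" if "{a, b} \<in> edges G" "a \<notin> {x, y}" for a b
    using that simple_graph_edge[OF xy(1) that(1)] by (auto simp: adj_def delete_verts_def intro: conn_base)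
  have clA: "b \<in> A \<union> {x, y}" if "{a, b} \<in> edges G" "a \<in> A" for a b
  proof -
    have a: "a \<notin> {x, y}" "(u, a) \<in> conn (adj ?H)" using that(2) by (auto simp: A_def)
    show ?thesis using step[OF that(1) a(1)] conn_trans[OF a(2)] by (auto simp: A_def)
  qed
  have clB: "b \<in> B \<union> {x, y}" if e: "{a, b} \<in> edges G" "a \<in> B" for a b
  proof -
    have "{b, a} \<in> edges G" using e(1) by (simp add: insert_commute)
    then have "b \<notin> A" using clA[of b a] e(2) by (auto simp: B_def)
    moreover have "b \<in> verts G" using simple_graph_edge[OF xy(1) e(1)] by simp
    ultimately show ?thesis by (auto simp: B_def)
  qed
  interpret A: two_connected_piece G x y A
    by unfold_locales (use G(1) two uv clA in \<open>auto simp: A_def\<close>)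
  interpret B: two_connected_piece G x y B
    by unfold_locales (use G(1) two uv clB in \<open>auto simp: A_def B_def\<close>)
  have sum: "is_xy_sum x y G A.piece B.piece"
    unfolding is_xy_sum_def
  proof (intro conjI)
    show "A.piece \<in> G_xy x y" "B.piece \<in> G_xy x y"
      using A.piece_nonadj B.piece_nonadj by (auto simp: G_xy_nonadj_def)
    have AB: "A \<inter> B = {}" "A \<union> B \<union> {x, y} = verts G" using xy by (auto simp: A_def B_def)
    show "verts A.piece \<inter> verts B.piece = {x, y}"
      using AB(1) A.W(2) B.W(2) by (auto simp: A.piece_def B.piece_def)
    have V: "verts G = verts A.piece \<union> verts B.piece"
      using AB(2) by (auto simp: A.piece_def B.piece_def)
    have "e \<in> edges A.piece \<or> e \<in> edges B.piece" if e: "e \<in> edges G" for e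
    proof -
      obtain p q where pq: "e = {p, q}" "p \<in> verts G" "q \<in> verts G" "p \<noteq> q" using simple_graph_edgeE[OF xy(1) e] .
      have qp: "{q, p} \<in> edges G" using e pq(1) by (simp add: insert_commute)
      have "\<not> (p \<in> {x, y} \<and> q \<in> {x, y})" using pq e xy(5) by (auto simp: insert_commute)
      then consider "p \<in> A" | "p \<in> B" | "q \<in> A" | "q \<in> B" using pq(2,3) AB(2) by blast
      then show ?thesis
        using clA[of p q] clB[of p q] clA[OF qp] clB[OF qp] e pq(1)
        by cases (auto simp: A.piece_def B.piece_def)
    qed
    then have E: "edges G = edges A.piece \<union> edges B.piece" by (auto simp: A.piece_def B.piece_def)
    show "G = \<lparr>verts = verts A.piece \<union> verts B.piece, edges = edges A.piece \<union> edges B.piece\<rparr>"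
      using V E by (auto intro!: graph.equality)
  qed
  have nA: "{x, y} \<notin> edges A.piece" and nB: "{x, y} \<notin> edges B.piece" using xy(5) by (auto simp: A.piece_def B.piece_def)
  \<comment> \<open>The summand \<open>Q\<close> is kept, so a strict drop for the sum is a strict
    drop for \<open>P\<close>. This takes the exact formula for the minor and the upper bound for
    \<open>G\<close>.\<close>
  have crit: "euler_genus_plus x y H < euler_genus_plus x y P"
    if s: "is_xy_sum x y G P Q" and n: "{x, y} \<notin> edges P" and H: "H \<in> minor_results x y P"
      and c: "connected_graph (add_xy x y H)" "connected_graph Q" for P Q H
  proof -
    obtain K where K: "K \<in> minor_results x y G" "is_xy_sum x y K H Q"
      using minor_of_summand[OF s n H] by blast
    have "euler_genus_plus x y H + euler_genus_plus x y Q = euler_genus_plus x y K"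
      using euler_genus_plus_sum[OF K(2) c(1) connected_add_xy[OF c(2)]] by simp
    also have "\<dots> < euler_genus_plus x y G" using G(2) K(1) by (simp add: plus_critical_def)
    also have "\<dots> \<le> euler_genus_plus x y P + euler_genus_plus x y Q" by (rule euler_genus_plus_sum_le[OF s])
    finally show ?thesis by simp
  qed
  have cA: "plus_critical x y A.piece"
    unfolding plus_critical_def using crit[OF sum nA] A.connected_minor B.connected_piece by blast
  have cB: "plus_critical x y B.piece"
    unfolding plus_critical_def using crit[OF xy_sum_commute[OF sum] nB] B.connected_minor A.connected_piece by blast
  have "euler_genus_plus x y A.piece + euler_genus_plus x y B.piece = 3"
    using euler_genus_plus_sum[OF sum] connected_add_xy A.connected_piece B.connected_piece G(3) by metis
  moreover have "euler_genus_plus x y A.piece > 0" "euler_genus_plus x y B.piece > 0"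
    using cA cB A.piece_has_minor B.piece_has_minor unfolding plus_critical_def by fastforce+
  \<comment> \<open>Two positive numbers with sum 3 are 1 and 2; which piece has genus 1 decides the
    order of the summands.\<close>
  ultimately consider "euler_genus_plus x y A.piece = 1" "euler_genus_plus x y B.piece = 2"
    | "euler_genus_plus x y B.piece = 1" "euler_genus_plus x y A.piece = 2" by linarith
  then show ?thesis
  proof cases
    case 1
    then show ?thesis
      using sum cA cB A.piece_nonadj B.piece_nonadj A.connected_piece B.connected_piece
      by (intro exI[of _ A.piece] exI[of _ B.piece]) (simp add: C_nonadj_def)
  next
    case 2
    then show ?thesis
      using xy_sum_commute[OF sum] cA cB A.piece_nonadj B.piece_nonadj A.connected_piece B.connected_piece
      by (intro exI[of _ B.piece] exI[of _ A.piece]) (simp add: C_nonadj_def)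
  qed
qed

theorem theorem5p9:
  fixes x y :: 'a
  shows
    "(\<forall>G G1 G2.
        G1 \<in> G_xy_nonadj x y \<and> connected_graph G1 \<and>
        G2 \<in> G_xy_nonadj x y \<and> connected_graph G2 \<and>
        is_xy_sum x y G G1 G2 \<and>
        G1 \<in> C_nonadj x y 0 \<and> G2 \<in> C_nonadj x y 1
        \<longrightarrow> G \<in> C_nonadj x y 2)
     \<and>
     (\<forall>G.
        two_connected G \<and> G \<in> C_nonadj x y 2 \<and> vertex_cut G {x, y}
        \<longrightarrow> (\<exists>G1 G2.
              G1 \<in> G_xy_nonadj x y \<and> connected_graph G1 \<and>
              G2 \<in> G_xy_nonadj x y \<and> connected_graph G2 \<and>
              is_xy_sum x y G G1 G2 \<and>
              G1 \<in> C_nonadj x y 0 \<and> G2 \<in> C_nonadj x y 1))"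
  by (intro conjI allI impI; elim conjE) (rule critical_sum split_critical; assumption)+

end
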